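(* Let $\varepsilon>0$ and $Q\geq 2$. Then, for all but $\ll_{\varepsilon} 1$ primes $q\in [Q^{1/2}, Q]$, we have $$\min_{a\in \mathbb{Z}_q^{\times}} |\{n\leq x: \ n\equiv a \ (\mathrm{mod}\ q),\ \mu(n)=-1\}| \gg_{\varepsilon} \frac{x}{q}$$ for all $x\geq q^{2+\varepsilon}$. The same holds when the condition $\mu(n) = -1$ is replaced by $\mu(n) = +1$.
   Context: $\mu$ is the M\"obius function and $\mathbb{Z}_q^\times$ is the set of invertible residue classes mod $q$; $n$ ranges over positive integers. $\ll_\varepsilon$, $\gg_\varepsilon$ mean that the implied constant depends only on $\varepsilon$. *)

theory Defs
  imports Complex_Main "HOL-Number_Theory.Number_Theory" "HOL-Computational_Algebra.Squarefree"
begin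

definition moebius_mu :: "nat \<Rightarrow> int" where
  "moebius_mu n = (if squarefree n then (-1) ^ card (prime_factors n) else 0)"

definition moebius_count :: "int \<Rightarrow> real \<Rightarrow> nat \<Rightarrow> nat \<Rightarrow> nat" where
  "moebius_count s x q a =
     card {n::nat. n > 0 \<and> real n \<le> x \<and> [n = a] (mod q) \<and> moebius_mu n = s}"

text \<open>
  The invertible residue classes modulo \<open>q\<close> are represented by \<open>totatives q\<close>, a finite set that is
  nonempty for \<open>q > 0\<close>, so the minimum is a genuine one for every prime \<open>q\<close>.
\<close>

definition min_moebius_count :: "int \<Rightarrow> real \<Rightarrow> nat \<Rightarrow> nat" where
  "min_moebius_count s x q = Min (moebius_count s x q ` totatives q)"

text \<open>
  The moduli violating the lower bound with implied constant \<open>c\<close>. For each real \<open>Q\<close> this is a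
  finite set, so its cardinality is meaningful.
\<close>

definition exceptional_primes :: "int \<Rightarrow> real \<Rightarrow> real \<Rightarrow> real \<Rightarrow> nat set" where
  "exceptional_primes s \<epsilon> c Q =
     {q. prime q \<and> real q \<in> {Q powr (1/2)..Q} \<and>
         \<not> (\<forall>x::real. x \<ge> real q powr (2 + \<epsilon>) \<longrightarrow>
              real (min_moebius_count s x q) \<ge> c * (x / real q))}"

end

theory Submission
  imports Defs "HOL-Analysis.Harmonic_Numbers" "HOL-Real_Asymp.Real_Asymp"
begin

text \<open>
  Count products \<open>n p r\<close> in a residue class modulo \<open>q\<close>, where \<open>n\<close> is squarefree of size slightly larger
  than \<open>q\<close>, \<open>p \<in> (Q\<^sup>\<eta>, Q\<^sup>2\<^sup>\<eta>]\<close> is prime and \<open>r\<close> has no prime factor as small as \<open>n\<close>; every integer has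
  boundedly many such representations. Translation by the primes \<open>p\<close> is an averaging operator on functions
  of the residue class and of the logarithmic scale. If it contracts the functions of mean zero by a small
  constant, the Cauchy-Schwarz inequality gives the expected number of products: the factors \<open>n\<close> are
  bounded in each class trivially and the factors \<open>r\<close> by Selberg's sieve (the lengths of both exceed
  \<open>q\<close>, hence the exponent \<open>2 + \<epsilon>\<close>). Since \<open>\<mu>(2 n) = -\<mu>(n)\<close> for odd \<open>n\<close>, both signs of \<open>\<mu>(n)\<close> are
  available, so \<open>\<mu>(n p r)\<close> can be prescribed. The moduli without contraction are boundedly many by a
  large sieve argument: a high power of the operator is supported on products of \<open>k\<close> primes, which
  exceed \<open>Q\<^sup>4\<close>, and matrix coefficients for different prime moduli are nearly orthogonal there; the Selberg
  majorant avoids a loss of logarithms. No Dirichlet characters or zeros of L-functions are needed.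
\<close>

text \<open>Powers of the logarithm shape the argument. The factors r have density about 1 / ln q
  among the integers, so a single scale of n yields only about x / (q ln q) products. Hence about ln
  q scales of n are treated at once, and the functions to be paired live on scales times residue
  classes. The product of their norms is then O(x / q), the order of the main term, so a contraction
  by a small constant independent of q suffices. The same balance bounds the number of exceptional
  moduli: tuples of k primes occupy O(ln Q) scales, and the Selberg majorant gains a factor 1 / ln Q
  at each of them. The parity obstacle is that the sieve bounds from below the number of squarefree
  r but not of those with a given sign of \<mu>(r). Both signs of r are therefore counted together,
  each combined with the sign of n that gives \<mu>(n p r) the prescribed value.\<close>

lemma sum_inverse_squares_le:
  fixes m n :: nat
  assumes "0 < m"
  shows "(\<Sum>d\<in>{m<..n}. 1 / real d ^ 2) \<le> 1 / real m"
proof -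
  have "(\<Sum>d\<in>{m<..n}. 1 / real d ^ 2) \<le> 1 / real m - 1 / real n" if "m \<le> n"
    using that
  proof (induction n rule: dec_induct)
    case base
    then show ?case by simp
  next
    case (step n)
    have "{m<..Suc n} = insert (Suc n) {m<..n}" using step by auto
    hence "(\<Sum>d\<in>{m<..Suc n}. 1 / real d ^ 2) = 1 / real (Suc n) ^ 2 + (\<Sum>d\<in>{m<..n}. 1 / real d ^ 2)"
      by simp
    also have "\<dots> \<le> 1 / real (Suc n) ^ 2 + (1 / real m - 1 / real n)" using step by simp
    also have "1 / real (Suc n) ^ 2 \<le> 1 / real n - 1 / real (Suc n)"
    proof -
      have n: "0 < n" using step assms by simp
      have "1 / real n - 1 / real (Suc n) = 1 / (real n * real (Suc n))"
        using n by (simp add: field_simps)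
      moreover have "1 / (real (Suc n) ^ 2) \<le> 1 / (real n * real (Suc n))"
        using n by (intro divide_left_mono) (auto simp: power2_eq_square)
      ultimately show ?thesis by simp
    qed
    finally show ?case by simp
  qed
  moreover have "1 / real m - 1 / real n \<le> 1 / real m" by simp
  ultimately show ?thesis by (cases "m \<le> n") (auto intro: order_trans)
qed

section \<open>The Moebius function: multiplicativity and divisor sums\<close>

lemma moebius_mu_1 [simp]: "moebius_mu (Suc 0) = 1"
  by (simp add: moebius_mu_def)

lemma moebius_mu_prime: "prime p \<Longrightarrow> moebius_mu p = -1"
  by (auto simp: moebius_mu_def squarefree_prime prime_prime_factors)

lemma moebius_mu_mult:
  assumes "coprime a b"
  shows "moebius_mu (a * b) = moebius_mu a * moebius_mu b"
proof (cases "squarefree a \<and> squarefree b")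
  case True
  hence nz: "a \<noteq> 0" "b \<noteq> 0" by (metis not_squarefree_0)+
  have "prime_factors (a * b) = prime_factors a \<union> prime_factors b"
    using nz by (simp add: prime_factors_product)
  moreover have "prime_factors a \<inter> prime_factors b = {}"
  proof -
    have False if "prime p" "p dvd a" "p dvd b" for p
      using that coprime_common_divisor[OF assms, of p] by simp
    thus ?thesis by (auto simp: in_prime_factors_iff)
  qed
  ultimately have "card (prime_factors (a * b)) = card (prime_factors a) + card (prime_factors b)"
    by (simp add: card_Un_disjoint)
  moreover have "squarefree (a * b)"
    using True assms by (simp add: squarefree_mult_coprime)
  ultimately show ?thesis using True by (simp add: moebius_mu_def power_add)
next
  case False
  hence "\<not> squarefree (a * b)" by (metis squarefree_multD)
  thus ?thesis using False by (auto simp: moebius_mu_def)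
qed

lemma moebius_mu_square: "squarefree n \<Longrightarrow> moebius_mu n ^ 2 = 1"
  by (simp add: moebius_mu_def flip: power_mult)

lemma abs_moebius_mu_le: "\<bar>moebius_mu n\<bar> \<le> 1"
  by (simp add: moebius_mu_def)

lemma moebius_mu_cases: "squarefree n \<Longrightarrow> moebius_mu n = 1 \<or> moebius_mu n = -1"
  using moebius_mu_square[of n] by (simp add: power2_eq_1_iff)

lemma squarefree_mult_nat_coprime:
  fixes a b :: nat
  assumes "squarefree (a * b)"
  shows "coprime a b"
proof (rule ccontr)
  assume "\<not> coprime a b"
  hence "gcd a b \<noteq> 1" using coprime_iff_gcd_eq_1 by blast
  then obtain p where p: "prime p" "p dvd gcd a b" using prime_factor_nat by blast
  hence "p dvd a" "p dvd b" by simp_all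
  hence "p ^ 2 dvd a * b" by (simp add: mult_dvd_mono power2_eq_square)
  with assms have "p dvd 1" by (rule squarefreeD)
  with p show False by simp
qed

lemma sum_moebius_mu_divisors:
  assumes "squarefree n"
  shows "(\<Sum>d | d dvd n. moebius_mu d) = (if n = 1 then 1 else 0)"
proof (cases "n = 1")
  case False
  have n0: "n \<noteq> 0" using assms by (metis not_squarefree_0)
  from False obtain p where p: "prime p" "p dvd n" using prime_factor_nat by blast
  then obtain m where m: "n = p * m" by blast
  have cop: "coprime p m" using squarefree_mult_nat_coprime assms m by blast
  have m0: "m \<noteq> 0" using n0 m by auto
  have p0: "p \<noteq> 0" using p by auto
  \<comment> \<open>Fixing one prime \<open>p\<close> of \<open>n\<close> pairs every divisor
    \<open>d\<close> of \<open>m\<close> with \<open>p * d\<close>, whose Moebius value is the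
    opposite one.\<close>
  have eq: "{d. d dvd n} = {d. d dvd m} \<union> (*) p ` {d. d dvd m}"
  proof (intro equalityI subsetI)
    fix d assume d: "d \<in> {d. d dvd n}"
    show "d \<in> {d. d dvd m} \<union> (*) p ` {d. d dvd m}"
    proof (cases "p dvd d")
      case True
      then obtain e where "d = p * e" by blast
      with d m p0 show ?thesis by auto
    next
      case False
      hence "coprime d p" using p prime_imp_coprime[of p d] by (simp add: coprime_commute)
      with d m have "d dvd m" by (simp add: coprime_dvd_mult_right_iff)
      thus ?thesis by simp
    qed
  qed (use m in auto)
  have disj: "{d. d dvd m} \<inter> (*) p ` {d. d dvd m} = {}"
  proof -
    have "\<not> p * d dvd m" for d
      using coprime_common_divisor[OF cop, of p] p dvd_mult_left[of p d m] by auto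
    thus ?thesis by auto
  qed
  have "(\<Sum>d | d dvd n. moebius_mu d) = (\<Sum>d | d dvd m. moebius_mu d) + (\<Sum>d\<in>(*) p ` {d. d dvd m}. moebius_mu d)"
    unfolding eq using m0 disj by (intro sum.union_disjoint) (auto simp: finite_divisors_nat)
  also have "(\<Sum>d\<in>(*) p ` {d. d dvd m}. moebius_mu d) = (\<Sum>d | d dvd m. moebius_mu (p * d))"
    using p0 by (subst sum.reindex) (auto simp: inj_on_def)
  also have "\<dots> = (\<Sum>d | d dvd m. - moebius_mu d)"
  proof (rule sum.cong)
    fix d assume "d \<in> {d. d dvd m}"
    hence "coprime p d" using cop using coprime_divisors[OF dvd_refl] by blast
    thus "moebius_mu (p * d) = - moebius_mu d"
      using p by (simp add: moebius_mu_mult moebius_mu_prime)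
  qed auto
  finally show ?thesis using False by (simp add: sum_negf)
next
  case True
  have "{d::nat. d dvd 1} = {1}" by auto
  thus ?thesis using True by simp
qed

section \<open>Selberg's sieve\<close>

definition squarefrees :: "nat \<Rightarrow> nat set" where
  "squarefrees D = {d\<in>{1..D}. squarefree d}"

definition selberg_G :: "nat \<Rightarrow> real" where
  "selberg_G D = (\<Sum>d\<in>squarefrees D. 1 / real (totient d))"

text \<open>Selberg's optimal weights for sieving by all primes up to \<open>D\<close>: the explicit
  minimiser of the quadratic form with coefficients 1 / lcm d e under the normalisation that the
  weight of 1 is 1.\<close>

definition selberg_lambda :: "nat \<Rightarrow> nat \<Rightarrow> real" where
  "selberg_lambda D d = of_int (moebius_mu d) * real d / selberg_G D *
     (\<Sum>l\<in>squarefrees D. if d dvd l then 1 / real (totient l) else 0)"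

definition selberg_beta :: "nat \<Rightarrow> nat \<Rightarrow> real" where
  "selberg_beta D n = (\<Sum>d\<in>squarefrees D. if d dvd n then selberg_lambda D d else 0) ^ 2"

definition rough :: "real \<Rightarrow> nat \<Rightarrow> bool" where
  "rough y n \<longleftrightarrow> n > 0 \<and> (\<forall>p. prime p \<longrightarrow> p dvd n \<longrightarrow> y < real p)"

lemma finite_squarefrees [simp]: "finite (squarefrees D)"
  by (simp add: squarefrees_def)

lemma squarefreesD: "d \<in> squarefrees D \<Longrightarrow> 1 \<le> d \<and> d \<le> D \<and> squarefree d"
  by (simp add: squarefrees_def)

lemma one_in_squarefrees [simp]: "1 \<le> D \<Longrightarrow> Suc 0 \<in> squarefrees D"
  by (simp add: squarefrees_def)

lemma totient_pos_real: "d \<in> squarefrees D \<Longrightarrow> 0 < real (totient d)"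
  using squarefreesD by fastforce

lemma selberg_G_pos: "1 \<le> D \<Longrightarrow> 0 < selberg_G D"
  unfolding selberg_G_def
  using totient_pos_real by (intro sum_pos2[of _ "Suc 0"]) auto

lemma selberg_lambda_1: "1 \<le> D \<Longrightarrow> selberg_lambda D (Suc 0) = 1"
  using selberg_G_pos[of D] by (simp add: selberg_lambda_def flip: selberg_G_def)

text \<open>The inner sum is a part of \<open>selberg_G D\<close>. The bound enters error terms
  only, where powers of \<open>D\<close> are affordable because \<open>D\<close> is chosen as a
  small power of the main parameter.\<close>

lemma abs_selberg_lambda_le:
  assumes "1 \<le> D" "d \<in> squarefrees D"
  shows "\<bar>selberg_lambda D d\<bar> \<le> real D"
proof -
  define T where "T = (\<Sum>l\<in>squarefrees D. if d dvd l then 1 / real (totient l) else 0)"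
  have T: "0 \<le> T" "T \<le> selberg_G D" unfolding T_def selberg_G_def
    by (auto intro!: sum_nonneg sum_mono)
  have G: "0 < selberg_G D" using assms selberg_G_pos by simp
  have "\<bar>selberg_lambda D d\<bar> = \<bar>of_int (moebius_mu d)\<bar> * real d * (T / selberg_G D)"
    using T G by (simp add: selberg_lambda_def abs_mult flip: T_def)
  also have "\<dots> \<le> 1 * real D * 1"
  proof (intro mult_mono)
    show "\<bar>real_of_int (moebius_mu d)\<bar> \<le> 1" using abs_moebius_mu_le[of d] by linarith
    show "T / selberg_G D \<le> 1" using T G by simp
  qed (use assms squarefreesD T G in auto)
  finally show ?thesis by simp
qed

lemma selberg_beta_nonneg: "0 \<le> selberg_beta D n"
  by (simp add: selberg_beta_def)

text \<open>The only divisor of a \<open>D\<close>-rough number up to \<open>D\<close> is 1. Being a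
  square, \<open>selberg_beta D\<close> thus majorises the indicator of the \<open>D\<close>-rough
  numbers.\<close>

lemma selberg_beta_rough:
  assumes "1 \<le> D" "rough (real D) n"
  shows "selberg_beta D n = 1"
proof -
  have "(\<Sum>d\<in>squarefrees D. if d dvd n then selberg_lambda D d else 0) =
        (\<Sum>d\<in>{Suc 0}. if d dvd n then selberg_lambda D d else 0)"
  proof (rule sum.mono_neutral_right)
    show "\<forall>d\<in>squarefrees D - {Suc 0}. (if d dvd n then selberg_lambda D d else 0) = 0"
    proof
      fix d assume d: "d \<in> squarefrees D - {Suc 0}"
      hence "d \<noteq> 1" by auto
      then obtain p where p: "prime p" "p dvd d" using prime_factor_nat by blast
      have "p \<le> D" using d p squarefreesD[of d D] by (auto dest: dvd_imp_le)
      hence "\<not> d dvd n" using p assms(2) unfolding rough_def by (meson dvd_trans not_less of_nat_le_iff)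
      thus "(if d dvd n then selberg_lambda D d else 0) = 0" by simp
    qed
  qed (use assms in auto)
  thus ?thesis using assms by (simp add: selberg_beta_def selberg_lambda_1)
qed

text \<open>Writing \<open>d = l * e\<close> leaves a full divisor sum of the Moebius function over
  k / l: Moebius inversion between multiples and divisors.\<close>

lemma sum_moebius_mu_between:
  assumes "l \<in> squarefrees D" "k \<in> squarefrees D"
  shows "(\<Sum>d\<in>squarefrees D. if l dvd d \<and> d dvd k then moebius_mu d else 0) = (if k = l then moebius_mu l else 0)"
proof (cases "l dvd k")
  case False
  hence "(if l dvd d \<and> d dvd k then moebius_mu d else 0) = 0" for d using dvd_trans by auto
  hence "(\<Sum>d\<in>squarefrees D. if l dvd d \<and> d dvd k then moebius_mu d else 0) = 0" by (intro sum.neutral) blast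
  thus ?thesis using False by auto
next
  case True
  then obtain m where m: "k = l * m" by blast
  have k: "k \<noteq> 0" "k \<le> D" "squarefree k" using assms squarefreesD[of k D] by auto
  have l0: "l \<noteq> 0" and m0: "m \<noteq> 0" using k m by auto
  have sm: "squarefree m" using k m squarefree_multD by blast
  have cop: "coprime l m" using squarefree_mult_nat_coprime k m by blast
  have eq: "{d\<in>squarefrees D. l dvd d \<and> d dvd k} = (*) l ` {e. e dvd m}"
  proof (intro equalityI subsetI)
    fix d assume "d \<in> (*) l ` {e. e dvd m}"
    then obtain e where e: "d = l * e" "e dvd m" by auto
    hence "d dvd k" using m by simp
    moreover have "d \<noteq> 0" using e l0 m0 by auto
    moreover have "d \<le> D" using \<open>d dvd k\<close> k dvd_imp_le[of d k] by linarith
    moreover have "squarefree d" using \<open>d dvd k\<close> k squarefree_mono by blast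
    ultimately show "d \<in> {d\<in>squarefrees D. l dvd d \<and> d dvd k}"
      using e by (auto simp: squarefrees_def)
  qed (use m l0 in auto)
  have "(\<Sum>d\<in>squarefrees D. if l dvd d \<and> d dvd k then moebius_mu d else 0) = (\<Sum>d\<in>{d\<in>squarefrees D. l dvd d \<and> d dvd k}. moebius_mu d)"
    by (simp add: sum.inter_filter)
  also have "\<dots> = (\<Sum>e | e dvd m. moebius_mu (l * e))"
    unfolding eq using l0 by (subst sum.reindex) (auto simp: inj_on_def)
  also have "\<dots> = (\<Sum>e | e dvd m. moebius_mu l * moebius_mu e)"
  proof (rule sum.cong)
    fix e assume "e \<in> {e. e dvd m}"
    hence "coprime l e" using cop using coprime_divisors[OF dvd_refl] by blast
    thus "moebius_mu (l * e) = moebius_mu l * moebius_mu e" by (rule moebius_mu_mult)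
  qed auto
  also have "\<dots> = moebius_mu l * (if m = 1 then 1 else 0)"
    using sum_moebius_mu_divisors[OF sm] by (simp flip: sum_distrib_left)
  finally show ?thesis using m l0 by auto
qed

text \<open>Dual Moebius inversion of the sum that defines \<open>selberg_lambda\<close>. The
  left-hand sides are the coordinates in which the sieve form is diagonal.\<close>

lemma selberg_diagonalise:
  assumes "1 \<le> D" "l \<in> squarefrees D"
  shows "(\<Sum>d\<in>squarefrees D. if l dvd d then selberg_lambda D d / real d else 0)
           = of_int (moebius_mu l) / (selberg_G D * real (totient l))"
proof -
  have "(\<Sum>d\<in>squarefrees D. if l dvd d then selberg_lambda D d / real d else 0)
     = (\<Sum>d\<in>squarefrees D. \<Sum>k\<in>squarefrees D. (1 / (selberg_G D * real (totient k))) * of_int (if l dvd d \<and> d dvd k then moebius_mu d else 0))"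
  proof (rule sum.cong)
    fix d assume "d \<in> squarefrees D"
    hence d: "d \<noteq> 0" using squarefreesD[of d] by force
    show "(if l dvd d then selberg_lambda D d / real d else 0) =
      (\<Sum>k\<in>squarefrees D. (1 / (selberg_G D * real (totient k))) * of_int (if l dvd d \<and> d dvd k then moebius_mu d else 0))"
    proof (cases "l dvd d")
      case True
      have "selberg_lambda D d / real d = of_int (moebius_mu d) / selberg_G D * (\<Sum>k\<in>squarefrees D. if d dvd k then 1 / real (totient k) else 0)"
        using d by (simp add: selberg_lambda_def)
      thus ?thesis using True by (auto simp: sum_distrib_left intro!: sum.cong)
    qed simp
  qed simp
  also have "\<dots> = (\<Sum>k\<in>squarefrees D. (1 / (selberg_G D * real (totient k))) *
      of_int (\<Sum>d\<in>squarefrees D. if l dvd d \<and> d dvd k then moebius_mu d else 0))"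
    by (subst sum.swap) (simp only: sum_distrib_left of_int_sum)
  also have "\<dots> = (\<Sum>k\<in>squarefrees D. (1 / (selberg_G D * real (totient k))) * of_int (if k = l then moebius_mu l else 0))"
    using assms by (intro sum.cong refl) (simp only: sum_moebius_mu_between)
  also have "\<dots> = (\<Sum>k\<in>squarefrees D. if k = l then of_int (moebius_mu l) / (selberg_G D * real (totient l)) else 0)"
    by (intro sum.cong) auto
  also have "\<dots> = of_int (moebius_mu l) / (selberg_G D * real (totient l))"
    using assms by simp
  finally show ?thesis .
qed

text \<open>Gauss's identity for the totient over common divisors. It separates the variables in 1 /
  lcm d e = gcd d e / (d e).\<close>

lemma gcd_eq_sum_totient:
  assumes "d \<in> squarefrees D" "e \<in> squarefrees D"
  shows "real (gcd d e) = (\<Sum>l\<in>squarefrees D. if l dvd d \<and> l dvd e then real (totient l) else 0)"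
proof -
  have d: "d \<noteq> 0" "d \<le> D" "squarefree d" using assms squarefreesD[of d D] by auto
  have "{l\<in>squarefrees D. l dvd d \<and> l dvd e} = {l. l dvd gcd d e}"
  proof (intro equalityI subsetI)
    fix l assume l: "l \<in> {l. l dvd gcd d e}"
    hence "l dvd d" by simp
    hence "l \<noteq> 0" "l \<le> D" "squarefree l"
      using d dvd_imp_le[of l d] squarefree_mono by (auto intro: order_trans)
    thus "l \<in> {l\<in>squarefrees D. l dvd d \<and> l dvd e}" using l by (auto simp: squarefrees_def)
  qed auto
  moreover have "real (gcd d e) = real (\<Sum>l | l dvd gcd d e. totient l)"
    by (simp only: totient_divisor_sum)
  ultimately have "real (gcd d e) = (\<Sum>l\<in>{l\<in>squarefrees D. l dvd d \<and> l dvd e}. real (totient l))" by simp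
  thus ?thesis by (simp only: sum.inter_filter finite_squarefrees)
qed

text \<open>Expanding the gcd into totients turns the form into a sum of squares with weights
  \<open>totient l\<close>; the diagonal coordinates are known, and the sum collapses to
  \<open>selberg_G D\<close> over its square.\<close>

lemma selberg_quadratic_form:
  assumes "1 \<le> D"
  shows "(\<Sum>d\<in>squarefrees D. \<Sum>e\<in>squarefrees D. selberg_lambda D d * selberg_lambda D e / real (lcm d e)) = 1 / selberg_G D"
proof -
  define A where "A = squarefrees D"
  define lam where "lam = selberg_lambda D"
  have "(\<Sum>d\<in>A. \<Sum>e\<in>A. lam d * lam e / real (lcm d e)) =
    (\<Sum>d\<in>A. \<Sum>e\<in>A. \<Sum>l\<in>A. real (totient l) * ((if l dvd d then lam d / real d else 0) * (if l dvd e then lam e / real e else 0)))"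
  proof (intro sum.cong refl)
    fix d e assume de: "d \<in> A" "e \<in> A"
    hence nz: "d \<noteq> 0" "e \<noteq> 0" using squarefreesD[of d D] squarefreesD[of e D] by (auto simp: A_def)
    have "real (lcm d e) * real (gcd d e) = real d * real e"
      by (simp flip: of_nat_mult)
    moreover have "real (lcm d e) \<noteq> 0" using nz by simp
    ultimately have "lam d * lam e / real (lcm d e) = lam d / real d * (lam e / real e) * real (gcd d e)"
      using nz by (simp add: field_simps)
    also have "\<dots> = (\<Sum>l\<in>A. lam d / real d * (lam e / real e) * (if l dvd d \<and> l dvd e then real (totient l) else 0))"
      using de unfolding A_def by (simp only: gcd_eq_sum_totient sum_distrib_left)
    also have "\<dots> = (\<Sum>l\<in>A. real (totient l) * ((if l dvd d then lam d / real d else 0) * (if l dvd e then lam e / real e else 0)))"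
      by (intro sum.cong) auto
    finally show "lam d * lam e / real (lcm d e) = \<dots>" .
  qed
  also have "\<dots> = (\<Sum>d\<in>A. \<Sum>l\<in>A. \<Sum>e\<in>A. real (totient l) * ((if l dvd d then lam d / real d else 0) * (if l dvd e then lam e / real e else 0)))"
    by (intro sum.cong refl sum.swap)
  also have "\<dots> = (\<Sum>l\<in>A. \<Sum>d\<in>A. \<Sum>e\<in>A. real (totient l) * ((if l dvd d then lam d / real d else 0) * (if l dvd e then lam e / real e else 0)))"
    by (rule sum.swap)
  also have "\<dots> = (\<Sum>l\<in>A. real (totient l) * (\<Sum>d\<in>A. if l dvd d then lam d / real d else 0) ^ 2)"
    by (simp only: power2_eq_square sum_product flip: sum_distrib_left)
  also have "\<dots> = (\<Sum>l\<in>A. 1 / selberg_G D ^ 2 * (1 / real (totient l)))"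
  proof (rule sum.cong)
    fix l assume l: "l \<in> A"
    have t: "0 < real (totient l)" using l totient_pos_real A_def by blast
    have "moebius_mu l ^ 2 = 1"
      using l squarefreesD[of l D] by (simp add: A_def moebius_mu_square)
    hence mu: "(of_int (moebius_mu l) :: real) ^ 2 = 1"
      by (simp flip: of_int_power)
    have "(\<Sum>d\<in>A. if l dvd d then lam d / real d else 0) = of_int (moebius_mu l) / (selberg_G D * real (totient l))"
      using selberg_diagonalise[OF assms, of l] l unfolding A_def lam_def by blast
    thus "real (totient l) * (\<Sum>d\<in>A. if l dvd d then lam d / real d else 0) ^ 2 = 1 / selberg_G D ^ 2 * (1 / real (totient l))"
      using t by (simp only: power_divide power_mult_distrib mu) (simp add: power2_eq_square)
  qed simp
  also have "\<dots> = 1 / selberg_G D ^ 2 * selberg_G D"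
    unfolding sum_distrib_left[symmetric] by (simp only: A_def flip: selberg_G_def)
  also have "\<dots> = 1 / selberg_G D"
    using selberg_G_pos[OF assms] by (simp add: power2_eq_square)
  finally show ?thesis by (simp add: A_def lam_def)
qed

text \<open>The weight \<open>u\<close> is arbitrary because it will be the indicator of a residue
  class in the sieve and a product of two periodic functions in the large sieve.\<close>

lemma sum_selberg_beta:
  fixes u :: "nat \<Rightarrow> real"
  shows "(\<Sum>n\<in>A. selberg_beta D n * u n) =
    (\<Sum>d\<in>squarefrees D. \<Sum>e\<in>squarefrees D. selberg_lambda D d * selberg_lambda D e *
        (\<Sum>n\<in>A. if lcm d e dvd n then u n else 0))"
proof -
  define S where "S = squarefrees D"
  define lam where "lam = selberg_lambda D"
  have "(\<Sum>n\<in>A. selberg_beta D n * u n) =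
     (\<Sum>n\<in>A. \<Sum>d\<in>S. \<Sum>e\<in>S. lam d * lam e * (if lcm d e dvd n then u n else 0))"
  proof (rule sum.cong[OF refl])
    fix n
    have "selberg_beta D n * u n = (\<Sum>d\<in>S. \<Sum>e\<in>S. (if d dvd n then lam d else 0) * (if e dvd n then lam e else 0)) * u n"
      by (simp only: selberg_beta_def power2_eq_square sum_product S_def lam_def)
    also have "\<dots> = (\<Sum>d\<in>S. \<Sum>e\<in>S. lam d * lam e * (if lcm d e dvd n then u n else 0))"
      unfolding sum_distrib_right by (intro sum.cong refl) auto
    finally show "selberg_beta D n * u n = \<dots>" .
  qed
  also have "\<dots> = (\<Sum>d\<in>S. \<Sum>n\<in>A. \<Sum>e\<in>S. lam d * lam e * (if lcm d e dvd n then u n else 0))"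
    by (rule sum.swap)
  also have "\<dots> = (\<Sum>d\<in>S. \<Sum>e\<in>S. \<Sum>n\<in>A. lam d * lam e * (if lcm d e dvd n then u n else 0))"
    by (intro sum.cong refl sum.swap)
  finally show ?thesis by (simp add: sum_distrib_left S_def lam_def)
qed

text \<open>Every \<open>n\<close> is a squarefree \<open>d\<close> times a square
  \<open>e ^ 2\<close>, with \<open>d\<close> and \<open>e\<close> at most \<open>D\<close>, and the
  pair determines \<open>n\<close>.\<close>

lemma sum_inverse_le_squarefree_mult_squares:
  "(\<Sum>n\<in>{1..D}. 1 / real n) \<le> (\<Sum>d\<in>squarefrees D. 1 / real d) * (\<Sum>e\<in>{1..D}. 1 / real e ^ 2)"
proof -
  define f where "f n = (squarefree_part n, square_part n)" for n :: nat
  have dec: "squarefree_part n * square_part n ^ 2 = n" for n :: nat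
    using squarefree_decompose[of n] by simp
  have inj: "inj_on f {1..D}"
    by (rule inj_on_inverseI[where g = "\<lambda>(d, e). d * e ^ 2"]) (simp add: f_def dec)
  have sub: "f ` {1..D} \<subseteq> squarefrees D \<times> {1..D}"
  proof
    fix x assume "x \<in> f ` {1..D}"
    then obtain n where n: "n \<in> {1..D}" "x = f n" by auto
    have "squarefree_part n dvd squarefree_part n * square_part n ^ 2"
      "square_part n dvd squarefree_part n * square_part n ^ 2"
      by (simp_all add: power2_eq_square)
    hence "squarefree_part n dvd n" "square_part n dvd n"
      by (simp_all only: dec)
    hence "squarefree_part n \<le> n" "square_part n \<le> n" "square_part n \<noteq> 0" "squarefree_part n \<noteq> 0"
      using n by (auto intro: dvd_imp_le simp del: One_nat_def)
    moreover from this have "1 \<le> squarefree_part n" "1 \<le> square_part n" by linarith+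
    ultimately show "x \<in> squarefrees D \<times> {1..D}"
      using n squarefree_squarefree_part[of n] by (auto simp: f_def squarefrees_def)
  qed
  have "(\<Sum>n\<in>{1..D}. 1 / real n) = (\<Sum>n\<in>{1..D}. (case f n of (d, e) \<Rightarrow> 1 / real d * (1 / real e ^ 2)))"
    by (intro sum.cong) (simp_all add: f_def dec flip: of_nat_mult of_nat_power)
  also have "\<dots> = (\<Sum>(d, e)\<in>f ` {1..D}. 1 / real d * (1 / real e ^ 2))"
    using inj by (simp add: sum.reindex)
  also have "\<dots> \<le> (\<Sum>(d, e)\<in>squarefrees D \<times> {1..D}. 1 / real d * (1 / real e ^ 2))"
    using sub by (intro sum_mono2) auto
  also have "\<dots> = (\<Sum>d\<in>squarefrees D. 1 / real d) * (\<Sum>e\<in>{1..D}. 1 / real e ^ 2)"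
    by (simp add: sum_product sum.cartesian_product)
  finally show ?thesis .
qed

lemma sum_inverse_squarefrees_ge: "ln (real D + 1) / 2 \<le> (\<Sum>d\<in>squarefrees D. 1 / real d)"
proof (cases "D = 0")
  case False
  \<comment> \<open>The squares contribute at most 1 + 1, which is the origin of the division by
    2.\<close>
  have "(\<Sum>e\<in>{1..D}. 1 / real e ^ 2) = 1 + (\<Sum>e\<in>{1<..D}. 1 / real e ^ 2)"
    using False by (subst sum.atLeast_Suc_atMost) (auto simp: atLeastSucAtMost_greaterThanAtMost)
  also have "\<dots> \<le> 2" using sum_inverse_squares_le[of 1 D] by simp
  finally have two: "(\<Sum>e\<in>{1..D}. 1 / real e ^ 2) \<le> 2" .
  have "ln (real D + 1) \<le> (\<Sum>n\<in>{1..D}. 1 / real n)"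
    using ln_le_harm[of D] by (simp add: harm_def divide_inverse)
  also have "\<dots> \<le> (\<Sum>d\<in>squarefrees D. 1 / real d) * (\<Sum>e\<in>{1..D}. 1 / real e ^ 2)"
    by (rule sum_inverse_le_squarefree_mult_squares)
  also have "\<dots> \<le> (\<Sum>d\<in>squarefrees D. 1 / real d) * 2"
    using two by (intro mult_left_mono sum_nonneg) auto
  finally show ?thesis by simp
qed (simp add: sum_nonneg)

lemma selberg_G_ge: "ln (real D + 1) / 2 \<le> selberg_G D"
proof -
  have "(\<Sum>d\<in>squarefrees D. 1 / real d) \<le> selberg_G D"
    unfolding selberg_G_def
  proof (rule sum_mono)
    fix d assume d: "d \<in> squarefrees D"
    have "totient d \<le> d" by (rule totient_le)
    thus "1 / real d \<le> 1 / real (totient d)"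
      using totient_pos_real[OF d] by (intro divide_left_mono) auto
  qed
  thus ?thesis using sum_inverse_squarefrees_ge[of D] by linarith
qed

section \<open>Counting and sieving in residue classes\<close>

lemma card_residue_class:
  fixes Y k r :: nat
  assumes "0 < k"
  shows "\<bar>real (card {n\<in>{1..Y}. [n = r] (mod k)}) - real Y / real k\<bar> \<le> 1"
proof -
  define A where "A = {n\<in>{1..Y}. [n = r] (mod k)}"
  have fin: "finite A" by (simp add: A_def)
  have "inj_on (\<lambda>n. n div k) A"
  proof (rule inj_onI)
    fix m n assume "m \<in> A" "n \<in> A" "m div k = n div k"
    moreover from this have "m mod k = n mod k" by (simp add: A_def Cong.cong_def)
    ultimately show "m = n" by (metis div_mult_mod_eq)
  qed
  moreover have "(\<lambda>n. n div k) ` A \<subseteq> {0..Y div k}"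
    by (auto simp: A_def div_le_mono)
  ultimately have up: "card A \<le> Y div k + 1"
    using card_inj_on_le[of "\<lambda>n. n div k" A "{0..Y div k}"] by simp
  \<comment> \<open>Least positive representative: the count starts at 1, so the zero class is
    represented by \<open>k\<close>.\<close>
  define s where "s = (if r mod k = 0 then k else r mod k)"
  have s: "1 \<le> s" "s \<le> k" "[s = r] (mod k)"
    using assms by (auto simp: s_def Cong.cong_def less_imp_le)
  have "inj_on (\<lambda>t. t * k + s) {..<Y div k}" using assms by (auto simp: inj_on_def)
  moreover have "(\<lambda>t. t * k + s) ` {..<Y div k} \<subseteq> A"
  proof (rule image_subsetI)
    fix t assume "t \<in> {..<Y div k}"
    hence "(t + 1) * k \<le> Y div k * k" by (intro mult_right_mono) auto
    also have "\<dots> \<le> Y" by simp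
    finally have "t * k + s \<le> Y" using s by simp
    thus "t * k + s \<in> A" using s by (auto simp: A_def Cong.cong_def)
  qed
  ultimately have lo: "Y div k \<le> card A"
    using card_inj_on_le[of "\<lambda>t. t * k + s" "{..<Y div k}" A] fin by simp
  have "real (Y div k) \<le> real Y / real k" by (rule of_nat_div_le_of_nat)
  moreover have "real Y / real k - 1 \<le> real (Y div k)"
  proof -
    have "Y < (Y div k + 1) * k" using assms by (metis Suc_eq_plus1 dividend_less_div_times mult.commute mult_Suc_right add.commute)
    hence "real Y < (real (Y div k) + 1) * real k" 
      by (metis of_nat_1 of_nat_add of_nat_less_iff of_nat_mult)
    thus ?thesis using assms by (simp add: field_simps)
  qed
  ultimately show ?thesis using up lo unfolding A_def[symmetric] by linarith
qed

lemma card_residue_class_multiples: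
  fixes Y q e c :: nat
  assumes "0 < q" "0 < e" "coprime e q"
  shows "\<bar>real (card {n\<in>{1..Y}. e dvd n \<and> [n = c] (mod q)}) - real Y / (real q * real e)\<bar> \<le> 1"
proof -
  obtain r where r: "[r = 0] (mod e)" "[r = c] (mod q)"
    using binary_chinese_remainder_nat[OF assms(3)] by blast
  have "e dvd n \<and> [n = c] (mod q) \<longleftrightarrow> [n = r] (mod (e * q))" for n
  proof
    assume "e dvd n \<and> [n = c] (mod q)"
    hence "[n = r] (mod e)" "[n = r] (mod q)"
      using r by (auto simp: Cong.cong_def)
    thus "[n = r] (mod (e * q))" using assms(3) by (intro coprime_cong_mult_nat)
  next
    assume "[n = r] (mod (e * q))"
    hence "[n = r] (mod e)" "[n = r] (mod q)"
      using cong_modulus_mult_nat by (blast, metis cong_modulus_mult_nat mult.commute)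
    thus "e dvd n \<and> [n = c] (mod q)" using r by (metis cong_0_iff cong_trans)
  qed
  thus ?thesis using card_residue_class[of "e * q" Y r] assms by (simp add: mult.commute)
qed

lemma sum_abs_selberg_lambda_le:
  assumes "1 \<le> D"
  shows "(\<Sum>d\<in>squarefrees D. \<bar>selberg_lambda D d\<bar>) \<le> real D ^ 2"
proof -
  have "(\<Sum>d\<in>squarefrees D. \<bar>selberg_lambda D d\<bar>) \<le> of_nat (card (squarefrees D)) * real D"
    using abs_selberg_lambda_le[OF assms] by (rule sum_bounded_above)
  also have "card (squarefrees D) \<le> D"
  proof -
    have "squarefrees D \<subseteq> {1..D}" by (auto simp: squarefrees_def)
    thus ?thesis using card_mono[of "{1..D}" "squarefrees D"] by simp
  qed
  finally show ?thesis by (simp add: power2_eq_square mult_right_mono)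
qed

lemma abs_double_sum_selberg_lambda_le:
  fixes h :: "nat \<Rightarrow> nat \<Rightarrow> real"
  assumes "1 \<le> D" and h: "\<And>d e. d \<in> squarefrees D \<Longrightarrow> e \<in> squarefrees D \<Longrightarrow> \<bar>h d e\<bar> \<le> M"
  shows "\<bar>\<Sum>d\<in>squarefrees D. \<Sum>e\<in>squarefrees D. selberg_lambda D d * selberg_lambda D e * h d e\<bar> \<le> real D ^ 4 * M"
proof -
  define S where "S = squarefrees D"
  define lam where "lam = selberg_lambda D"
  have M: "0 \<le> M" using h[of 1 1] assms(1) by (simp add: order_trans[OF abs_ge_zero])
  have "\<bar>\<Sum>d\<in>S. \<Sum>e\<in>S. lam d * lam e * h d e\<bar> \<le> (\<Sum>d\<in>S. \<Sum>e\<in>S. \<bar>lam d * lam e * h d e\<bar>)"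
    by (rule order_trans[OF sum_abs sum_mono[OF sum_abs]])
  also have "\<dots> \<le> (\<Sum>d\<in>S. \<Sum>e\<in>S. \<bar>lam d\<bar> * \<bar>lam e\<bar> * M)"
    using h by (intro sum_mono) (auto simp: abs_mult S_def intro!: mult_left_mono)
  also have "\<dots> = (\<Sum>d\<in>S. \<bar>lam d\<bar>) * (\<Sum>d\<in>S. \<bar>lam d\<bar>) * M"
    unfolding sum_product by (simp only: sum_distrib_right)
  also have "\<dots> \<le> real D ^ 2 * real D ^ 2 * M"
    using sum_abs_selberg_lambda_le[OF assms(1)] M unfolding S_def lam_def
    by (intro mult_mono sum_nonneg mult_right_mono) auto
  also have "\<dots> = real D ^ 4 * M" by (simp flip: power_add)
  finally show ?thesis by (simp add: S_def lam_def)
qed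

text \<open>A bound of Brun-Titchmarsh type. By the Chinese remainder theorem each pair of weights
  sees one residue class, counted up to an error of 1. The main parts add up to the quadratic form;
  the errors are bounded by the square of the sum of the absolute weights.\<close>

lemma sum_selberg_beta_residue_class_le:
  assumes "1 \<le> D" "0 < q" and cop: "\<And>d. d \<in> {1..D} \<Longrightarrow> coprime d q"
  shows "(\<Sum>n\<in>{1..Y}. selberg_beta D n * (if [n = c] (mod q) then 1 else 0))
          \<le> real Y / (real q * selberg_G D) + real D ^ 4"
proof -
  define S where "S = squarefrees D"
  define lam where "lam = selberg_lambda D"
  define N where "N e = real (card {n\<in>{1..Y}. e dvd n \<and> [n = c] (mod q)})" for e
  define h where "h d e = N (lcm d e) - real Y / (real q * real (lcm d e))" for d e
  have hb: "\<bar>h d e\<bar> \<le> 1" if "d \<in> S" "e \<in> S" for d e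
  proof -
    have "d \<in> {1..D}" "e \<in> {1..D}" using that squarefreesD unfolding S_def by auto
    hence "coprime (d * e) q" "0 < lcm d e" using cop by (auto simp: lcm_pos_nat)
    moreover have "lcm d e dvd d * e" by simp
    ultimately have "coprime (lcm d e) q" using coprime_divisors dvd_refl by blast
    thus ?thesis using \<open>0 < lcm d e\<close> assms(2) unfolding h_def N_def
      by (intro card_residue_class_multiples)
  qed
  have "(\<Sum>n\<in>{1..Y}. selberg_beta D n * (if [n = c] (mod q) then 1 else 0)) = 
     (\<Sum>d\<in>S. \<Sum>e\<in>S. lam d * lam e * (\<Sum>n\<in>{1..Y}. if lcm d e dvd n then (if [n = c] (mod q) then 1 else 0) else 0))"
    unfolding S_def lam_def by (rule sum_selberg_beta)
  also have "\<dots> = (\<Sum>d\<in>S. \<Sum>e\<in>S. lam d * lam e * N (lcm d e))"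
  proof -
    have "(\<Sum>n\<in>{1..Y}. if k dvd n then (if [n = c] (mod q) then 1 else 0) else 0) = N k" for k
    proof -
      have "(\<Sum>n\<in>{1..Y}. if k dvd n then (if [n = c] (mod q) then 1 else 0) else 0) = 
        (\<Sum>n\<in>{1..Y}. if k dvd n \<and> [n = c] (mod q) then 1 else (0::real))" by (intro sum.cong) auto
      also have "\<dots> = (\<Sum>n\<in>{n\<in>{1..Y}. k dvd n \<and> [n = c] (mod q)}. 1)"
        by (rule sum.inter_filter[symmetric]) simp
      finally show ?thesis by (simp add: N_def)
    qed
    thus ?thesis by (simp only:)
  qed
  also have "\<dots> = (\<Sum>d\<in>S. \<Sum>e\<in>S. real Y / real q * (lam d * lam e / real (lcm d e)) + lam d * lam e * h d e)"
    by (intro sum.cong refl) (simp add: h_def field_simps)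
  also have "\<dots> = real Y / real q * (\<Sum>d\<in>S. \<Sum>e\<in>S. lam d * lam e / real (lcm d e)) + (\<Sum>d\<in>S. \<Sum>e\<in>S. lam d * lam e * h d e)"
    by (simp only: sum.distrib sum_distrib_left)
  also have "\<dots> \<le> real Y / real q * (1 / selberg_G D) + real D ^ 4 * 1"
  proof (intro add_mono)
    show "real Y / real q * (\<Sum>d\<in>S. \<Sum>e\<in>S. lam d * lam e / real (lcm d e)) \<le> real Y / real q * (1 / selberg_G D)"
      using selberg_quadratic_form[OF assms(1)] unfolding S_def lam_def by (simp only: order_refl)
    show "(\<Sum>d\<in>S. \<Sum>e\<in>S. lam d * lam e * h d e) \<le> real D ^ 4 * 1"
      using abs_double_sum_selberg_lambda_le[OF assms(1), of h 1] hb unfolding S_def lam_def by (meson abs_le_D1)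
  qed
  finally show ?thesis by simp
qed

lemma card_rough_residue_class_le:
  assumes "1 \<le> D" "0 < q" and cop: "\<And>d. d \<in> {1..D} \<Longrightarrow> coprime d q"
  shows "real (card {n\<in>{1..Y}. [n = c] (mod q) \<and> rough (real D) n})
          \<le> real Y / (real q * selberg_G D) + real D ^ 4"
proof -
  have "real (card {n\<in>{1..Y}. [n = c] (mod q) \<and> rough (real D) n}) =
     (\<Sum>n\<in>{1..Y}. if [n = c] (mod q) \<and> rough (real D) n then 1 else 0)"
    by (subst sum.inter_filter[symmetric]) auto
  also have "\<dots> \<le> (\<Sum>n\<in>{1..Y}. selberg_beta D n * (if [n = c] (mod q) then 1 else 0))"
    using selberg_beta_rough[OF assms(1)] selberg_beta_nonneg by (intro sum_mono) auto
  also have "\<dots> \<le> real Y / (real q * selberg_G D) + real D ^ 4"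
    using assms by (rule sum_selberg_beta_residue_class_le)
  finally show ?thesis .
qed

section \<open>Estimates of Chebyshev and Mertens\<close>

definition primes_in :: "real \<Rightarrow> real \<Rightarrow> nat set" where
  "primes_in u v = {p. prime p \<and> u < real p \<and> real p \<le> v}"

lemma finite_primes_in [simp]: "finite (primes_in u v)"
proof (rule finite_subset)
  show "primes_in u v \<subseteq> {..nat \<lfloor>v\<rfloor>}" by (auto simp: primes_in_def le_nat_floor)
qed simp

text \<open>Chebyshev's upper bound from the sieve with modulus 1: a prime is at most
  \<open>D\<close> or \<open>D\<close>-rough. Of the constant 20, the main term takes 16 and the two
  error terms, each at most sqrt n, take 4.\<close>

lemma card_primes_le:
  assumes "2 \<le> (n::nat)"
  shows "real (card {p\<in>{1..n}. prime p}) * ln (real n) \<le> 20 * real n"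
proof -
  \<comment> \<open>The exponent 1/8 gives \<open>D ^ 4\<close> at most sqrt n and
    \<open>selberg_G D\<close> at least ln n / 16.\<close>
  define y where "y = real n powr (1/8)"
  define D where "D = nat \<lfloor>y\<rfloor>"
  have y1: "1 \<le> y" using assms unfolding y_def by (simp add: ge_one_powr_ge_zero)
  have D1: "1 \<le> D" using y1 by (simp add: D_def le_nat_floor)
  have Dy: "real D \<le> y" "y < real D + 1" using y1 by (auto simp: D_def)
  have lny: "ln y = ln (real n) / 8" using assms by (simp add: y_def ln_powr)
  have "ln y \<le> ln (real D + 1)" using Dy y1 by simp
  hence G: "ln (real n) / 16 \<le> selberg_G D" using selberg_G_ge[of D] lny by linarith
  have lnpos: "0 < ln (real n)" using assms by simp
  have D4: "real D ^ 4 \<le> sqrt (real n)"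
  proof -
    have "real D ^ 4 \<le> y ^ 4" using Dy by (intro power_mono) auto
    also have "y ^ 4 = sqrt (real n)"
      using assms by (simp add: y_def powr_power powr_half_sqrt)
    finally show ?thesis .
  qed
  have "real D \<le> real D ^ 4" using D1 by (simp add: self_le_power)
  hence DD: "real D \<le> sqrt (real n)" using D4 by linarith
  have "{p\<in>{1..n}. prime p} \<subseteq> {1..D} \<union> {m\<in>{1..n}. [m = 0] (mod 1) \<and> rough (real D) m}"
    by (auto simp: rough_def prime_nat_iff)
  hence "card {p\<in>{1..n}. prime p} \<le> card {1..D} + card {m\<in>{1..n}. [m = 0] (mod 1) \<and> rough (real D) m}"
    by (intro order_trans[OF card_mono card_Un_le]) auto
  hence "real (card {p\<in>{1..n}. prime p}) \<le> real D + real (card {m\<in>{1..n}. [m = 0] (mod 1) \<and> rough (real D) m})"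
    by simp
  also have "\<dots> \<le> sqrt (real n) + (real n / (real 1 * selberg_G D) + real D ^ 4)"
    using DD card_rough_residue_class_le[OF D1, of 1 n 0] by (intro add_mono) auto
  also have "\<dots> \<le> sqrt (real n) + (real n / (ln (real n) / 16) + sqrt (real n))"
  proof -
    have "real n / (real 1 * selberg_G D) \<le> real n / (ln (real n) / 16)"
      using G lnpos by (simp del: divide_divide_eq_right add: divide_left_mono)
    thus ?thesis using D4 by simp
  qed
  finally have "real (card {p\<in>{1..n}. prime p}) * ln (real n) \<le> (2 * sqrt (real n) + 16 * real n / ln (real n)) * ln (real n)"
    using lnpos by (intro mult_right_mono) (auto simp: field_simps)
  also have "\<dots> = 2 * sqrt (real n) * ln (real n) + 16 * real n"
    using lnpos by (simp add: field_simps)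
  also have "2 * sqrt (real n) * ln (real n) \<le> 2 * sqrt (real n) * (2 * sqrt (real n))"
  proof (intro mult_left_mono)
    have "ln (sqrt (real n)) \<le> sqrt (real n)" using ln_bound[of "sqrt (real n)"] assms by simp
    thus "ln (real n) \<le> 2 * sqrt (real n)" using assms by (simp add: ln_sqrt)
  qed auto
  finally show ?thesis by simp
qed

lemma sum_ln_primes_le:
  assumes "1 \<le> (n::nat)"
  shows "(\<Sum>p | p \<in> {1..n} \<and> prime p. ln (real p)) \<le> 20 * real n"
proof (cases "n = 1")
  case True
  have "{p. p \<in> {1..n} \<and> prime p} = {}" using True by (auto simp: prime_nat_iff)
  thus ?thesis by (simp only: sum.empty)
next
  case False
  have "(\<Sum>p | p \<in> {1..n} \<and> prime p. ln (real p)) \<le> of_nat (card {p. p \<in> {1..n} \<and> prime p}) * ln (real n)"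
    by (rule sum_bounded_above) auto
  also have "\<dots> \<le> 20 * real n" using card_primes_le[of n] False assms by simp
  finally show ?thesis .
qed

section \<open>Mertens's first theorem, from the prime factorisation of the factorial\<close>

lemma multiplicity_eq_card_powers:
  fixes p m :: nat
  assumes "prime p" "0 < m" "m \<le> n"
  shows "multiplicity p m = card {k\<in>{1..n}. p ^ k dvd m}"
proof -
  have p: "\<not> is_unit p" using assms by auto
  have pw: "p ^ k dvd m \<longleftrightarrow> k \<le> multiplicity p m" for k
    using power_dvd_iff_le_multiplicity[of m p k] p assms by auto
  define a where "a = multiplicity p m"
  have "a \<le> n"
  proof -
    have "p ^ a \<le> m" using assms by (simp add: a_def dvd_imp_le multiplicity_dvd)
    moreover have "a < p ^ a"
      using prime_ge_2_nat[OF assms(1)] by (intro power_gt_expt) auto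
    ultimately show ?thesis using assms by linarith
  qed
  hence "{k\<in>{1..n}. k \<le> a} = {1..a}" by auto
  thus ?thesis unfolding pw a_def[symmetric] by simp
qed

lemma ln_eq_sum_multiplicity:
  assumes "0 < m" "m \<le> n"
  shows "ln (real m) = (\<Sum>p | p \<in> {1..n} \<and> prime p. real (multiplicity p m) * ln (real p))"
proof -
  have "real m = (\<Prod>p\<in>prime_factors m. real p ^ multiplicity p m)"
    using assms prime_factorization_nat[of m] by (metis (mono_tags, lifting) of_nat_power of_nat_prod prod.cong)
  hence "ln (real m) = (\<Sum>p\<in>prime_factors m. ln (real p ^ multiplicity p m))"
    by (simp only:) (rule ln_prod, auto dest!: in_prime_factors_imp_prime simp: prime_gt_0_nat)
  also have "\<dots> = (\<Sum>p\<in>prime_factors m. real (multiplicity p m) * ln (real p))"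
    by (intro sum.cong refl) (auto dest!: in_prime_factors_imp_prime simp: ln_realpow prime_gt_0_nat)
  also have "\<dots> = (\<Sum>p | p \<in> {1..n} \<and> prime p. real (multiplicity p m) * ln (real p))"
  proof (rule sum.mono_neutral_left)
    show "prime_factors m \<subseteq> {p. p \<in> {1..n} \<and> prime p}"
    proof
      fix p assume "p \<in> prime_factors m"
      hence p: "prime p" "p dvd m" by auto
      hence "1 \<le> p" "p \<le> m" using assms by (auto simp: prime_gt_0_nat Suc_le_eq dvd_imp_le)
      thus "p \<in> {p. p \<in> {1..n} \<and> prime p}" using p assms by auto
    qed
    show "\<forall>p\<in>{p. p \<in> {1..n} \<and> prime p} - prime_factors m. real (multiplicity p m) * ln (real p) = 0"
      using assms by (auto simp: in_prime_factors_iff not_dvd_imp_multiplicity_0)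
  qed simp
  finally show ?thesis .
qed

lemma card_multiples: "0 < d \<Longrightarrow> card {m\<in>{1..n}. d dvd m} = n div (d::nat)"
proof -
  assume d: "0 < d"
  have "{m\<in>{1..n}. d dvd m} = (*) d ` {1..n div d}"
  proof (intro equalityI subsetI)
    fix m assume "m \<in> {m\<in>{1..n}. d dvd m}"
    then obtain k where "m = d * k" "1 \<le> d * k" "d * k \<le> n" by auto
    thus "m \<in> (*) d ` {1..n div d}" using d
      by (auto simp: less_eq_div_iff_mult_less_eq mult.commute intro!: imageI)
  next
    fix m assume "m \<in> (*) d ` {1..n div d}"
    thus "m \<in> {m\<in>{1..n}. d dvd m}" using d
      by (auto simp: less_eq_div_iff_mult_less_eq mult.commute)
  qed
  thus ?thesis using d by (simp add: card_image inj_on_def)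
qed

text \<open>Legendre's formula for the exponents in \<open>fact n\<close>. Exponents
  \<open>k\<close> up to \<open>n\<close> capture all of it, since larger powers of a prime exceed
  \<open>n\<close>.\<close>

lemma ln_fact_eq_sum_primes:
  "ln (fact n) = (\<Sum>p | p \<in> {1..n} \<and> prime p. ln (real p) * (\<Sum>k\<in>{1..n}. real (n div p ^ k)))"
proof -
  define P where "P = {p. p \<in> {1..n} \<and> prime p}"
  have "fact n = (\<Prod>m\<in>{1..n}. real m)" by (simp add: fact_prod)
  hence "ln (fact n) = (\<Sum>m\<in>{1..n}. ln (real m))" by (simp only:) (rule ln_prod, auto)
  also have "\<dots> = (\<Sum>m\<in>{1..n}. \<Sum>p\<in>P. \<Sum>k\<in>{1..n}. ln (real p) * (if p ^ k dvd m then 1 else 0))"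
  proof (intro sum.cong refl)
    fix m assume m: "m \<in> {1..n}"
    have "ln (real m) = (\<Sum>p\<in>P. real (multiplicity p m) * ln (real p))"
      unfolding P_def using m by (intro ln_eq_sum_multiplicity) auto
    also have "\<dots> = (\<Sum>p\<in>P. \<Sum>k\<in>{1..n}. ln (real p) * (if p ^ k dvd m then 1 else 0))"
    proof (intro sum.cong refl)
      fix p assume p: "p \<in> P"
      have "real (multiplicity p m) = real (card {k\<in>{1..n}. p ^ k dvd m})"
        using multiplicity_eq_card_powers[of p m n] p m by (auto simp: P_def)
      also have "\<dots> = (\<Sum>k\<in>{k\<in>{1..n}. p ^ k dvd m}. 1)" by simp
      also have "\<dots> = (\<Sum>k\<in>{1..n}. if p ^ k dvd m then 1 else 0)" by (rule sum.inter_filter) simp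
      finally have "real (multiplicity p m) = (\<Sum>k\<in>{1..n}. if p ^ k dvd m then 1 else 0)" .
      thus "real (multiplicity p m) * ln (real p) = (\<Sum>k\<in>{1..n}. ln (real p) * (if p ^ k dvd m then 1 else 0))"
        by (simp only: sum_distrib_left mult.commute)
    qed
    finally show "ln (real m) = \<dots>" .
  qed
  also have "\<dots> = (\<Sum>p\<in>P. \<Sum>m\<in>{1..n}. \<Sum>k\<in>{1..n}. ln (real p) * (if p ^ k dvd m then 1 else 0))"
    by (rule sum.swap)
  also have "\<dots> = (\<Sum>p\<in>P. \<Sum>k\<in>{1..n}. \<Sum>m\<in>{1..n}. ln (real p) * (if p ^ k dvd m then 1 else 0))"
    by (intro sum.cong refl sum.swap)
  also have "\<dots> = (\<Sum>p\<in>P. \<Sum>k\<in>{1..n}. ln (real p) * real (n div p ^ k))"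
  proof (intro sum.cong refl)
    fix p k assume "p \<in> P"
    hence p: "0 < p ^ k" by (auto simp: P_def prime_gt_0_nat)
    have "(\<Sum>m\<in>{1..n}. if p ^ k dvd m then 1 else 0) = (\<Sum>m\<in>{m\<in>{1..n}. p ^ k dvd m}. (1::real))"
      by (rule sum.inter_filter[symmetric]) simp
    also have "\<dots> = real (card {m\<in>{1..n}. p ^ k dvd m})" by simp
    finally have "(\<Sum>m\<in>{1..n}. if p ^ k dvd m then 1 else 0) = real (n div p ^ k)"
      using p by (simp only: card_multiples)
    thus "(\<Sum>m\<in>{1..n}. ln (real p) * (if p ^ k dvd m then 1 else 0)) = ln (real p) * real (n div p ^ k)"
      by (simp only: flip: sum_distrib_left)
  qed
  finally show ?thesis by (simp only: P_def sum_distrib_left)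
qed

lemma ln_fact_ge:
  assumes "1 \<le> n"
  shows "real n * ln (real n) - real n \<le> ln (fact n)"
  using assms
proof (induction n rule: dec_induct)
  case base
  show ?case by simp
next
  case (step n)
  have n: "0 < real n" using step by simp
  have "ln (real (Suc n) / real n) \<le> real (Suc n) / real n - 1"
    using n by (intro ln_le_minus_one) simp
  also have "\<dots> = 1 / real n" using n by (simp add: field_simps)
  finally have "real n * (ln (real (Suc n)) - ln (real n)) \<le> 1"
    using n by (simp add: ln_div field_simps)
  moreover have "ln (fact (Suc n)) = ln (real (Suc n)) + ln (fact n)"
    by (simp add: ln_mult)
  ultimately show ?case using step by (simp add: algebra_simps)
qed

lemma ln_fact_le: "ln (fact n) \<le> real n * ln (real n)"
proof (cases "n = 0")
  case False
  have "fact n \<le> real n ^ n" using fact_le_power[of n] by simp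
  hence "ln (fact n) \<le> ln (real n ^ n)" using False by (subst ln_le_cancel_iff) auto
  thus ?thesis using False by (simp add: ln_realpow)
qed simp

text \<open>Only \<open>k = 1\<close> is kept in Legendre's formula. Rounding n / p down costs at
  most ln p for each prime, and Chebyshev's bound for the total is the 20.\<close>

lemma sum_ln_over_primes_le:
  assumes "1 \<le> n"
  shows "(\<Sum>p | p \<in> {1..n} \<and> prime p. ln (real p) / real p) \<le> ln (real n) + 20"
proof -
  define P where "P = {p. p \<in> {1..n} \<and> prime p}"
  have "real n * (\<Sum>p\<in>P. ln (real p) / real p) - (\<Sum>p\<in>P. ln (real p)) = (\<Sum>p\<in>P. ln (real p) * (real n / real p - 1))"
    by (simp add: sum_distrib_left sum_subtractf algebra_simps)
  also have "\<dots> \<le> (\<Sum>p\<in>P. ln (real p) * (\<Sum>k\<in>{1..n}. real (n div p ^ k)))"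
  proof (intro sum_mono mult_left_mono)
    fix p assume p: "p \<in> P"
    hence p0: "0 < p" by (auto simp: P_def)
    have "n < (n div p + 1) * p" using p0 by (metis Suc_eq_plus1 dividend_less_div_times mult.commute mult_Suc_right add.commute)
    hence "real n < (real (n div p) + 1) * real p"
      by (metis of_nat_1 of_nat_add of_nat_less_iff of_nat_mult)
    hence "real n / real p - 1 \<le> real (n div p ^ 1)" using p0 by (simp add: field_simps)
    also have "\<dots> \<le> (\<Sum>k\<in>{1..n}. real (n div p ^ k))"
      using assms by (intro member_le_sum) auto
    finally show "real n / real p - 1 \<le> (\<Sum>k\<in>{1..n}. real (n div p ^ k))" .
    show "0 \<le> ln (real p)" using p by (auto simp: P_def)
  qed
  also have "\<dots> = ln (fact n)" by (simp only: ln_fact_eq_sum_primes P_def)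
  also have "\<dots> \<le> real n * ln (real n)" by (rule ln_fact_le)
  finally have "real n * (\<Sum>p\<in>P. ln (real p) / real p) \<le> real n * ln (real n) + 20 * real n"
    using sum_ln_primes_le[OF assms] by (simp only: P_def)
  also have "\<dots> = real n * (ln (real n) + 20)" by (simp add: algebra_simps)
  finally show ?thesis using assms by (simp add: P_def)
qed

text \<open>Domination by the convergent series of 4 m^(-3/2), through ln m \<le> 2 sqrt m. This sum
  is the contribution of the proper prime powers to Legendre's formula.\<close>

lemma sum_ln_over_squares_bounded:
  obtains C :: real where "0 \<le> C" "\<And>n. (\<Sum>m\<in>{2..n}. ln (real m) / (real m * (real m - 1))) \<le> C"
proof
  define f where "f m = 4 * real m powr (-3/2)" for m
  have sm: "summable f" unfolding f_def by (intro summable_mult) (simp add: summable_real_powr_iff)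
  show "0 \<le> suminf f" using sm by (intro suminf_nonneg) (auto simp: f_def)
  fix n
  have "(\<Sum>m\<in>{2..n}. ln (real m) / (real m * (real m - 1))) \<le> (\<Sum>m\<in>{2..n}. f m)"
  proof (rule sum_mono)
    fix m assume "m \<in> {2..n}"
    hence m: "2 \<le> real m" by simp
    have l: "ln (real m) \<le> 2 * sqrt (real m)"
      using ln_bound[of "sqrt (real m)"] m by (simp add: ln_sqrt)
    have "ln (real m) / (real m * (real m - 1)) \<le> 2 * sqrt (real m) / (real m * (real m / 2))"
      using l m by (intro frac_le mult_left_mono) auto
    also have "\<dots> = 4 * (sqrt (real m) / real m ^ 2)" using m by (simp add: power2_eq_square)
    also have "sqrt (real m) / real m ^ 2 = real m powr (1/2) / real m powr 2"
      using m by (simp add: powr_half_sqrt)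
    also have "\<dots> = real m powr (-3/2)" by (simp only: powr_diff[symmetric]) simp
    finally show "ln (real m) / (real m * (real m - 1)) \<le> f m" by (simp add: f_def)
  qed
  also have "\<dots> \<le> suminf f" using sm by (rule sum_le_suminf) (auto simp: f_def)
  finally show "(\<Sum>m\<in>{2..n}. ln (real m) / (real m * (real m - 1))) \<le> suminf f" .
qed

lemma sum_powers_inverse_le:
  assumes "1 < (x::real)"
  shows "(\<Sum>k\<in>{1..n}. 1 / x ^ k) \<le> 1 / (x - 1)"
proof -
  have "(\<Sum>k\<in>{1..n}. 1 / x ^ k) = 1 / (x - 1) - 1 / ((x - 1) * x ^ n)"
  proof (induction n)
    case (Suc n)
    have "(\<Sum>k\<in>{1..Suc n}. 1 / x ^ k) = 1 / (x - 1) - 1 / ((x - 1) * x ^ n) + 1 / x ^ Suc n"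
      using Suc by simp
    also have "\<dots> = 1 / (x - 1) - 1 / ((x - 1) * x ^ Suc n)"
      using assms by (simp add: divide_simps) (simp add: algebra_simps)
    finally show ?case .
  qed simp
  thus ?thesis using assms by simp
qed

text \<open>All powers of \<open>p\<close> together contribute at most the geometric sum 1 / (p - 1)
  = 1 / p + 1 / (p (p - 1)), whose second part converges when summed with ln p. The additional 1 in
  the constant is the loss in the Stirling bound.\<close>

lemma sum_ln_over_primes_ge:
  obtains C :: real where "0 \<le> C" 
    "\<And>n. 1 \<le> n \<Longrightarrow> ln (real n) - C \<le> (\<Sum>p | p \<in> {1..n} \<and> prime p. ln (real p) / real p)"
proof -
  obtain C0 where C0: "0 \<le> C0" "\<And>n. (\<Sum>m\<in>{2..n}. ln (real m) / (real m * (real m - 1))) \<le> C0"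
    using sum_ln_over_squares_bounded by blast
  have "ln (real n) - (C0 + 1) \<le> (\<Sum>p | p \<in> {1..n} \<and> prime p. ln (real p) / real p)" if n: "1 \<le> n" for n
  proof -
    define P where "P = {p. p \<in> {1..n} \<and> prime p}"
    have "real n * ln (real n) - real n \<le> ln (fact n)" using n by (rule ln_fact_ge)
    also have "\<dots> = (\<Sum>p\<in>P. ln (real p) * (\<Sum>k\<in>{1..n}. real (n div p ^ k)))"
      by (simp only: ln_fact_eq_sum_primes P_def)
    also have "\<dots> \<le> (\<Sum>p\<in>P. ln (real p) * (real n * (1 / real p + 1 / (real p * (real p - 1)))))"
    proof (intro sum_mono mult_left_mono)
      fix p assume p: "p \<in> P"
      hence p2: "2 \<le> real p" using prime_ge_2_nat by (auto simp: P_def)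
      have "(\<Sum>k\<in>{1..n}. real (n div p ^ k)) \<le> (\<Sum>k\<in>{1..n}. real n * (1 / real p ^ k))"
      proof (rule sum_mono)
        fix k
        have "real (n div p ^ k) \<le> real n / real (p ^ k)" by (rule of_nat_div_le_of_nat)
        thus "real (n div p ^ k) \<le> real n * (1 / real p ^ k)" by simp
      qed
      also have "\<dots> \<le> real n * (1 / (real p - 1))"
        unfolding sum_distrib_left[symmetric] using p2 by (intro mult_left_mono sum_powers_inverse_le) auto
      also have "1 / (real p - 1) = 1 / real p + 1 / (real p * (real p - 1))"
        using p2 by (simp add: divide_simps)
      finally show "(\<Sum>k\<in>{1..n}. real (n div p ^ k)) \<le> real n * (1 / real p + 1 / (real p * (real p - 1)))" .
      show "0 \<le> ln (real p)" using p2 by simp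
    qed
    also have "\<dots> = real n * ((\<Sum>p\<in>P. ln (real p) / real p) + (\<Sum>p\<in>P. ln (real p) / (real p * (real p - 1))))"
      by (simp add: sum_distrib_left sum.distrib algebra_simps)
    also have "(\<Sum>p\<in>P. ln (real p) / (real p * (real p - 1))) \<le> (\<Sum>m\<in>{2..n}. ln (real m) / (real m * (real m - 1)))"
      by (intro sum_mono2) (auto simp: P_def dest: prime_ge_2_nat)
    also have "\<dots> \<le> C0" by (rule C0)
    finally have "real n * ln (real n) - real n \<le> real n * ((\<Sum>p\<in>P. ln (real p) / real p) + C0)"
      using n by (simp add: mult_left_mono)
    hence "real n * (ln (real n) - 1) \<le> real n * ((\<Sum>p\<in>P. ln (real p) / real p) + C0)"
      by (simp add: algebra_simps)
    thus ?thesis using n by (simp add: P_def)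
  qed
  thus thesis using that[of "C0 + 1"] C0 by auto
qed

lemma mertens_first:
  obtains C :: real where "0 < C"
    "\<And>u v. 1 \<le> u \<Longrightarrow> u \<le> v \<Longrightarrow> \<bar>(\<Sum>p\<in>primes_in u v. ln (real p) / real p) - ln (v / u)\<bar> \<le> C"
proof -
  obtain C0 where C0: "0 \<le> C0"
    "\<And>n. 1 \<le> n \<Longrightarrow> ln (real n) - C0 \<le> (\<Sum>p | p \<in> {1..n} \<and> prime p. ln (real p) / real p)"
    using sum_ln_over_primes_ge by blast
  define M where "M u = (\<Sum>p | p \<in> {1..nat \<lfloor>u\<rfloor>} \<and> prime p. ln (real p) / real p)" for u :: real
  have M: "\<bar>M u - ln u\<bar> \<le> C0 + 21" if u: "1 \<le> u" for u
  proof -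
    have n: "1 \<le> nat \<lfloor>u\<rfloor>" using u by (simp add: le_nat_floor)
    have le: "real (nat \<lfloor>u\<rfloor>) \<le> u" using u by simp
    have "u \<le> 2 * real (nat \<lfloor>u\<rfloor>)" using u n by linarith
    hence "ln u \<le> ln (2 * real (nat \<lfloor>u\<rfloor>))" using u by simp
    also have "\<dots> = ln 2 + ln (real (nat \<lfloor>u\<rfloor>))" by (rule ln_mult_pos) (use n in linarith)+
    finally have "ln u \<le> 1 + ln (real (nat \<lfloor>u\<rfloor>))" using ln_2_less_1 by linarith
    moreover have "ln (real (nat \<lfloor>u\<rfloor>)) \<le> ln u" using le n by simp
    ultimately show ?thesis using C0(2)[OF n] sum_ln_over_primes_le[OF n] C0(1) unfolding M_def by linarith
  qed
  have "\<bar>(\<Sum>p\<in>primes_in u v. ln (real p) / real p) - ln (v / u)\<bar> \<le> 2 * (C0 + 21)"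
    if uv: "1 \<le> u" "u \<le> v" for u v
  proof -
    have eq: "{p. p \<in> {1..nat \<lfloor>w\<rfloor>} \<and> prime p} = {p. prime p \<and> real p \<le> w}" if "1 \<le> w" for w
      using that by (auto simp: le_nat_floor prime_gt_0_nat Suc_le_eq) linarith
    define A where "A = {p. p \<in> {1..nat \<lfloor>u\<rfloor>} \<and> prime p}"
    have "{p. p \<in> {1..nat \<lfloor>v\<rfloor>} \<and> prime p} = A \<union> primes_in u v"
      unfolding A_def using uv by (subst (1 2) eq) (auto simp: primes_in_def)
    hence "M v = (\<Sum>p\<in>A \<union> primes_in u v. ln (real p) / real p)"
      unfolding M_def by (simp only:)
    also have "A \<inter> primes_in u v = {}"
      unfolding A_def using uv by (subst eq) (auto simp: primes_in_def)
    hence "(\<Sum>p\<in>A \<union> primes_in u v. ln (real p) / real p) = M u + (\<Sum>p\<in>primes_in u v. ln (real p) / real p)"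
      unfolding M_def A_def by (intro sum.union_disjoint) auto
    finally show ?thesis using M[of u] M[of v] uv by (simp add: ln_div)
  qed
  thus thesis using that[of "2 * (C0 + 21)"] C0(1) by auto
qed

text \<open>Mertens's estimate produces primes in every interval of ratio \<open>b\<close> as soon
  as ln b exceeds its error bound by 1. This \<open>b\<close> becomes the base of the logarithmic
  scales.\<close>

lemma chebyshev_interval:
  obtains b :: nat where "2 \<le> b"
    "\<And>Y. real b \<le> Y \<Longrightarrow> Y / real b \<le> (\<Sum>p\<in>primes_in (Y / real b) Y. ln (real p))"
proof -
  obtain C :: real where C: "0 < C"
    "\<And>u v. 1 \<le> u \<Longrightarrow> u \<le> v \<Longrightarrow> \<bar>(\<Sum>p\<in>primes_in u v. ln (real p) / real p) - ln (v / u)\<bar> \<le> C"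
    using mertens_first by blast
  define b where "b = nat \<lceil>exp (C + 1)\<rceil> + 2"
  have "exp (C + 1) \<le> real b" unfolding b_def by linarith
  hence lnb: "C + 1 \<le> ln (real b)" by (metis exp_gt_zero exp_ln_iff ln_mono ln_exp order_less_le_trans)
  have "2 \<le> b" by (simp add: b_def)
  hence b0: "0 < real b" by simp
  have "Y / real b \<le> (\<Sum>p\<in>primes_in (Y / real b) Y. ln (real p))" if Y: "real b \<le> Y" for Y
  proof -
    have "1 \<le> Y / real b" "Y / real b \<le> Y"
      using Y b0 \<open>2 \<le> b\<close> by (simp_all add: divide_le_eq le_divide_eq mult_le_cancel_left1)
    hence "1 \<le> (\<Sum>p\<in>primes_in (Y / real b) Y. ln (real p) / real p)"
      using C(2)[of "Y / real b" Y] lnb Y b0 by simp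
    hence "Y / real b * 1 \<le> Y / real b * (\<Sum>p\<in>primes_in (Y / real b) Y. ln (real p) / real p)"
      using Y b0 by (intro mult_left_mono) auto
    also have "\<dots> = (\<Sum>p\<in>primes_in (Y / real b) Y. ln (real p) * (Y / real b / real p))"
      by (simp add: sum_distrib_left mult_ac)
    also have "\<dots> \<le> (\<Sum>p\<in>primes_in (Y / real b) Y. ln (real p) * 1)"
    proof (intro sum_mono mult_left_mono)
      fix p assume "p \<in> primes_in (Y / real b) Y"
      hence p: "Y / real b < real p" "0 < p" by (auto simp: primes_in_def prime_gt_0_nat)
      thus "Y / real b / real p \<le> 1" by (simp only: divide_le_eq_1) simp
      show "0 \<le> ln (real p)" using p by simp
    qed
    finally show ?thesis by simp
  qed
  thus thesis using that[of b] by (simp add: b_def)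
qed

section \<open>Upper bound for the Mertens product\<close>

lemma inj_on_prod_primes: "inj_on (\<lambda>A. \<Prod>A) {A. finite A \<and> (\<forall>p\<in>A. prime (p::nat))}"
proof (rule inj_onI)
  fix A B :: "nat set"
  assume AB: "A \<in> {A. finite A \<and> (\<forall>p\<in>A. prime p)}" "B \<in> {A. finite A \<and> (\<forall>p\<in>A. prime p)}" and eq: "\<Prod>A = \<Prod>B"
  have *: "A = {p. prime p \<and> p dvd \<Prod>A}" if "finite A" "\<forall>p\<in>A. prime p" for A :: "nat set"
    using that by (auto simp: prime_dvd_prod_iff) (metis primes_dvd_imp_eq)
  have "A = {p. prime p \<and> p dvd \<Prod>A}" using AB by (intro *) auto
  also have "\<dots> = {p. prime p \<and> p dvd \<Prod>B}" by (simp only: eq)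
  also have "\<dots> = B" using AB by (intro *[symmetric]) auto
  finally show "A = B" .
qed

lemma prod_prime_factors_squarefree:
  assumes "squarefree (d::nat)"
  shows "\<Prod>(prime_factors d) = d"
proof -
  have d: "d \<noteq> 0" using assms by (metis not_squarefree_0)
  have "d = (\<Prod>p\<in>prime_factors d. p ^ multiplicity p d)" using d by (simp add: prime_factorization_nat)
  also have "\<dots> = (\<Prod>p\<in>prime_factors d. p)"
  proof (rule prod.cong)
    fix p assume p: "p \<in> prime_factors d"
    hence "multiplicity p d > 0" by (simp add: prime_factors_multiplicity)
    moreover have "multiplicity p d \<le> 1" using assms p d
      by (subst (asm) squarefree_factorial_semiring'') auto
    ultimately have "multiplicity p d = 1" by simp
    thus "p ^ multiplicity p d = p" by simp
  qed simp
  finally show ?thesis by simp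
qed

lemma sum_inverse_le_ln: "1 \<le> n \<Longrightarrow> (\<Sum>k\<in>{1..n}. 1 / real k) \<le> 1 + ln (real n)"
proof (induction n rule: dec_induct)
  case (step n)
  have n: "0 < real n" using step by simp
  have "ln (real n / real (Suc n)) \<le> real n / real (Suc n) - 1"
    using n by (intro ln_le_minus_one) simp
  also have "\<dots> = - 1 / real (Suc n)" by (simp add: field_simps)
  finally have "1 / real (Suc n) \<le> ln (real (Suc n)) - ln (real n)" using n by (simp add: ln_div)
  thus ?case using step by simp
qed simp

text \<open>
  Upper bound for the Mertens product without partial summation: with respect to the weights
  \<open>1 / s\<close> on the divisors \<open>s\<close> of the product of the primes up to \<open>N\<close>, the mean of \<open>ln s\<close> is at most
  \<open>ln N + O(1)\<close>, so by Markov's inequality a positive proportion of the weight sits on \<open>s \<le> N\<^sup>3\<close>.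
\<close>

lemma mertens_product_le:
  obtains N0 :: real where "3 \<le> N0"
    "\<And>N. N0 \<le> N \<Longrightarrow> (\<Sum>A\<in>Pow (primes_in 1 N). \<Prod>p\<in>A. 1 / real p) \<le> 12 * ln N"
proof -
  obtain C :: real where C: "0 < C"
    "\<And>u v. 1 \<le> u \<Longrightarrow> u \<le> v \<Longrightarrow> \<bar>(\<Sum>p\<in>primes_in u v. ln (real p) / real p) - ln (v / u)\<bar> \<le> C"
    using mertens_first by blast
  \<comment> \<open>With 3 one has 1 \<le> ln N; with exp C the error in Mertens's estimate is at
    most ln N, so that the mean of \<open>l\<close> is at most 2 ln N.\<close>
  define N0 where "N0 = max 3 (exp C)"
  have "(\<Sum>A\<in>Pow (primes_in 1 N). \<Prod>p\<in>A. 1 / real p) \<le> 12 * ln N" if N: "N0 \<le> N" for N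
  proof -
    define P where "P = primes_in 1 N"
    define w where "w A = (\<Prod>p\<in>A. 1 / real p)" for A :: "nat set"
    define l where "l A = (\<Sum>p\<in>A. ln (real p))" for A :: "nat set"
    define W where "W = sum w (Pow P)"
    have fP [simp]: "finite P" by (simp add: P_def)
    have pP: "prime p" "1 < real p" "real p \<le> N" if "p \<in> P" for p
      using that by (auto simp: P_def primes_in_def)
    have fin: "finite A" if "A \<in> Pow P" for A using that by (auto intro: finite_subset)
    have N3: "3 \<le> N" "exp C \<le> N" using N by (auto simp: N0_def)
    have lnN: "1 \<le> ln N" using N3 ln3_gt_1 ln_mono[of 3 N] by linarith
    have "C \<le> ln N" using N3 by (metis exp_gt_zero ln_exp ln_mono)
    have w0: "0 \<le> w A" for A unfolding w_def by (intro prod_nonneg) auto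
    have l0: "0 \<le> l A" if "A \<in> Pow P" for A unfolding l_def using that pP by (intro sum_nonneg) force
    have W0: "0 \<le> W" unfolding W_def by (intro sum_nonneg w0)
    have "(\<Sum>A\<in>Pow P. w A * l A) = (\<Sum>A\<in>Pow P. \<Sum>p\<in>P. if p \<in> A then w A * ln (real p) else 0)"
    proof (intro sum.cong refl)
      fix A assume A: "A \<in> Pow P"
      have "w A * l A = (\<Sum>p\<in>P \<inter> A. w A * ln (real p))"
        using A by (simp add: l_def sum_distrib_left Int_absorb1)
      thus "w A * l A = (\<Sum>p\<in>P. if p \<in> A then w A * ln (real p) else 0)"
        by (simp add: sum.inter_restrict)
    qed
    also have "\<dots> = (\<Sum>p\<in>P. \<Sum>A\<in>Pow P. if p \<in> A then w A * ln (real p) else 0)" by (rule sum.swap)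
    also have "\<dots> \<le> (\<Sum>p\<in>P. ln (real p) / real p * W)"
    proof (rule sum_mono)
      fix p assume p: "p \<in> P"
      have "(\<Sum>A\<in>Pow P. if p \<in> A then w A * ln (real p) else 0) = (\<Sum>A\<in>{A\<in>Pow P. p \<in> A}. w A * ln (real p))"
        by (rule sum.inter_filter[symmetric]) simp
      \<comment> \<open>Removing \<open>p\<close> from \<open>A\<close> shows that the sets
        containing \<open>p\<close> carry at most the fraction 1 / p of the total weight.\<close>
      also have "\<dots> = (\<Sum>A\<in>{A\<in>Pow P. p \<in> A}. ln (real p) / real p * w (A - {p}))"
      proof (intro sum.cong refl)
        fix A assume "A \<in> {A\<in>Pow P. p \<in> A}"
        hence "w A = 1 / real p * w (A - {p})"
          unfolding w_def by (intro prod.remove) (auto intro: finite_subset[OF _ fP])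
        thus "w A * ln (real p) = ln (real p) / real p * w (A - {p})" by simp
      qed
      also have "\<dots> = ln (real p) / real p * (\<Sum>A\<in>(\<lambda>A. A - {p}) ` {A\<in>Pow P. p \<in> A}. w A)"
      proof -
        have "inj_on (\<lambda>A. A - {p}) {A\<in>Pow P. p \<in> A}" by (rule inj_onI) blast
        thus ?thesis by (simp add: sum.reindex sum_distrib_left)
      qed
      also have "\<dots> \<le> ln (real p) / real p * W"
        unfolding W_def using pP[OF p] w0 by (intro mult_left_mono sum_mono2) auto
      finally show "(\<Sum>A\<in>Pow P. if p \<in> A then w A * ln (real p) else 0) \<le> ln (real p) / real p * W" .
    qed
    also have "\<dots> = (\<Sum>p\<in>P. ln (real p) / real p) * W" by (simp only: sum_distrib_right)
    also have "\<dots> \<le> (2 * ln N) * W"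
      using C(2)[of 1 N] N3 \<open>C \<le> ln N\<close> W0 unfolding P_def by (intro mult_right_mono) auto
    finally have mean: "(\<Sum>A\<in>Pow P. w A * l A) \<le> 2 * ln N * W" .
    \<comment> \<open>Markov's inequality with mean at most 2 ln N and threshold 3 ln N: at least a
      third of the weight remains in \<open>S\<close>, where the products are distinct integers up
      to N^3.\<close>
    define S where "S = {A\<in>Pow P. l A \<le> 3 * ln N}"
    have fS: "finite S" "S \<subseteq> Pow P" by (auto simp: S_def)
    have "3 * ln N * sum w (Pow P - S) \<le> (\<Sum>A\<in>Pow P - S. w A * l A)"
      unfolding sum_distrib_left
    proof (rule sum_mono)
      fix A assume "A \<in> Pow P - S"
      hence "3 * ln N \<le> l A" by (auto simp: S_def)
      from mult_left_mono[OF this w0[of A]] show "3 * ln N * w A \<le> w A * l A" by (simp only: mult.commute)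
    qed
    also have "\<dots> \<le> (\<Sum>A\<in>Pow P. w A * l A)" using w0 l0 by (intro sum_mono2) auto
    finally have "3 * ln N * sum w (Pow P - S) \<le> 2 * ln N * W" using mean by linarith
    hence "3 * sum w (Pow P - S) \<le> 2 * W" using lnN
      by (metis (no_types, opaque_lifting) mult.assoc mult.left_commute mult_le_cancel_left_pos zero_less_one order_less_le_trans)
    moreover have "W = sum w (Pow P - S) + sum w S"
      unfolding W_def using fS by (intro sum.subset_diff) auto
    ultimately have "W \<le> 3 * sum w S" by linarith
    also have "sum w S = (\<Sum>A\<in>S. 1 / real (\<Prod>A))"
      by (intro sum.cong) (auto simp: w_def prod_dividef)
    also have "\<dots> = (\<Sum>n\<in>(\<lambda>A. \<Prod>A) ` S. 1 / real n)"
    proof -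
      have "finite A \<and> (\<forall>p\<in>A. prime p)" if "A \<in> S" for A
        using that fin[of A] pP(1) by (auto simp: S_def)
      hence "S \<subseteq> {A. finite A \<and> (\<forall>p\<in>A. prime p)}" by (intro subsetI) simp
      hence "inj_on (\<lambda>A. \<Prod>A) S" using inj_on_prod_primes inj_on_subset by blast
      thus ?thesis by (simp add: sum.reindex)
    qed
    also have "\<dots> \<le> (\<Sum>n\<in>{1..nat \<lfloor>N ^ 3\<rfloor>}. 1 / real n)"
    proof (rule sum_mono2)
      show "(\<lambda>A. \<Prod>A) ` S \<subseteq> {1..nat \<lfloor>N ^ 3\<rfloor>}"
      proof (rule image_subsetI)
        fix A assume A: "A \<in> S"
        hence AP: "A \<in> Pow P" "l A \<le> 3 * ln N" by (auto simp: S_def)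
        have pos: "0 < real p" if "p \<in> A" for p
        proof -
          have "p \<in> P" using that AP by blast
          thus ?thesis using pP(2)[of p] by linarith
        qed
        hence pp: "0 < \<Prod>A" using fin[OF AP(1)] by (intro prod_pos) simp
        have "ln (real (\<Prod>A)) = l A" unfolding l_def of_nat_prod
          using pos fin[OF AP(1)] by (intro ln_prod) auto
        also have "\<dots> \<le> ln (N ^ 3)" using AP N3 by (simp add: ln_realpow)
        finally have "ln (real (\<Prod>A)) \<le> ln (N ^ 3)" .
        moreover have "0 < real (\<Prod>A)" "0 < N ^ 3" using pp N3 by (simp_all only: of_nat_0_less_iff) simp
        ultimately have "real (\<Prod>A) \<le> N ^ 3" using ln_le_cancel_iff by blast
        thus "\<Prod>A \<in> {1..nat \<lfloor>N ^ 3\<rfloor>}" using pp by (simp add: le_nat_floor Suc_le_eq)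
      qed
    qed auto
    also have "\<dots> \<le> 1 + ln (real (nat \<lfloor>N ^ 3\<rfloor>))"
      using N3 by (intro sum_inverse_le_ln) (simp add: le_nat_floor)
    also have "ln (real (nat \<lfloor>N ^ 3\<rfloor>)) \<le> ln (N ^ 3)"
    proof -
      have "1 \<le> N ^ 3" using N3 by simp
      hence "1 \<le> nat \<lfloor>N ^ 3\<rfloor>" by (simp add: le_nat_floor)
      thus ?thesis using \<open>1 \<le> N ^ 3\<close> of_nat_floor[of "N ^ 3"] by (intro ln_mono) linarith+
    qed
    also have "ln (N ^ 3) = 3 * ln N" using N3 by (simp add: ln_realpow)
    \<comment> \<open>Since 1 \<le> ln N, the bound 3 + 9 ln N is at most 12 ln N.\<close>
    finally have "W \<le> 3 * (1 + 3 * ln N)" by simp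
    thus ?thesis using lnN by (simp add: W_def w_def P_def)
  qed
  thus thesis using that[of N0] by (simp add: N0_def)
qed

section \<open>Numbers without small prime factors\<close>

definition rough_squarefrees :: "real \<Rightarrow> nat \<Rightarrow> nat set" where
  "rough_squarefrees N Y = {r\<in>squarefrees Y. rough N r}"

text \<open>Splitting each squarefree d up to \<open>Y\<close> into its primes up to
  \<open>N\<close> and its rough part bounds the sum of 1 / d by the product on the right. Dividing
  by the Mertens product then gives a lower bound for rough numbers without a lower-bound
  sieve.\<close>

lemma sum_inverse_rough_squarefrees_ge:
  assumes "1 \<le> N"
  shows "ln (real Y + 1) / 2 \<le> (\<Sum>A\<in>Pow (primes_in 1 N). \<Prod>p\<in>A. 1 / real p) * (\<Sum>r\<in>rough_squarefrees N Y. 1 / real r)"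
proof -
  define P where "P = primes_in 1 N"
  define R where "R = rough_squarefrees N Y"
  define a where "a d = {p\<in>prime_factors d. real p \<le> N}" for d :: nat
  define r where "r d = (\<Prod>p\<in>{p\<in>prime_factors d. N < real p}. p)" for d :: nat
  have dec: "\<Prod>(a d) * r d = d" if "d \<in> squarefrees Y" for d
  proof -
    have "prime_factors d = a d \<union> {p\<in>prime_factors d. N < real p}" by (auto simp: a_def)
    hence "\<Prod>(prime_factors d) = \<Prod>(a d) * r d" unfolding r_def
      by (subst prod.union_disjoint[symmetric]) (auto simp: a_def)
    thus ?thesis using that prod_prime_factors_squarefree squarefreesD by metis
  qed
  have inj: "inj_on (\<lambda>d. (a d, r d)) (squarefrees Y)"
    by (rule inj_on_inverseI[where g = "\<lambda>(A, s). \<Prod>A * s"]) (simp add: dec)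
  have sub: "(\<lambda>d. (a d, r d)) ` squarefrees Y \<subseteq> Pow P \<times> R"
  proof (rule image_subsetI)
    fix d assume d: "d \<in> squarefrees Y"
    have dY: "1 \<le> d" "d \<le> Y" "squarefree d" using squarefreesD[OF d] by auto
    have "a d \<subseteq> P" by (auto simp: a_def P_def primes_in_def prime_gt_1_nat[unfolded One_nat_def] in_prime_factors_iff)
    moreover have rd: "r d dvd d" using dec[OF d] by (metis dvd_triv_right)
    hence "squarefree (r d)" "r d \<le> Y" "1 \<le> r d"
      using dY squarefree_mono dvd_imp_le[OF rd] by (auto simp: Suc_le_eq intro: Nat.gr0I)
    moreover have "rough N (r d)" unfolding rough_def
    proof (intro conjI allI impI)
      show "0 < r d" using \<open>1 \<le> r d\<close> by simp
      fix p assume p: "prime p" "p dvd r d"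
      then obtain t where "t \<in> {p\<in>prime_factors d. N < real p}" "p dvd t"
        unfolding r_def by (subst (asm) prime_dvd_prod_iff) auto
      thus "N < real p" using p by (auto dest: primes_dvd_imp_eq)
    qed
    ultimately show "(a d, r d) \<in> Pow P \<times> R"
      by (simp add: R_def rough_squarefrees_def squarefrees_def)
  qed
  have fR: "finite R" by (simp add: R_def rough_squarefrees_def)
  have "ln (real Y + 1) / 2 \<le> (\<Sum>d\<in>squarefrees Y. 1 / real d)" by (rule sum_inverse_squarefrees_ge)
  also have "\<dots> = (\<Sum>d\<in>squarefrees Y. (\<lambda>(A, s). (\<Prod>p\<in>A. 1 / real p) * (1 / real s)) (a d, r d))"
  proof (intro sum.cong refl)
    fix d assume d: "d \<in> squarefrees Y"
    have "1 / real d = 1 / (real (\<Prod>(a d)) * real (r d))" using dec[OF d] by (metis of_nat_mult)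
    thus "1 / real d = (\<lambda>(A, s). (\<Prod>p\<in>A. 1 / real p) * (1 / real s)) (a d, r d)"
      by (simp add: prod_dividef)
  qed
  also have "\<dots> = (\<Sum>(A, s)\<in>(\<lambda>d. (a d, r d)) ` squarefrees Y. (\<Prod>p\<in>A. 1 / real p) * (1 / real s))"
    using inj by (simp add: sum.reindex)
  also have "\<dots> \<le> (\<Sum>(A, s)\<in>Pow P \<times> R. (\<Prod>p\<in>A. 1 / real p) * (1 / real s))"
    using sub fR by (intro sum_mono2) (auto intro!: divide_nonneg_nonneg prod_nonneg simp: P_def)
  also have "\<dots> = (\<Sum>A\<in>Pow P. \<Prod>p\<in>A. 1 / real p) * (\<Sum>s\<in>R. 1 / real s)"
    by (simp add: sum_product sum.cartesian_product)
  finally show ?thesis by (simp add: P_def R_def)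
qed

lemma sum_ln_prime_factors_le:
  assumes "0 < (n::nat)"
  shows "(\<Sum>p\<in>prime_factors n. ln (real p)) \<le> ln (real n)"
proof -
  have "(\<Sum>p\<in>prime_factors n. ln (real p)) \<le> (\<Sum>p\<in>prime_factors n. real (multiplicity p n) * ln (real p))"
  proof (rule sum_mono)
    fix p assume p: "p \<in> prime_factors n"
    have "1 * ln (real p) \<le> real (multiplicity p n) * ln (real p)"
      using p prime_gt_1_nat[of p] by (intro mult_right_mono) (auto simp: prime_factors_multiplicity)
    thus "ln (real p) \<le> real (multiplicity p n) * ln (real p)" by simp
  qed
  also have "\<dots> \<le> (\<Sum>p | p \<in> {1..n} \<and> prime p. real (multiplicity p n) * ln (real p))"
    using assms
    by (intro sum_mono2) (auto simp: prime_gt_0_nat Suc_le_eq in_prime_factors_iff dvd_imp_le)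
  also have "\<dots> = ln (real n)" using assms by (simp only: ln_eq_sum_multiplicity[of n n])
  finally show ?thesis .
qed

lemma card_multiples_le: "0 < d \<Longrightarrow> real (card {m\<in>{1..n}. d dvd m}) \<le> real n / real (d::nat)"
  by (simp only: card_multiples of_nat_div_le_of_nat)

text \<open>Rough numbers are produced as \<open>p * r\<close> with \<open>r\<close> rough and
  \<open>p\<close> a prime in the interval of ratio \<open>b\<close> that places the product in (X /
  b, X]. The cutoff X / (b N) for \<open>r\<close> forces \<open>p\<close> above \<open>N\<close>.
  Weighting by ln p, each product is counted with total weight at most the logarithm of itself,
  hence at most ln X.\<close>

lemma sum_ln_rough_ge:
  fixes b :: nat
  assumes b: "2 \<le> b" "\<And>Y. real b \<le> Y \<Longrightarrow> Y / real b \<le> (\<Sum>p\<in>primes_in (Y / real b) Y. ln (real p))"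
    and N: "1 \<le> N" and X: "real b * N \<le> X"
  defines "T \<equiv> {r. X / real b < real r \<and> real r \<le> X \<and> rough N r}"
  shows "X / real b * (\<Sum>r\<in>rough_squarefrees N (nat \<lfloor>X / (real b * N)\<rfloor>). 1 / real r) \<le> real (card T) * ln X"
proof -
  define R where "R = rough_squarefrees N (nat \<lfloor>X / (real b * N)\<rfloor>)"
  define I where "I r = primes_in (X / real r / real b) (X / real r)" for r
  have b0: "0 < real b" using b by simp
  have fT: "finite T"
  proof (rule finite_subset)
    show "T \<subseteq> {..nat \<lfloor>X\<rfloor>}" by (auto simp: T_def le_nat_floor)
  qed simp
  have fR: "finite R" by (simp add: R_def rough_squarefrees_def)
  have R: "0 < r" "real r * (real b * N) \<le> X" "rough N r" if "r \<in> R" for r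
  proof -
    have r: "1 \<le> r" "r \<le> nat \<lfloor>X / (real b * N)\<rfloor>" "rough N r"
      using that squarefreesD[of r] by (auto simp: R_def rough_squarefrees_def)
    hence "1 \<le> X / (real b * N)" by linarith
    hence "real r \<le> X / (real b * N)" using r(2) by linarith
    thus "0 < r" "real r * (real b * N) \<le> X" "rough N r"
      using r b0 N by (auto simp: field_simps)
  qed
  have inj: "inj_on (\<lambda>(r, p). (p * r, p)) (Sigma R I)"
    using R by (auto simp: inj_on_def I_def primes_in_def prime_gt_0_nat)
  have sub: "(\<lambda>(r, p). (p * r, p)) ` Sigma R I \<subseteq> Sigma T prime_factors"
  proof (clarify)
    fix r p assume r: "r \<in> R" and p: "p \<in> I r"
    have pp: "prime p" "X / real r / real b < real p" "real p \<le> X / real r"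
      using p by (auto simp: I_def primes_in_def)
    have r0: "0 < real r" using R(1)[OF r] by simp
    have "N * real b \<le> X / real r" using R(2)[OF r] r0 by (simp add: field_simps)
    hence "N \<le> X / real r / real b" using b0 by (simp only: pos_le_divide_eq)
    hence "N < real p" using pp by linarith
    hence "rough N (p * r)" using R(3)[OF r] pp(1)
      by (auto simp: rough_def prime_dvd_mult_iff prime_gt_0_nat dest: primes_dvd_imp_eq)
    moreover have "X / real b < real (p * r)" "real (p * r) \<le> X"
      using pp r0 b0 by (auto simp: field_simps)
    moreover have "p \<in> prime_factors (p * r)"
      using pp R(1)[OF r] by (auto simp: in_prime_factors_iff)
    ultimately show "(p * r \<in> T) \<and> p \<in> prime_factors (p * r)" by (simp add: T_def)
  qed
  have "X / real b * (\<Sum>r\<in>R. 1 / real r) = (\<Sum>r\<in>R. X / real r / real b)"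
    by (simp add: sum_distrib_left mult_ac)
  also have "\<dots> \<le> (\<Sum>r\<in>R. \<Sum>p\<in>I r. ln (real p))"
  proof (rule sum_mono)
    fix r assume r: "r \<in> R"
    have "real b * 1 \<le> real b * N" using N b0 by (intro mult_left_mono) auto
    also have "\<dots> \<le> X / real r" using R[OF r] by (simp add: field_simps)
    finally show "X / real r / real b \<le> (\<Sum>p\<in>I r. ln (real p))"
      unfolding I_def by (intro b(2)) simp
  qed
  also have "\<dots> = (\<Sum>(r, p)\<in>Sigma R I. ln (real p))"
    using fR by (intro sum.Sigma) (auto simp: I_def)
  also have "\<dots> = (\<Sum>(n, p)\<in>(\<lambda>(r, p). (p * r, p)) ` Sigma R I. ln (real p))"
    using inj by (simp add: sum.reindex split_def)
  also have "\<dots> \<le> (\<Sum>(n, p)\<in>Sigma T prime_factors. ln (real p))"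
    using sub fT by (intro sum_mono2) (auto simp: prime_gt_0_nat Suc_le_eq in_prime_factors_iff)
  also have "\<dots> = (\<Sum>n\<in>T. \<Sum>p\<in>prime_factors n. ln (real p))"
    using fT by (intro sum.Sigma[symmetric]) auto
  also have "\<dots> \<le> (\<Sum>n\<in>T. ln X)"
  proof (rule sum_mono)
    fix n assume n: "n \<in> T"
    hence n0: "0 < n" by (simp add: T_def rough_def)
    hence "(\<Sum>p\<in>prime_factors n. ln (real p)) \<le> ln (real n)" by (rule sum_ln_prime_factors_le)
    also have "\<dots> \<le> ln X" using n n0 by (intro ln_mono) (auto simp: T_def)
    finally show "(\<Sum>p\<in>prime_factors n. ln (real p)) \<le> ln X" .
  qed
  also have "\<dots> = real (card T) * ln X" by simp
  finally show ?thesis by (simp only: R_def)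
qed

text \<open>Such a number is divisible by the square of a prime above \<open>N\<close>, so the tail
  of the sum of 1 / d^2 bounds the count. The factor 2 pays for rounding \<open>N\<close>
  down.\<close>

lemma card_rough_not_squarefree_le:
  assumes N: "1 \<le> N" and "0 \<le> X"
  shows "real (card {r. real r \<le> X \<and> rough N r \<and> \<not> squarefree r}) \<le> 2 * X / N"
proof -
  define n where "n = nat \<lfloor>X\<rfloor>"
  define m where "m = nat \<lfloor>N\<rfloor>"
  have m: "0 < m" "real m \<le> N" "N < real m + 1" using N by (auto simp: m_def)
  have n: "real n \<le> X" using assms by (simp add: n_def)
  have "{r. real r \<le> X \<and> rough N r \<and> \<not> squarefree r} \<subseteq> (\<Union>d\<in>{m<..n}. {r\<in>{1..n}. d ^ 2 dvd r})"
  proof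
    fix r assume "r \<in> {r. real r \<le> X \<and> rough N r \<and> \<not> squarefree r}"
    hence r: "real r \<le> X" "rough N r" "\<not> squarefree r" by auto
    have r0: "0 < r" using r by (simp add: rough_def)
    have rn: "r \<le> n" using r by (simp add: n_def le_nat_floor)
    obtain x where x: "x ^ 2 dvd r" "\<not> x dvd 1" using r(3) by (rule not_squarefreeE)
    then obtain p where p: "prime p" "p dvd x" using prime_factor_nat[of x] by auto
    hence pr: "p ^ 2 dvd r" using x(1) by (meson dvd_power_same dvd_trans)
    hence "p dvd r" by (metis dvd_trans dvd_triv_left power2_eq_square)
    hence "N < real p" using r(2) p(1) by (simp add: rough_def)
    hence "m < p" using m by linarith
    moreover have "p \<le> n" using dvd_imp_le[OF \<open>p dvd r\<close> r0] rn by simp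
    ultimately show "r \<in> (\<Union>d\<in>{m<..n}. {r\<in>{1..n}. d ^ 2 dvd r})" using pr r0 rn by auto
  qed
  hence "card {r. real r \<le> X \<and> rough N r \<and> \<not> squarefree r} \<le> card (\<Union>d\<in>{m<..n}. {r\<in>{1..n}. d ^ 2 dvd r})"
    by (intro card_mono) auto
  also have "\<dots> \<le> (\<Sum>d\<in>{m<..n}. card {r\<in>{1..n}. d ^ 2 dvd r})"
    by (rule card_UN_le) simp
  finally have "real (card {r. real r \<le> X \<and> rough N r \<and> \<not> squarefree r}) \<le> (\<Sum>d\<in>{m<..n}. real (card {r\<in>{1..n}. d ^ 2 dvd r}))"
    by (simp flip: of_nat_sum)
  also have "\<dots> \<le> (\<Sum>d\<in>{m<..n}. real n * (1 / real d ^ 2))"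
  proof (rule sum_mono)
    fix d assume "d \<in> {m<..n}"
    hence "0 < d ^ 2" by simp
    hence "real (card {r\<in>{1..n}. d ^ 2 dvd r}) \<le> real n / real (d ^ 2)" by (rule card_multiples_le)
    thus "real (card {r\<in>{1..n}. d ^ 2 dvd r}) \<le> real n * (1 / real d ^ 2)" by simp
  qed
  also have "\<dots> \<le> real n * (1 / real m)"
    unfolding sum_distrib_left[symmetric] using m by (intro mult_left_mono sum_inverse_squares_le) auto
  also have "\<dots> \<le> X * (2 / N)"
  proof (intro mult_mono)
    have "1 \<le> m" using m by simp
    hence "N \<le> 2 * real m" using m by linarith
    hence "2 / (2 * real m) \<le> 2 / N" using m N by (intro divide_left_mono[OF \<open>N \<le> 2 * real m\<close>]) auto
    thus "1 / real m \<le> 2 / N" by simp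
  qed (use n assms in auto)
  finally show ?thesis by (simp add: mult.commute)
qed

lemma card_rough_squarefree_ge:
  fixes b :: nat and \<delta> :: real
  assumes b: "2 \<le> b" "\<And>Y. real b \<le> Y \<Longrightarrow> Y / real b \<le> (\<Sum>p\<in>primes_in (Y / real b) Y. ln (real p))"
    and "0 < \<delta>" "\<delta> \<le> 1"
  obtains c N0 :: real where "0 < c" "1 \<le> N0"
    "\<And>N X. N0 \<le> N \<Longrightarrow> N powr (1 + \<delta>) \<le> X \<Longrightarrow> 
        c * X / ln N \<le> real (card {r. X / real b < real r \<and> real r \<le> X \<and> rough N r \<and> squarefree r})"
proof -
  obtain N1 :: real where N1: "3 \<le> N1"
    "\<And>N. N1 \<le> N \<Longrightarrow> (\<Sum>A\<in>Pow (primes_in 1 N). \<Prod>p\<in>A. 1 / real p) \<le> 12 * ln N"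
    using mertens_product_le by blast
  \<comment> \<open>The construction yields the density \<delta> / (96 b ln N), which is at least 2
    c / ln N; one half is given up to the numbers that are not squarefree.\<close>
  define c where "c = \<delta> / (200 * real b)"
  have c: "0 < c" using assms by (simp add: c_def)
  have "\<forall>\<^sub>F N in at_top. N1 \<le> N \<and> real b \<le> N powr (\<delta> / 2) \<and> 2 * ln N / N \<le> c"
  proof (intro eventually_conj)
    show "\<forall>\<^sub>F N in at_top. N1 \<le> N" by (rule eventually_ge_at_top)
    have "filterlim (\<lambda>N::real. N powr (\<delta> / 2)) at_top at_top" using assms by real_asymp
    thus "\<forall>\<^sub>F N in at_top. real b \<le> N powr (\<delta> / 2)" by (simp add: filterlim_at_top)
    have "((\<lambda>N::real. 2 * ln N / N) \<longlongrightarrow> 0) at_top" by real_asymp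
    from order_tendstoD(2)[OF this c] show "\<forall>\<^sub>F N in at_top. 2 * ln N / N \<le> c"
      by eventually_elim simp
  qed
  then obtain N0 where N0: "\<And>N. N0 \<le> N \<Longrightarrow> N1 \<le> N \<and> real b \<le> N powr (\<delta> / 2) \<and> 2 * ln N / N \<le> c"
    unfolding eventually_at_top_linorder by blast
  have "c * X / ln N \<le> real (card {r. X / real b < real r \<and> real r \<le> X \<and> rough N r \<and> squarefree r})"
    if N: "max 1 N0 \<le> N" and X: "N powr (1 + \<delta>) \<le> X" for N X
  proof -
    have N': "3 \<le> N" "N1 \<le> N" "real b \<le> N powr (\<delta> / 2)" "2 * ln N / N \<le> c" using N0[of N] N N1 by auto
    have lnN: "1 \<le> ln N" using N' ln3_gt_1 ln_mono[of 3 N] by linarith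
    have b0: "0 < real b" using b by simp
    have "0 < N powr (1 + \<delta>)" using N' by simp
    hence X0: "0 < X" using X by linarith
    have "ln (N powr (1 + \<delta>)) \<le> ln X" using X N' by (intro ln_mono) auto
    hence lnX: "(1 + \<delta>) * ln N \<le> ln X" using N' by (simp add: ln_powr)
    have "1 * 1 \<le> (1 + \<delta>) * ln N" using lnN assms by (intro mult_mono) auto
    hence lnX0: "0 < ln X" using lnX by linarith
    have "ln (real b) \<le> ln (N powr (\<delta> / 2))" using N' b0 by (intro ln_mono) auto
    hence lnb: "ln (real b) \<le> \<delta> / 2 * ln N" using N' by (simp add: ln_powr)
    have "real b * N \<le> N powr (\<delta> / 2) * N" using N' by (intro mult_right_mono) auto
    also have "\<dots> = N powr (\<delta> / 2 + 1)" using N' by (simp add: powr_add)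
    also have "\<dots> \<le> N powr (1 + \<delta>)" using N' assms by (intro powr_mono) auto
    finally have bN: "real b * N \<le> X" using X by linarith
    define Y where "Y = X / (real b * N)"
    have Y: "1 \<le> Y" using bN b0 N' by (simp add: Y_def field_simps)
    \<comment> \<open>Since \<open>X\<close> exceeds \<open>N\<close> by a fixed power, ln Y is a
      positive proportion of ln X. So the ln X in the bound for \<open>T\<close> cancels and the
      order X / ln N remains.\<close>
    have lnY: "\<delta> / 4 * ln X \<le> ln Y"
    proof -
      have "ln Y = ln X - ln (real b) - ln N" using X0 b0 N' by (simp add: Y_def ln_div ln_mult)
      hence "ln X - (1 + \<delta> / 2) * ln N \<le> ln Y" using lnb by (simp add: algebra_simps)
      moreover have "(1 + \<delta> / 2) * ln N \<le> (1 - \<delta> / 4) * ((1 + \<delta>) * ln N)"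
      proof -
        have "0 \<le> \<delta> * (1 - \<delta>)" using assms by simp
        moreover have "(1 - \<delta> / 4) * (1 + \<delta>) = 1 + \<delta> / 2 + \<delta> * (1 - \<delta>) / 4" by (simp add: field_simps)
        ultimately have "1 + \<delta> / 2 \<le> (1 - \<delta> / 4) * (1 + \<delta>)" by simp
        thus ?thesis using lnN by (simp only: mult.assoc[symmetric]) (intro mult_right_mono, auto)
      qed
      moreover have "(1 - \<delta> / 4) * ((1 + \<delta>) * ln N) \<le> (1 - \<delta> / 4) * ln X"
        using lnX assms by (intro mult_left_mono) auto
      ultimately show ?thesis by (simp add: algebra_simps)
    qed
    define L where "L = (\<Sum>r\<in>rough_squarefrees N (nat \<lfloor>Y\<rfloor>). 1 / real r)"
    have L0: "0 \<le> L" unfolding L_def by (intro sum_nonneg) auto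
    have "Y \<le> real (nat \<lfloor>Y\<rfloor>) + 1" using Y by linarith
    hence "ln Y / 2 \<le> ln (real (nat \<lfloor>Y\<rfloor>) + 1) / 2" using Y by (intro divide_right_mono ln_mono) auto
    also have "\<dots> \<le> (\<Sum>A\<in>Pow (primes_in 1 N). \<Prod>p\<in>A. 1 / real p) * L"
      unfolding L_def using N' by (intro sum_inverse_rough_squarefrees_ge) auto
    also have "\<dots> \<le> 12 * ln N * L" using N1(2)[of N] N' L0 by (intro mult_right_mono) auto
    finally have L: "ln Y \<le> 24 * ln N * L" by simp
    define T where "T = {r. X / real b < real r \<and> real r \<le> X \<and> rough N r}"
    have T: "X / real b * L \<le> real (card T) * ln X"
      unfolding T_def L_def Y_def using b N' bN by (intro sum_ln_rough_ge) auto
    have "X / real b * (\<delta> / 4 * ln X) \<le> X / real b * (24 * ln N * L)"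
      using lnY L X0 b0 by (intro mult_left_mono) auto
    also have "\<dots> = 24 * ln N * (X / real b * L)" by simp
    also have "\<dots> \<le> 24 * ln N * (real (card T) * ln X)" using T lnN by (intro mult_left_mono) auto
    finally have "X / real b * (\<delta> / 4) * ln X \<le> 24 * ln N * real (card T) * ln X" by (simp only: mult.assoc)
    hence "X / real b * (\<delta> / 4) \<le> 24 * ln N * real (card T)" using lnX0 by (simp only: mult_le_cancel_right_pos)
    hence "X / real b * (\<delta> / 4) / 24 \<le> 24 * ln N * real (card T) / 24" by (rule divide_right_mono) simp
    hence "X / real b * (\<delta> / 4) / 24 \<le> real (card T) * ln N" by (simp only: mult_ac)
    hence "X / real b * (\<delta> / 4) / 24 / ln N \<le> real (card T)" using lnN by (subst pos_divide_le_eq) auto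
    moreover have "2 * (c * X / ln N) \<le> X / real b * (\<delta> / 4) / 24 / ln N"
    proof -
      have "2 * c * X \<le> X / real b * (\<delta> / 4) / 24"
        using X0 b0 assms by (simp add: c_def field_simps)
      from divide_right_mono[OF this, of "ln N"] show ?thesis using lnN by (simp only: times_divide_eq_right mult.assoc)
    qed
    ultimately have T2: "2 * (c * X / ln N) \<le> real (card T)" by linarith
    have "2 * X / N \<le> c * X / ln N"
    proof -
      have "2 * ln N \<le> c * N" using N' by (simp add: field_simps)
      hence "2 * ln N * X \<le> c * N * X" using X0 by (intro mult_right_mono) auto
      thus ?thesis using lnN N' by (simp add: field_simps)
    qed
    hence NS: "real (card {r. real r \<le> X \<and> rough N r \<and> \<not> squarefree r}) \<le> c * X / ln N"
      using card_rough_not_squarefree_le[of N X] N' X0 by linarith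
    define U where "U = {r. X / real b < real r \<and> real r \<le> X \<and> rough N r \<and> squarefree r}"
    define V where "V = {r. real r \<le> X \<and> rough N r \<and> \<not> squarefree r}"
    have "finite {r. real r \<le> X}"
      by (rule finite_subset[of _ "{..nat \<lfloor>X\<rfloor>}"]) (auto simp: le_nat_floor)
    hence "finite U" "finite V" unfolding U_def V_def by (auto elim: finite_subset[rotated])
    hence "card T \<le> card U + card V"
      by (intro order_trans[OF card_mono[of "U \<union> V"] card_Un_le]) (auto simp: T_def U_def V_def)
    hence "real (card T) \<le> real (card U) + real (card V)" by simp
    thus ?thesis using T2 NS unfolding U_def V_def by linarith
  qed
  thus thesis using that[of c "max 1 N0"] c by simp
qed

section \<open>Density of the two signs of the Moebius function\<close>

text \<open>Union bound: discarding the multiples of 2, of 9, of d^2 for d > 3 and of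
  \<open>q\<close> leaves the proportion 1 - 1/2 - 1/9 - 1/3 - 1/36 = 1/36.\<close>

lemma card_odd_squarefree_coprime_ge:
  assumes "prime q" "36 \<le> q"
  shows "real K / 36 \<le> real (card {m\<in>{1..K}. odd m \<and> squarefree m \<and> \<not> q dvd m})"
proof -
  define S where "S = {m\<in>{1..K}. odd m \<and> squarefree m \<and> \<not> q dvd m}"
  define B where "B d = {m\<in>{1..K}. d dvd m}" for d :: nat
  have sub: "{1..K} \<subseteq> S \<union> (B 2 \<union> (B 9 \<union> ((\<Union>d\<in>{3<..K}. B (d ^ 2)) \<union> B q)))"
  proof
    fix m assume m: "m \<in> {1..K}"
    show "m \<in> S \<union> (B 2 \<union> (B 9 \<union> ((\<Union>d\<in>{3<..K}. B (d ^ 2)) \<union> B q)))"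
    proof (cases "squarefree m \<or> even m")
      case True
      thus ?thesis using m by (auto simp: S_def B_def)
    next
      case False
      then obtain x where x: "x ^ 2 dvd m" "\<not> x dvd 1" using not_squarefreeE by blast
      have "x \<noteq> 1" "x \<noteq> 0" "x \<noteq> 2" using x m False by (auto intro: Nat.gr0I)
      hence "x = 3 \<or> 3 < x" by linarith
      moreover have "x \<le> m" using x(1) m
        by (metis atLeastAtMost_iff dvd_imp_le dvd_trans dvd_triv_left less_le_trans power2_eq_square zero_less_one)
      ultimately show ?thesis using x m by (auto simp: B_def)
    qed
  qed
  have fB: "finite (B d)" for d by (simp add: B_def)
  have Bc: "real (card (B d)) \<le> real K / real d" if "0 < d" for d
    unfolding B_def using that by (rule card_multiples_le)
  have B2: "real (card (B 2)) \<le> real K / 2" using Bc[of 2] by simp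
  have B9: "real (card (B 9)) \<le> real K / 9" using Bc[of 9] by simp
  have Bq: "real (card (B q)) \<le> real K / 36"
  proof -
    have "real (card (B q)) \<le> real K / real q" using Bc[of q] assms by simp
    also have "\<dots> \<le> real K / 36" using assms by (intro divide_left_mono) auto
    finally show ?thesis .
  qed
  have "card (\<Union>d\<in>{3<..K}. B (d ^ 2)) \<le> (\<Sum>d\<in>{3<..K}. card (B (d ^ 2)))" by (rule card_UN_le) simp
  hence "real (card (\<Union>d\<in>{3<..K}. B (d ^ 2))) \<le> (\<Sum>d\<in>{3<..K}. real (card (B (d ^ 2))))"
    by (simp flip: of_nat_sum)
  also have "\<dots> \<le> (\<Sum>d\<in>{3<..K}. real K * (1 / real d ^ 2))"
    using Bc by (intro sum_mono) (metis divide_inverse greaterThanAtMost_iff inverse_eq_divide mult_1 of_nat_power gr_zeroI not_less_zero power_eq_0_iff zero_less_power)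
  also have "\<dots> \<le> real K * (1 / real 3)"
    unfolding sum_distrib_left[symmetric] by (intro mult_left_mono sum_inverse_squares_le) auto
  finally have BU: "real (card (\<Union>d\<in>{3<..K}. B (d ^ 2))) \<le> real K / 3" by simp
  have "K \<le> card (S \<union> (B 2 \<union> (B 9 \<union> ((\<Union>d\<in>{3<..K}. B (d ^ 2)) \<union> B q))))"
    using card_mono[OF _ sub] fB by (simp add: S_def)
  also have "\<dots> \<le> card S + (card (B 2) + (card (B 9) + (card (\<Union>d\<in>{3<..K}. B (d ^ 2)) + card (B q))))"
    by (intro order_trans[OF card_Un_le] add_left_mono card_Un_le)
  finally have "real K \<le> real (card S) + (real (card (B 2)) + (real (card (B 9)) + (real (card (\<Union>d\<in>{3<..K}. B (d ^ 2))) + real (card (B q)))))"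
    by (simp flip: of_nat_add)
  thus ?thesis using B2 B9 Bq BU unfolding S_def[symmetric] by linarith
qed

text \<open>Multiplication by \<open>2\<close> flips the sign of \<open>\<mu>\<close> on odd numbers, so both signs have positive density.\<close>

lemma card_moebius_mu_eq_ge:
  assumes "prime q" "36 \<le> q" "s = 1 \<or> s = -1" "2 \<le> M"
  shows "real M / 108 \<le> real (card {m\<in>{1..M}. moebius_mu m = s \<and> \<not> q dvd m})"
proof -
  define S where "S = {m\<in>{1..M div 2}. odd m \<and> squarefree m \<and> \<not> q dvd m}"
  define f where "f m = (if moebius_mu m = s then m else 2 * m)" for m
  have "inj_on f S"
    by (rule inj_onI) (auto simp: f_def S_def split: if_splits)
  moreover have "f ` S \<subseteq> {m\<in>{1..M}. moebius_mu m = s \<and> \<not> q dvd m}"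
  proof (rule image_subsetI)
    fix m assume m: "m \<in> S"
    have "moebius_mu (2 * m) = - moebius_mu m"
      using m by (simp add: moebius_mu_mult moebius_mu_prime S_def)
    moreover have "\<not> q dvd 2 * m"
      using m assms dvd_imp_le[of q 2] by (auto simp: S_def prime_dvd_mult_iff)
    moreover have "moebius_mu m = 1 \<or> moebius_mu m = -1"
      using m by (intro moebius_mu_cases) (simp add: S_def)
    ultimately show "f m \<in> {m\<in>{1..M}. moebius_mu m = s \<and> \<not> q dvd m}"
      using m assms(3) by (auto simp: f_def S_def)
  qed
  ultimately have "card S \<le> card {m\<in>{1..M}. moebius_mu m = s \<and> \<not> q dvd m}"
    by (intro card_inj_on_le) auto
  moreover have "real (M div 2) / 36 \<le> real (card S)"
    unfolding S_def using assms by (intro card_odd_squarefree_coprime_ge)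
  \<comment> \<open>Halving with rounding loses at most a factor 3 once \<open>M\<close> is at least
    2, whence 108 = 3 * 36.\<close>
  moreover have "real M / 3 \<le> real (M div 2)"
  proof -
    have "M \<le> 3 * (M div 2)" using assms(4) by presburger
    thus ?thesis by linarith
  qed
  ultimately show ?thesis by linarith
qed

section \<open>Averages over commuting permutations\<close>

text \<open>
  Operators that average over commuting permutations are normal, so the norms of the iterates are
  log-convex: \<open>\<parallel>S\<^sup>k f\<parallel>\<close> is at least \<open>\<kappa>\<^sup>k\<parallel>f\<parallel>\<close> once \<open>\<parallel>S f\<parallel> \<ge> \<kappa>\<parallel>f\<parallel>\<close>.
\<close>

lemma normal_operator_iterates:
  fixes S S' :: "('g \<Rightarrow> real) \<Rightarrow> 'g \<Rightarrow> real"
  assumes adj: "\<And>f g. (\<Sum>x\<in>\<Gamma>. S f x * g x) = (\<Sum>x\<in>\<Gamma>. f x * S' g x)"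
    and nrm: "\<And>g. (\<Sum>x\<in>\<Gamma>. (S' g x)\<^sup>2) = (\<Sum>x\<in>\<Gamma>. (S g x)\<^sup>2)"
    and \<kappa>: "0 \<le> \<kappa>" "\<kappa> * (\<Sum>x\<in>\<Gamma>. (f x)\<^sup>2) \<le> (\<Sum>x\<in>\<Gamma>. (S f x)\<^sup>2)"
  shows "\<kappa> ^ k * (\<Sum>x\<in>\<Gamma>. (f x)\<^sup>2) \<le> (\<Sum>x\<in>\<Gamma>. ((S ^^ k) f x)\<^sup>2)"
proof -
  define A where "A k = (\<Sum>x\<in>\<Gamma>. ((S ^^ k) f x)\<^sup>2)" for k
  have A0: "0 \<le> A k" for k unfolding A_def by (intro sum_nonneg) auto
  \<comment> \<open>Log-convexity, where normality enters: the adjoint and the operator give images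
    of equal norm when applied to \<open>S g\<close>.\<close>
  have conv: "(A (Suc k))\<^sup>2 \<le> A k * A (Suc (Suc k))" for k
  proof -
    define g where "g = (S ^^ k) f"
    have "A (Suc k) = (\<Sum>x\<in>\<Gamma>. S g x * S g x)" by (simp add: A_def g_def power2_eq_square)
    also have "\<dots> = (\<Sum>x\<in>\<Gamma>. g x * S' (S g) x)" by (rule adj)
    finally have "(A (Suc k))\<^sup>2 \<le> (\<Sum>x\<in>\<Gamma>. (g x)\<^sup>2) * (\<Sum>x\<in>\<Gamma>. (S' (S g) x)\<^sup>2)"
      by (simp only: Cauchy_Schwarz_ineq_sum)
    thus ?thesis by (simp add: nrm A_def g_def)
  qed
  have step: "\<kappa> * A k \<le> A (Suc k)" for k
  proof (induction k)
    case 0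
    show ?case using \<kappa> by (simp add: A_def)
  next
    case (Suc k)
    show ?case
    proof (cases "A k = 0")
      case True
      hence "(A (Suc k))\<^sup>2 \<le> 0" using conv[of k] by simp
      hence "A (Suc k) = 0" by simp
      thus ?thesis using A0 by simp
    next
      case False
      hence pos: "0 < A k" using A0[of k] by simp
      have "\<kappa> * A k * A (Suc k) \<le> A (Suc k) * A (Suc k)" using Suc A0 by (intro mult_right_mono) auto
      also have "\<dots> \<le> A k * A (Suc (Suc k))" using conv[of k] by (simp add: power2_eq_square)
      finally have "A k * (\<kappa> * A (Suc k)) \<le> A k * A (Suc (Suc k))" by (simp add: mult_ac)
      thus ?thesis using pos by (simp only: mult_le_cancel_left_pos)
    qed
  qed
  have "\<kappa> ^ k * A 0 \<le> A k"
  proof (induction k)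
    case (Suc k)
    have "\<kappa> ^ Suc k * A 0 = \<kappa> * (\<kappa> ^ k * A 0)" by simp
    also have "\<dots> \<le> \<kappa> * A k" using Suc \<kappa> by (intro mult_left_mono)
    also have "\<dots> \<le> A (Suc k)" by (rule step)
    finally show ?case .
  qed simp
  thus ?thesis by (simp add: A_def)
qed

text \<open>The adjoint averages over the inverse permutations. Expanding both square norms into
  pairs of indices and substituting \<open>\<pi> p (\<pi> r x)\<close> for \<open>x\<close> carries
  one into the other, because the permutations commute.\<close>

lemma commuting_permutations_iterates:
  fixes \<pi> :: "'p \<Rightarrow> 'g \<Rightarrow> 'g" and w :: "'p \<Rightarrow> real"
  assumes bij: "\<And>p. p \<in> P \<Longrightarrow> bij_betw (\<pi> p) \<Gamma> \<Gamma>"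
    and comm: "\<And>p r x. p \<in> P \<Longrightarrow> r \<in> P \<Longrightarrow> x \<in> \<Gamma> \<Longrightarrow> \<pi> p (\<pi> r x) = \<pi> r (\<pi> p x)"
    and \<kappa>: "0 \<le> \<kappa>" "\<kappa> * (\<Sum>x\<in>\<Gamma>. (f x)\<^sup>2) \<le> (\<Sum>x\<in>\<Gamma>. (\<Sum>p\<in>P. w p * f (\<pi> p x))\<^sup>2)"
  shows "\<kappa> ^ k * (\<Sum>x\<in>\<Gamma>. (f x)\<^sup>2) \<le> (\<Sum>x\<in>\<Gamma>. (((\<lambda>f x. \<Sum>p\<in>P. w p * f (\<pi> p x)) ^^ k) f x)\<^sup>2)"
proof -
  define \<rho> where "\<rho> p = inv_into \<Gamma> (\<pi> p)" for p
  define S where "S = (\<lambda>f x. \<Sum>p\<in>P. w p * f (\<pi> p x))"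
  define S' where "S' f x = (\<Sum>p\<in>P. w p * f (\<rho> p x))" for f :: "'g \<Rightarrow> real" and x
  have \<rho>: "\<rho> p (\<pi> p x) = x" if "p \<in> P" "x \<in> \<Gamma>" for p x
    unfolding \<rho>_def using bij[OF that(1)] that(2) by (intro inv_into_f_f) (auto simp: bij_betw_def)
  have \<pi>: "\<pi> p x \<in> \<Gamma>" if "p \<in> P" "x \<in> \<Gamma>" for p x
    using bij[OF that(1)] that(2) by (auto simp: bij_betw_def)
  have "(\<Sum>x\<in>\<Gamma>. S f x * g x) = (\<Sum>x\<in>\<Gamma>. f x * S' g x)" for f g
  proof -
    have "(\<Sum>x\<in>\<Gamma>. S f x * g x) = (\<Sum>x\<in>\<Gamma>. \<Sum>p\<in>P. w p * (f (\<pi> p x) * g (\<rho> p (\<pi> p x))))"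
      unfolding S_def sum_distrib_right by (intro sum.cong refl) (simp add: \<rho>)
    also have "\<dots> = (\<Sum>p\<in>P. \<Sum>x\<in>\<Gamma>. w p * (f (\<pi> p x) * g (\<rho> p (\<pi> p x))))" by (rule sum.swap)
    also have "\<dots> = (\<Sum>p\<in>P. \<Sum>x\<in>\<Gamma>. w p * (f x * g (\<rho> p x)))"
      by (intro sum.cong refl sum.reindex_bij_betw[OF bij, where g = "\<lambda>x. w _ * (f x * g (\<rho> _ x))"])
    also have "\<dots> = (\<Sum>x\<in>\<Gamma>. \<Sum>p\<in>P. w p * (f x * g (\<rho> p x)))" by (rule sum.swap)
    also have "\<dots> = (\<Sum>x\<in>\<Gamma>. f x * S' g x)"
      by (simp add: S'_def sum_distrib_left mult_ac)
    finally show ?thesis .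
  qed
  moreover have "(\<Sum>x\<in>\<Gamma>. (S' g x)\<^sup>2) = (\<Sum>x\<in>\<Gamma>. (S g x)\<^sup>2)" for g
  proof -
    have expand: "(\<Sum>x\<in>\<Gamma>. (\<Sum>p\<in>P. w p * g (\<tau> p x))\<^sup>2) = (\<Sum>p\<in>P. \<Sum>r\<in>P. w p * w r * (\<Sum>x\<in>\<Gamma>. g (\<tau> p x) * g (\<tau> r x)))"
      for \<tau> :: "'p \<Rightarrow> 'g \<Rightarrow> 'g"
    proof -
      have "(\<Sum>x\<in>\<Gamma>. (\<Sum>p\<in>P. w p * g (\<tau> p x))\<^sup>2) = (\<Sum>x\<in>\<Gamma>. \<Sum>p\<in>P. \<Sum>r\<in>P. w p * w r * (g (\<tau> p x) * g (\<tau> r x)))"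
        unfolding power2_eq_square sum_product by (intro sum.cong refl) (simp add: mult_ac)
      also have "\<dots> = (\<Sum>p\<in>P. \<Sum>x\<in>\<Gamma>. \<Sum>r\<in>P. w p * w r * (g (\<tau> p x) * g (\<tau> r x)))" by (rule sum.swap)
      also have "\<dots> = (\<Sum>p\<in>P. \<Sum>r\<in>P. \<Sum>x\<in>\<Gamma>. w p * w r * (g (\<tau> p x) * g (\<tau> r x)))"
        by (intro sum.cong refl sum.swap)
      finally show ?thesis by (simp add: sum_distrib_left)
    qed
    have "(\<Sum>x\<in>\<Gamma>. (S' g x)\<^sup>2) = (\<Sum>p\<in>P. \<Sum>r\<in>P. w p * w r * (\<Sum>x\<in>\<Gamma>. g (\<rho> p x) * g (\<rho> r x)))"
      unfolding S'_def by (rule expand)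
    also have "\<dots> = (\<Sum>p\<in>P. \<Sum>r\<in>P. w p * w r * (\<Sum>x\<in>\<Gamma>. g (\<pi> r x) * g (\<pi> p x)))"
    proof (rule sum.cong[OF refl], rule sum.cong[OF refl])
      fix p r assume pr: "p \<in> P" "r \<in> P"
      have "bij_betw (\<pi> p \<circ> \<pi> r) \<Gamma> \<Gamma>" using bij pr bij_betw_trans by blast
      hence "(\<Sum>x\<in>\<Gamma>. g (\<rho> p x) * g (\<rho> r x)) = (\<Sum>x\<in>\<Gamma>. g (\<rho> p ((\<pi> p \<circ> \<pi> r) x)) * g (\<rho> r ((\<pi> p \<circ> \<pi> r) x)))"
        by (rule sum.reindex_bij_betw[symmetric])
      also have "\<dots> = (\<Sum>x\<in>\<Gamma>. g (\<pi> r x) * g (\<pi> p x))"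
      proof (intro sum.cong refl)
        fix x assume x: "x \<in> \<Gamma>"
        have "\<rho> p (\<pi> p (\<pi> r x)) = \<pi> r x" using pr x \<pi> by (intro \<rho>)
        moreover have "\<rho> r (\<pi> p (\<pi> r x)) = \<pi> p x"
          unfolding comm[OF pr x] using pr x \<pi> by (intro \<rho>)
        ultimately show "g (\<rho> p ((\<pi> p \<circ> \<pi> r) x)) * g (\<rho> r ((\<pi> p \<circ> \<pi> r) x)) = g (\<pi> r x) * g (\<pi> p x)"
          by simp
      qed
      finally show "w p * w r * (\<Sum>x\<in>\<Gamma>. g (\<rho> p x) * g (\<rho> r x)) = w p * w r * (\<Sum>x\<in>\<Gamma>. g (\<pi> r x) * g (\<pi> p x))"
        by (simp only:)
    qed
    also have "\<dots> = (\<Sum>x\<in>\<Gamma>. (S g x)\<^sup>2)"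
      unfolding S_def expand by (intro sum.cong refl) (simp add: mult.commute)
    finally show ?thesis .
  qed
  ultimately have "\<kappa> ^ k * (\<Sum>x\<in>\<Gamma>. (f x)\<^sup>2) \<le> (\<Sum>x\<in>\<Gamma>. ((S ^^ k) f x)\<^sup>2)"
    using \<kappa> by (intro normal_operator_iterates[where S' = S']) (auto simp: S_def)
  thus ?thesis by (simp add: S_def)
qed

text \<open>
  The first coordinate of \<open>grid m q\<close> records a logarithmic scale (cyclically modulo \<open>m\<close>, which is harmless),
  the second a residue class. Multiplication by a prime \<open>p\<close> shifts the scale by \<open>\<lceil>log\<^sub>b p\<rceil>\<close>.
\<close>

definition grid :: "nat \<Rightarrow> nat \<Rightarrow> (nat \<times> nat) set" where
  "grid m q = {..<m} \<times> totatives q"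

definition log_scale :: "nat \<Rightarrow> nat \<Rightarrow> nat" where
  "log_scale b p = nat \<lceil>log (real b) (real p)\<rceil>"

definition mult_shift :: "nat \<Rightarrow> nat \<Rightarrow> nat \<Rightarrow> nat \<Rightarrow> nat \<times> nat \<Rightarrow> nat \<times> nat" where
  "mult_shift m q s n = (\<lambda>(i, a). ((i + s) mod m, (a * n) mod q))"

text \<open>The weight stands for 1 / p, from which it differs by at most the factor
  \<open>b\<close>. Being an exact power of \<open>b\<close>, it cancels against the scale factors
  in the trilinear count.\<close>

definition prime_op :: "nat set \<Rightarrow> nat \<Rightarrow> nat \<Rightarrow> nat \<Rightarrow> (nat \<times> nat \<Rightarrow> real) \<Rightarrow> nat \<times> nat \<Rightarrow> real" where
  "prime_op P b m q = (\<lambda>f x. \<Sum>p\<in>P. 1 / real b ^ log_scale b p * f (mult_shift m q (log_scale b p) p x))"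

text \<open>Failure of contraction by \<kappa> on functions of mean zero at each scale. The number
  \<open>m\<close> of scales is quantified because the range of scales used for a good modulus
  depends on that modulus.\<close>

definition bad_modulus :: "nat set \<Rightarrow> nat \<Rightarrow> real \<Rightarrow> nat \<Rightarrow> bool" where
  "bad_modulus P b \<kappa> q \<longleftrightarrow> (\<exists>m f. 0 < m \<and> (\<forall>i<m. (\<Sum>a\<in>totatives q. f (i, a)) = 0) \<and>
      \<kappa>\<^sup>2 * (\<Sum>x\<in>grid m q. (f x)\<^sup>2) < (\<Sum>x\<in>grid m q. (prime_op P b m q f x)\<^sup>2))"

definition tuples :: "nat set \<Rightarrow> nat \<Rightarrow> nat list set" where
  "tuples P k = {xs. set xs \<subseteq> P \<and> length xs = k}"

abbreviation tuple_scale :: "nat \<Rightarrow> nat list \<Rightarrow> nat" where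
  "tuple_scale b xs \<equiv> sum_list (map (log_scale b) xs)"

lemma finite_grid [simp]: "finite (grid m q)"
  by (simp add: grid_def)

lemma log_scale_bounds:
  assumes "2 \<le> b" "1 \<le> p"
  shows "real p \<le> real b ^ log_scale b p" "real b ^ log_scale b p \<le> real b * real p"
proof -
  have b: "1 < real b" using assms by simp
  have l: "0 \<le> log (real b) (real p)" using b assms by simp
  have "real p = real b powr (log (real b) (real p))" using b assms by simp
  also have "\<dots> \<le> real b powr real (log_scale b p)"
    using b l by (intro powr_mono) (auto simp: log_scale_def)
  finally show "real p \<le> real b ^ log_scale b p" using b by (simp add: powr_realpow)
  have "real (log_scale b p) \<le> log (real b) (real p) + 1" using l by (simp add: log_scale_def)
  hence "real b powr real (log_scale b p) \<le> real b powr (log (real b) (real p) + 1)"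
    using b by (intro powr_mono) auto
  also have "\<dots> = real b * real p" using b assms by (simp add: powr_add)
  finally show "real b ^ log_scale b p \<le> real b * real p" using b by (simp add: powr_realpow)
qed

lemma totatives_mult_bij:
  assumes "1 < q" "coprime n q"
  shows "bij_betw (\<lambda>a. (a * n) mod q) (totatives q) (totatives q)"
proof -
  have inj: "inj_on (\<lambda>a. (a * n) mod q) (totatives q)"
  proof (rule inj_onI)
    fix a c assume ac: "a \<in> totatives q" "c \<in> totatives q" "(a * n) mod q = (c * n) mod q"
    hence "[a * n = c * n] (mod q)" by (simp add: Cong.cong_def)
    hence "[a = c] (mod q)" using assms(2) cong_mult_rcancel_nat by blast
    moreover have "a < q" "c < q" using ac assms by (auto intro: totatives_less)
    ultimately show "a = c" by (simp add: Cong.cong_def)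
  qed
  have "(\<lambda>a. (a * n) mod q) ` totatives q \<subseteq> totatives q"
  proof (rule image_subsetI)
    fix a assume "a \<in> totatives q"
    hence "coprime (a * n) q" using assms by (auto simp: totatives_def)
    hence c: "coprime ((a * n) mod q) q" using assms by (simp add: coprime_mod_left_iff)
    have "(a * n) mod q \<noteq> 0" using c assms by (metis coprime_0_left_iff nat_dvd_1_iff_1 nat_neq_iff)
    thus "(a * n) mod q \<in> totatives q" using c assms by (auto simp: totatives_def less_imp_le)
  qed
  thus ?thesis using inj by (intro bij_betw_imageI endo_inj_surj) auto
qed

lemma mult_shift_bij:
  assumes "0 < m" "1 < q" "coprime n q"
  shows "bij_betw (mult_shift m q s n) (grid m q) (grid m q)"
proof -
  have "bij_betw (\<lambda>i. (i + s) mod m) {..<m} {..<m}"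
  proof -
    have "inj_on (\<lambda>i. (i + s) mod m) {..<m}"
    proof (rule inj_onI)
      fix i j assume "i \<in> {..<m}" "j \<in> {..<m}" "(i + s) mod m = (j + s) mod m"
      moreover from this have "[i + s = j + s] (mod m)" by (simp add: Cong.cong_def)
      hence "[i = j] (mod m)" by (simp only: cong_add_rcancel_nat)
      ultimately show "i = j" by (simp add: Cong.cong_def)
    qed
    thus ?thesis using assms by (intro bij_betw_imageI endo_inj_surj) auto
  qed
  from bij_betw_map_prod[OF this totatives_mult_bij[OF assms(2,3)]]
  show ?thesis by (simp add: grid_def mult_shift_def map_prod_def)
qed

lemma mult_shift_mult_shift:
  "mult_shift m q s n (mult_shift m q s' n' x) = mult_shift m q (s' + s) (n' * n) x"
  by (cases x) (simp add: mult_shift_def mod_simps ac_simps)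

lemma finite_tuples [simp]: "finite P \<Longrightarrow> finite (tuples P k)"
  unfolding tuples_def by (rule finite_lists_length_eq)

lemma tuples_0: "tuples P 0 = {[]}"
  by (auto simp: tuples_def)

lemma sum_tuples_Suc:
  assumes "finite P"
  shows "(\<Sum>xs\<in>tuples P (Suc k). F xs) = (\<Sum>p\<in>P. \<Sum>xs\<in>tuples P k. F (p # xs))"
proof -
  have "tuples P (Suc k) = (\<lambda>(p, xs). p # xs) ` (P \<times> tuples P k)"
    by (auto simp: tuples_def length_Suc_conv image_iff)
  moreover have "inj_on (\<lambda>(p, xs). p # xs) (P \<times> tuples P k)" by (auto simp: inj_on_def)
  ultimately have "(\<Sum>xs\<in>tuples P (Suc k). F xs) = (\<Sum>(p, xs)\<in>P \<times> tuples P k. F (p # xs))"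
    by (simp add: sum.reindex split_def)
  thus ?thesis by (simp add: sum.cartesian_product)
qed

lemma prime_op_iterate:
  assumes "finite P" "x \<in> grid m q" "1 < q" and cop: "\<And>p. p \<in> P \<Longrightarrow> coprime p q" "0 < m"
  shows "(prime_op P b m q ^^ k) f x =
    (\<Sum>xs\<in>tuples P k. 1 / real b ^ tuple_scale b xs * f (mult_shift m q (tuple_scale b xs) (prod_list xs) x))"
  using assms(2)
proof (induction k arbitrary: x)
  case 0
  have "mult_shift m q 0 1 x = x" using 0 assms(3)
    by (auto simp: mult_shift_def grid_def totatives_less)
  thus ?case by (simp add: tuples_0)
next
  case (Suc k)
  have "(prime_op P b m q ^^ Suc k) f x = 
     (\<Sum>p\<in>P. 1 / real b ^ log_scale b p * (prime_op P b m q ^^ k) f (mult_shift m q (log_scale b p) p x))"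
    by (simp add: prime_op_def)
  also have "\<dots> = (\<Sum>p\<in>P. \<Sum>xs\<in>tuples P k. 1 / real b ^ tuple_scale b (p # xs) * 
     f (mult_shift m q (tuple_scale b (p # xs)) (prod_list (p # xs)) x))"
  proof (intro sum.cong refl)
    fix p assume p: "p \<in> P"
    have "mult_shift m q (log_scale b p) p x \<in> grid m q"
      using mult_shift_bij[of m q p] cop p assms(3) Suc.prems by (metis bij_betw_apply)
    from Suc.IH[OF this] show "1 / real b ^ log_scale b p * (prime_op P b m q ^^ k) f (mult_shift m q (log_scale b p) p x) =
       (\<Sum>xs\<in>tuples P k. 1 / real b ^ tuple_scale b (p # xs) * 
         f (mult_shift m q (tuple_scale b (p # xs)) (prod_list (p # xs)) x))"
      by (simp add: mult_shift_mult_shift sum_distrib_left power_add)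
  qed
  also have "\<dots> = (\<Sum>xs\<in>tuples P (Suc k). 1 / real b ^ tuple_scale b xs * f (mult_shift m q (tuple_scale b xs) (prod_list xs) x))"
    using assms(1) by (simp only: sum_tuples_Suc)
  finally show ?case .
qed

text \<open>
  A bad modulus yields a matrix coefficient \<open>c\<close> of the regular representation: a bounded function on the
  residue classes, of mean zero at each scale, that correlates with products of \<open>k\<close> primes.
\<close>

lemma bad_modulus_coefficient:
  assumes bad: "bad_modulus P b \<kappa> q" and P: "finite P" "\<And>p. p \<in> P \<Longrightarrow> coprime p q"
    and q: "1 < q" and \<kappa>: "0 < \<kappa>"
  obtains c :: "nat \<Rightarrow> nat \<Rightarrow> real" where
    "\<And>s n. \<bar>c s n\<bar> \<le> 1" "\<And>s n. c s (n mod q) = c s n"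
    "\<And>s e. coprime e q \<Longrightarrow> (\<Sum>n<q. c s (e * n)) = 0"
    "\<kappa> ^ k \<le> (\<Sum>xs\<in>tuples P k. c (tuple_scale b xs) (prod_list xs) / real b ^ tuple_scale b xs)"
proof -
  from bad obtain m f where m: "0 < m" and f0: "\<And>i. i < m \<Longrightarrow> (\<Sum>a\<in>totatives q. f (i, a)) = 0"
    and big: "\<kappa>\<^sup>2 * (\<Sum>x\<in>grid m q. (f x)\<^sup>2) < (\<Sum>x\<in>grid m q. (prime_op P b m q f x)\<^sup>2)"
    unfolding bad_modulus_def by blast
  define \<Gamma> where "\<Gamma> = grid m q"
  define S where "S = prime_op P b m q"
  define F where "F = sqrt (\<Sum>x\<in>\<Gamma>. (f x)\<^sup>2)"
  define g where "g = (S ^^ k) f"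
  define H where "H = sqrt (\<Sum>x\<in>\<Gamma>. (g x)\<^sup>2)"
  have F2: "F\<^sup>2 = (\<Sum>x\<in>\<Gamma>. (f x)\<^sup>2)" unfolding F_def by (simp add: sum_nonneg)
  have H2: "H\<^sup>2 = (\<Sum>x\<in>\<Gamma>. (g x)\<^sup>2)" unfolding H_def by (simp add: sum_nonneg)
  have bij: "bij_betw (mult_shift m q s n) \<Gamma> \<Gamma>" if "coprime n q" for s n
    unfolding \<Gamma>_def using m q that by (rule mult_shift_bij)
  \<comment> \<open>The inequality defining a bad modulus is strict, which excludes the zero
    function and permits the normalisation of \<open>c\<close>.\<close>
  have "F \<noteq> 0"
  proof
    assume "F = 0"
    hence "\<forall>x\<in>\<Gamma>. (f x)\<^sup>2 = 0" using F2 by (simp add: sum_nonneg_eq_0_iff \<Gamma>_def)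
    hence "f x = 0" if "x \<in> \<Gamma>" for x using that by simp
    moreover have "mult_shift m q (log_scale b p) p x \<in> \<Gamma>" if "x \<in> \<Gamma>" "p \<in> P" for x p
      using bij[OF P(2)] that by (metis bij_betw_apply)
    ultimately have "S f x = 0" if "x \<in> \<Gamma>" for x
      unfolding S_def prime_op_def using that by (intro sum.neutral) auto
    hence "(\<Sum>x\<in>\<Gamma>. (S f x)\<^sup>2) = 0" by simp
    thus False using big F2 \<open>F = 0\<close> by (simp add: \<Gamma>_def S_def)
  qed
  hence F0: "0 < F" unfolding F_def by (simp add: sum_nonneg less_le)
  have "(\<kappa>\<^sup>2) ^ k * (\<Sum>x\<in>\<Gamma>. (f x)\<^sup>2) \<le> (\<Sum>x\<in>\<Gamma>. (g x)\<^sup>2)"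
    unfolding g_def S_def prime_op_def
  proof (rule commuting_permutations_iterates)
    show "\<kappa>\<^sup>2 * (\<Sum>x\<in>\<Gamma>. (f x)\<^sup>2) \<le> (\<Sum>x\<in>\<Gamma>. (\<Sum>p\<in>P. 1 / real b ^ log_scale b p * f (mult_shift m q (log_scale b p) p x))\<^sup>2)"
      using big by (simp add: \<Gamma>_def prime_op_def)
  qed (use bij P in \<open>auto simp: mult_shift_mult_shift ac_simps\<close>)
  hence "(\<kappa> ^ k * F)\<^sup>2 \<le> H\<^sup>2" by (simp add: F2 H2 power_mult_distrib flip: power_mult) (simp add: mult.commute)
  moreover have "0 \<le> H" unfolding H_def by (simp add: sum_nonneg)
  ultimately have HF: "\<kappa> ^ k * F \<le> H" by (rule power2_le_imp_le)
  have "0 < \<kappa> ^ k * F" using \<kappa> F0 by simp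
  hence H0: "0 < H" using HF by linarith
  \<comment> \<open>Correlation of a translate of \<open>f\<close> with the iterate
    \<open>g\<close>, scaled by the Cauchy-Schwarz bound. The value 0 off the invertible classes
    makes it a periodic function of all integers, as the sieve requires.\<close>
  define c where "c s n = (if coprime n q then (\<Sum>x\<in>\<Gamma>. f (mult_shift m q s n x) * g x) / (F * H) else 0)" for s n
  show thesis
  proof
    fix s n
    show "\<bar>c s n\<bar> \<le> 1"
    proof (cases "coprime n q")
      case True
      define t where "t = (\<Sum>x\<in>\<Gamma>. f (mult_shift m q s n x) * g x)"
      have "t\<^sup>2 \<le> (\<Sum>x\<in>\<Gamma>. (f (mult_shift m q s n x))\<^sup>2) * (\<Sum>x\<in>\<Gamma>. (g x)\<^sup>2)"
        unfolding t_def by (rule Cauchy_Schwarz_ineq_sum)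
      also have "(\<Sum>x\<in>\<Gamma>. (f (mult_shift m q s n x))\<^sup>2) = (\<Sum>x\<in>\<Gamma>. (f x)\<^sup>2)"
        by (rule sum.reindex_bij_betw[OF bij[OF True]])
      finally have "\<bar>t\<bar>\<^sup>2 \<le> (F * H)\<^sup>2" by (simp add: F2 H2 power_mult_distrib)
      hence "\<bar>t\<bar> \<le> F * H" by (rule power2_le_imp_le) (use F0 H0 in simp)
      thus ?thesis using True F0 H0 by (simp add: c_def t_def)
    qed (simp add: c_def)
    show "c s (n mod q) = c s n"
    proof -
      have "mult_shift m q s (n mod q) x = mult_shift m q s n x" for x
        by (cases x) (simp add: mult_shift_def mod_simps)
      moreover have "coprime (n mod q) q \<longleftrightarrow> coprime n q" using q by (simp add: coprime_mod_left_iff)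
      ultimately show ?thesis by (simp add: c_def)
    qed
  next
    fix s e assume e: "coprime e q"
    have tot: "totatives q \<subseteq> {..<q}" using q totatives_less by auto
    have "(\<Sum>n<q. c s (e * n)) = (\<Sum>n\<in>totatives q. c s (e * n))"
    proof (rule sum.mono_neutral_right)
      show "\<forall>n\<in>{..<q} - totatives q. c s (e * n) = 0"
      proof
        fix n assume n: "n \<in> {..<q} - totatives q"
        have "\<not> coprime n q"
        proof
          assume "coprime n q"
          moreover from this have "n \<noteq> 0" using q by (auto intro: Nat.gr0I)
          ultimately show False using n by (auto simp: totatives_def)
        qed
        thus "c s (e * n) = 0" by (simp add: c_def)
      qed
    qed (use tot in auto)
    also have "\<dots> = (\<Sum>n\<in>totatives q. \<Sum>x\<in>\<Gamma>. g x * f (mult_shift m q s (e * n) x) / (F * H))"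
      using e by (intro sum.cong refl) (simp add: c_def totatives_def sum_divide_distrib mult.commute)
    also have "\<dots> = (\<Sum>x\<in>\<Gamma>. \<Sum>n\<in>totatives q. g x * f (mult_shift m q s (e * n) x) / (F * H))" by (rule sum.swap)
    also have "\<dots> = 0"
    proof (rule sum.neutral, rule ballI)
      fix x assume "x \<in> \<Gamma>"
      then obtain i a where x: "x = (i, a)" "i < m" "a \<in> totatives q" by (auto simp: \<Gamma>_def grid_def)
      have ae: "coprime (a * e) q" using x e by (auto simp: totatives_def)
      define j where "j = (i + s) mod m"
      have "(\<Sum>n\<in>totatives q. f (mult_shift m q s (e * n) x)) = (\<Sum>n\<in>totatives q. f (j, (n * (a * e)) mod q))"
        by (simp add: x mult_shift_def j_def mult_ac)
      also have "\<dots> = (\<Sum>n\<in>totatives q. f (j, n))"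
        by (rule sum.reindex_bij_betw[OF totatives_mult_bij[OF q ae]])
      also have "\<dots> = 0" using m by (intro f0) (simp add: j_def)
      finally show "(\<Sum>n\<in>totatives q. g x * f (mult_shift m q s (e * n) x) / (F * H)) = 0"
        by (simp flip: sum_distrib_left sum_divide_distrib)
    qed
    finally show "(\<Sum>n<q. c s (e * n)) = 0" .
  next
    have cop: "coprime (prod_list xs) q" if "set xs \<subseteq> P" for xs
      using that P(2) by (induction xs) auto
    have "(\<Sum>xs\<in>tuples P k. c (tuple_scale b xs) (prod_list xs) / real b ^ tuple_scale b xs) =
      (\<Sum>xs\<in>tuples P k. \<Sum>x\<in>\<Gamma>. 1 / real b ^ tuple_scale b xs * f (mult_shift m q (tuple_scale b xs) (prod_list xs) x) * g x / (F * H))"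
      using cop by (intro sum.cong refl) (simp add: c_def tuples_def sum_divide_distrib mult.commute)
    also have "\<dots> = (\<Sum>x\<in>\<Gamma>. \<Sum>xs\<in>tuples P k. 1 / real b ^ tuple_scale b xs * f (mult_shift m q (tuple_scale b xs) (prod_list xs) x) * g x / (F * H))"
      by (rule sum.swap)
    also have "\<dots> = (\<Sum>x\<in>\<Gamma>. (\<Sum>xs\<in>tuples P k. 1 / real b ^ tuple_scale b xs * f (mult_shift m q (tuple_scale b xs) (prod_list xs) x)) * g x / (F * H))"
      by (simp only: sum_distrib_right sum_divide_distrib)
    \<comment> \<open>Summed over the tuples, the translates of \<open>f\<close> recombine to the
      iterate \<open>g\<close>, so the coefficient sum is H^2 / (F H) = H / F, at least
      \<kappa>^k.\<close>
    also have "\<dots> = (\<Sum>x\<in>\<Gamma>. g x * g x / (F * H))"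
    proof (intro sum.cong refl)
      fix x assume "x \<in> \<Gamma>"
      hence "g x = (\<Sum>xs\<in>tuples P k. 1 / real b ^ tuple_scale b xs * f (mult_shift m q (tuple_scale b xs) (prod_list xs) x))"
        unfolding g_def S_def \<Gamma>_def using P q m by (intro prime_op_iterate)
      thus "(\<Sum>xs\<in>tuples P k. 1 / real b ^ tuple_scale b xs * f (mult_shift m q (tuple_scale b xs) (prod_list xs) x)) * g x / (F * H) = g x * g x / (F * H)"
        by (simp only:)
    qed
    also have "\<dots> = H\<^sup>2 / (F * H)" unfolding H2 by (simp add: sum_divide_distrib power2_eq_square)
    also have "\<dots> = H / F" using H0 by (simp add: power2_eq_square)
    finally show "\<kappa> ^ k \<le> (\<Sum>xs\<in>tuples P k. c (tuple_scale b xs) (prod_list xs) / real b ^ tuple_scale b xs)"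
      using HF F0 by (simp add: pos_le_divide_eq)
  qed
qed

section \<open>Large sieve for bad moduli\<close>

lemma abs_sum_periodic_le:
  fixes w :: "nat \<Rightarrow> real"
  assumes K: "0 < K" and per: "\<And>n. w (n mod K) = w n" and zero: "(\<Sum>n<K. w n) = 0"
    and bd: "\<And>n. \<bar>w n\<bar> \<le> 1"
  shows "\<bar>\<Sum>n\<in>{1..M}. w n\<bar> \<le> real K"
proof -
  define T where "T M = (\<Sum>n<M. w n)" for M
  have add: "T (K + M) = T M" for M
  proof (induction M)
    case 0
    show ?case using zero by (simp add: T_def)
  next
    case (Suc M)
    have "w (K + M) = w M" using per[of "K + M"] per[of M] by simp
    thus ?case using Suc by (simp add: T_def)
  qed
  have "T (t * K + r) = T r" for t r
    by (induction t) (use add in \<open>simp_all add: add.assoc\<close>)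
  hence "T (Suc M) = T (Suc M mod K)" by (metis div_mult_mod_eq)
  moreover have "\<bar>T r\<bar> \<le> real r" for r
  proof -
    have "\<bar>T r\<bar> \<le> (\<Sum>n<r. \<bar>w n\<bar>)" unfolding T_def by (rule sum_abs)
    also have "\<dots> \<le> of_nat (card {..<r}) * 1" using bd by (intro sum_bounded_above) auto
    finally show ?thesis by simp
  qed
  \<comment> \<open>Full periods cancel and the incomplete one has at most \<open>K - 1\<close>
    terms; the spare unit pays for the term at 0, which the sum from 1 omits.\<close>
  moreover have "Suc M mod K + 1 \<le> K" using K by (simp add: Suc_le_eq)
  ultimately have "\<bar>T (Suc M)\<bar> + 1 \<le> real K" by (smt (verit) of_nat_1 of_nat_add of_nat_le_iff)
  moreover have "T (Suc M) = w 0 + (\<Sum>n\<in>{1..M}. w n)"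
  proof -
    have "{..<Suc M} = insert 0 {1..M}" by auto
    thus ?thesis by (simp add: T_def)
  qed
  ultimately show ?thesis using bd[of 0] by linarith
qed

text \<open>By the Chinese remainder theorem the pairs of residues run through the whole product, so
  the sum factors and the sum of \<open>u\<close> over a period is a factor.\<close>

lemma sum_product_periods_eq_0:
  fixes u v :: "nat \<Rightarrow> real"
  assumes "coprime q r" "0 < q" "0 < r"
    and u: "\<And>n. u (n mod q) = u n" "(\<Sum>n<q. u n) = 0" and v: "\<And>n. v (n mod r) = v n"
  shows "(\<Sum>n<q * r. u n * v n) = 0"
proof -
  have inj: "inj_on (\<lambda>n. (n mod q, n mod r)) {..<q * r}"
  proof (rule inj_onI)
    fix m n assume mn: "m \<in> {..<q * r}" "n \<in> {..<q * r}" "(m mod q, m mod r) = (n mod q, n mod r)"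
    hence "[m = n] (mod q * r)" using assms(1) by (intro coprime_cong_mult_nat) (auto simp: Cong.cong_def)
    thus "m = n" using mn by (simp add: Cong.cong_def)
  qed
  moreover have "(\<lambda>n. (n mod q, n mod r)) ` {..<q * r} = {..<q} \<times> {..<r}"
  proof (rule card_subset_eq)
    show "(\<lambda>n. (n mod q, n mod r)) ` {..<q * r} \<subseteq> {..<q} \<times> {..<r}" using assms by auto
    show "card ((\<lambda>n. (n mod q, n mod r)) ` {..<q * r}) = card ({..<q} \<times> {..<r})"
      using inj by (simp add: card_image card_cartesian_product)
  qed simp
  ultimately have "(\<Sum>(x, y)\<in>{..<q} \<times> {..<r}. u x * v y) = (\<Sum>n<q * r. u (n mod q) * v (n mod r))"
    by (metis (no_types, lifting) sum.reindex_cong old.prod.case)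
  hence "(\<Sum>n<q * r. u n * v n) = (\<Sum>(x, y)\<in>{..<q} \<times> {..<r}. u x * v y)" by (simp only: u v)
  also have "\<dots> = (\<Sum>x<q. u x) * (\<Sum>y<r. v y)" by (simp add: sum_product sum.cartesian_product)
  finally show ?thesis using u by simp
qed

text \<open>Near orthogonality. Along the multiples of lcm d e, the product of \<open>u\<close> and
  \<open>v\<close> again has period q r and mean zero, so its sum is at most q r whatever
  \<open>Y\<close> is. This is why \<open>u\<close> is assumed to have mean zero along every
  dilation by an \<open>e\<close> coprime to \<open>q\<close>.\<close>

lemma sum_selberg_beta_periodic_le:
  fixes u v :: "nat \<Rightarrow> real"
  assumes D: "1 \<le> D" and qr: "prime q" "prime r" "q \<noteq> r" "D < q" "D < r"
    and u: "\<And>n. \<bar>u n\<bar> \<le> 1" "\<And>n. u (n mod q) = u n" "\<And>e. coprime e q \<Longrightarrow> (\<Sum>n<q. u (e * n)) = 0"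
    and v: "\<And>n. \<bar>v n\<bar> \<le> 1" "\<And>n. v (n mod r) = v n"
  shows "(\<Sum>n\<in>{1..Y}. selberg_beta D n * (u n * v n)) \<le> real D ^ 4 * (real q * real r)"
proof -
  have pos: "0 < q" "0 < r" using qr by (auto simp: prime_gt_0_nat)
  have cqr: "coprime q r" using qr by (simp add: primes_coprime)
  have "\<bar>\<Sum>n\<in>{1..Y}. if lcm d e dvd n then u n * v n else 0\<bar> \<le> real q * real r"
    if de: "d \<in> squarefrees D" "e \<in> squarefrees D" for d e
  proof -
    define k where "k = lcm d e"
    have "1 \<le> d" "d < q" "1 \<le> e" "e < q" using squarefreesD[OF de(1)] squarefreesD[OF de(2)] qr by auto
    hence "\<not> q dvd d" "\<not> q dvd e" by (auto dest: dvd_imp_le)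
    hence "coprime d q" "coprime e q" using prime_imp_coprime[OF qr(1)] by (simp_all add: coprime_commute)
    hence "coprime (d * e) q" by simp
    hence kq: "coprime k q" unfolding k_def by (rule coprime_divisors[rotated 2]) auto
    have k0: "0 < k" using \<open>1 \<le> d\<close> \<open>1 \<le> e\<close> by (simp add: k_def lcm_pos_nat)
    have eq: "{n\<in>{1..Y}. k dvd n} = (*) k ` {1..Y div k}"
    proof (intro equalityI subsetI)
      fix n assume "n \<in> {n\<in>{1..Y}. k dvd n}"
      then obtain t where "n = k * t" "1 \<le> k * t" "k * t \<le> Y" by auto
      thus "n \<in> (*) k ` {1..Y div k}" using k0
        by (auto simp: less_eq_div_iff_mult_less_eq mult.commute intro!: imageI)
    qed (use k0 in \<open>auto simp: less_eq_div_iff_mult_less_eq mult.commute\<close>)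
    have "(\<Sum>n\<in>{1..Y}. if k dvd n then u n * v n else 0) = (\<Sum>n\<in>{n\<in>{1..Y}. k dvd n}. u n * v n)"
      by (rule sum.inter_filter[symmetric]) simp
    also have "\<dots> = (\<Sum>m\<in>{1..Y div k}. u (k * m) * v (k * m))"
      unfolding eq using k0 by (subst sum.reindex) (auto simp: inj_on_def)
    also have "\<bar>\<dots>\<bar> \<le> real (q * r)"
    proof (rule abs_sum_periodic_le)
      have pu: "u (k * (n mod q)) = u (k * n)" for n using u(2) by (metis mod_mult_right_eq)
      have pv: "v (k * (n mod r)) = v (k * n)" for n using v(2) by (metis mod_mult_right_eq)
      show "u (k * (n mod (q * r))) * v (k * (n mod (q * r))) = u (k * n) * v (k * n)" for n
        using pu[of "n mod (q * r)"] pu[of n] pv[of "n mod (q * r)"] pv[of n]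
        by (simp only: mod_mod_cancel[OF dvd_triv_left] mod_mod_cancel[OF dvd_triv_right])
      show "(\<Sum>n<q * r. u (k * n) * v (k * n)) = 0"
        using pu pv u(3)[OF kq] cqr pos by (intro sum_product_periods_eq_0) auto
      show "\<bar>u (k * n) * v (k * n)\<bar> \<le> 1" for n
        using u(1)[of "k * n"] v(1)[of "k * n"] by (simp add: abs_mult mult_le_one)
    qed (use pos in simp)
    finally show ?thesis by (simp add: k_def)
  qed
  hence "\<bar>\<Sum>d\<in>squarefrees D. \<Sum>e\<in>squarefrees D. selberg_lambda D d * selberg_lambda D e *
        (\<Sum>n\<in>{1..Y}. if lcm d e dvd n then u n * v n else 0)\<bar> \<le> real D ^ 4 * (real q * real r)"
    by (rule abs_double_sum_selberg_lambda_le[OF D])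
  thus ?thesis unfolding sum_selberg_beta by linarith
qed

lemma sum_over_fibres_le:
  fixes g :: "'b \<Rightarrow> real"
  assumes "finite A" "finite B" "h ` A \<subseteq> B" "\<And>y. y \<in> B \<Longrightarrow> 0 \<le> g y"
    and fib: "\<And>y. y \<in> B \<Longrightarrow> card {x\<in>A. h x = y} \<le> K"
  shows "(\<Sum>x\<in>A. g (h x)) \<le> real K * (\<Sum>y\<in>B. g y)"
proof -
  have "(\<Sum>x\<in>A. g (h x)) = (\<Sum>y\<in>B. \<Sum>x\<in>{x\<in>A. h x = y}. g (h x))"
    using assms by (intro sum.group[symmetric])
  also have "\<dots> = (\<Sum>y\<in>B. real (card {x\<in>A. h x = y}) * g y)" by (intro sum.cong refl) simp
  also have "\<dots> \<le> (\<Sum>y\<in>B. real K * g y)"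
    using fib assms(4) by (intro sum_mono mult_right_mono) auto
  finally show ?thesis by (simp add: sum_distrib_left)
qed

text \<open>By unique factorisation all tuples with product \<open>n\<close> draw their entries from
  the set of entries of a single one, which has at most \<open>k\<close> elements.\<close>

lemma card_tuples_prod_le:
  assumes "finite P" "\<And>p. p \<in> P \<Longrightarrow> prime p"
  shows "card {xs\<in>tuples P k. prod_list xs = n} \<le> k ^ k"
proof (cases "\<exists>ys\<in>tuples P k. prod_list ys = n")
  case True
  then obtain ys where ys: "set ys \<subseteq> P" "length ys = k" "prod_list ys = n" by (auto simp: tuples_def)
  have "{xs\<in>tuples P k. prod_list xs = n} \<subseteq> tuples (set ys) k"
  proof
    fix xs assume "xs \<in> {xs\<in>tuples P k. prod_list xs = n}"
    hence xs: "set xs \<subseteq> P" "length xs = k" "prod_list xs = n" by (auto simp: tuples_def)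
    have "p \<in> set ys" if p: "p \<in> set xs" for p
    proof -
      have pp: "prime p" using p xs assms(2) by auto
      have "p dvd prod_list ys" using prod_list_dvd[OF p] xs ys by simp
      moreover have "\<exists>r\<in>set l. p dvd r" if "p dvd prod_list l" for l
        using that pp by (induction l) (auto simp: prime_dvd_mult_iff)
      ultimately have "\<exists>r\<in>set ys. p dvd r" by blast
      then obtain r where "r \<in> set ys" "p dvd r" by blast
      moreover from this have "prime r" using ys assms(2) by auto
      ultimately show ?thesis using pp primes_dvd_imp_eq by blast
    qed
    thus "xs \<in> tuples (set ys) k" using xs by (auto simp: tuples_def)
  qed
  hence "card {xs\<in>tuples P k. prod_list xs = n} \<le> card (tuples (set ys) k)" by (intro card_mono) auto
  also have "\<dots> = card (set ys) ^ k" unfolding tuples_def by (rule card_lists_length_eq) simp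
  also have "\<dots> \<le> k ^ k" using card_length[of ys] ys by (intro power_mono) auto
  finally show ?thesis .
next
  case False
  hence "{xs\<in>tuples P k. prod_list xs = n} = {}" by auto
  thus ?thesis by (simp only: card.empty)
qed

lemma sum_tuples_power:
  assumes "finite P"
  shows "(\<Sum>xs\<in>tuples P k. 1 / real b ^ tuple_scale b xs) = (\<Sum>p\<in>P. 1 / real b ^ log_scale b p) ^ k"
proof (induction k)
  case (Suc k)
  have "(\<Sum>xs\<in>tuples P (Suc k). 1 / real b ^ tuple_scale b xs) =
     (\<Sum>p\<in>P. \<Sum>xs\<in>tuples P k. 1 / real b ^ log_scale b p * (1 / real b ^ tuple_scale b xs))"
    using assms by (simp add: sum_tuples_Suc power_add)
  also have "\<dots> = (\<Sum>p\<in>P. 1 / real b ^ log_scale b p) * (\<Sum>xs\<in>tuples P k. 1 / real b ^ tuple_scale b xs)"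
    by (rule sum_product[symmetric])
  finally show ?case by (simp only: Suc power_Suc)
qed (simp add: tuples_0)

text \<open>
  Large sieve inequality by duality: coefficients belonging to distinct bad moduli are nearly orthogonal,
  and the Selberg majorant \<open>selberg_beta\<close> of the products of \<open>k\<close> primes keeps the bound free of logarithms.
\<close>

lemma large_sieve_rough:
  fixes c :: "nat \<Rightarrow> nat \<Rightarrow> real"
  assumes D: "1 \<le> D" and B: "finite B" "\<And>q. q \<in> B \<Longrightarrow> prime q \<and> D < q \<and> real q \<le> Q"
    and c: "\<And>q n. q \<in> B \<Longrightarrow> \<bar>c q n\<bar> \<le> 1" "\<And>q n. q \<in> B \<Longrightarrow> c q (n mod q) = c q n"
      "\<And>q e. q \<in> B \<Longrightarrow> coprime e q \<Longrightarrow> (\<Sum>n<q. c q (e * n)) = 0"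
  shows "(\<Sum>n\<in>{1..Y}. selberg_beta D n * (\<Sum>q\<in>B. c q n)\<^sup>2)
    \<le> real (card B) * (real Y / selberg_G D + real D ^ 4) + (real (card B))\<^sup>2 * (real D ^ 4 * Q\<^sup>2)"
proof -
  define E where "E q r = (\<Sum>n\<in>{1..Y}. selberg_beta D n * (c q n * c r n))" for q r
  have bb: "(\<Sum>n\<in>{1..Y}. selberg_beta D n) \<le> real Y / selberg_G D + real D ^ 4"
  proof -
    have "(\<Sum>n\<in>{1..Y}. selberg_beta D n * (if [n = 0] (mod 1) then 1 else 0)) \<le> real Y / (real 1 * selberg_G D) + real D ^ 4"
      using D by (intro sum_selberg_beta_residue_class_le) auto
    thus ?thesis by (simp add: Cong.cong_def)
  qed
  have diag: "E q q \<le> real Y / selberg_G D + real D ^ 4" if q: "q \<in> B" for q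
  proof -
    have "E q q \<le> (\<Sum>n\<in>{1..Y}. selberg_beta D n * 1)"
      unfolding E_def
    proof (intro sum_mono mult_left_mono selberg_beta_nonneg)
      fix n
      have "\<bar>c q n\<bar> * \<bar>c q n\<bar> \<le> 1 * 1" using c(1)[OF q, of n] by (intro mult_mono) auto
      thus "c q n * c q n \<le> 1" by (simp add: abs_mult[symmetric])
    qed
    thus ?thesis using bb by simp
  qed
  have off: "E q r \<le> real D ^ 4 * Q\<^sup>2" if qr: "q \<in> B" "r \<in> B" "q \<noteq> r" for q r
  proof -
    have "E q r \<le> real D ^ 4 * (real q * real r)"
      unfolding E_def using D B(2) qr c by (intro sum_selberg_beta_periodic_le) auto
    also have "\<dots> \<le> real D ^ 4 * (Q * Q)"
    proof (intro mult_left_mono mult_mono)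
      show "real q \<le> Q" "real r \<le> Q" using B(2) qr by auto
      thus "0 \<le> Q" by (meson of_nat_0_le_iff order_trans)
    qed auto
    finally show ?thesis by (simp add: power2_eq_square)
  qed
  define d where "d = real Y / selberg_G D + real D ^ 4"
  have d0: "0 \<le> d" unfolding d_def using selberg_G_pos[OF D] by (intro add_nonneg_nonneg divide_nonneg_pos) auto
  have o0: "0 \<le> real D ^ 4 * Q\<^sup>2" by simp
  have "(\<Sum>n\<in>{1..Y}. selberg_beta D n * (\<Sum>q\<in>B. c q n)\<^sup>2) = (\<Sum>n\<in>{1..Y}. \<Sum>q\<in>B. \<Sum>r\<in>B. selberg_beta D n * (c q n * c r n))"
    unfolding power2_eq_square sum_product by (simp only: sum_distrib_left)
  also have "\<dots> = (\<Sum>q\<in>B. \<Sum>n\<in>{1..Y}. \<Sum>r\<in>B. selberg_beta D n * (c q n * c r n))" by (rule sum.swap)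
  also have "\<dots> = (\<Sum>q\<in>B. \<Sum>r\<in>B. E q r)" unfolding E_def by (intro sum.cong refl sum.swap)
  also have "\<dots> \<le> (\<Sum>q\<in>B. \<Sum>r\<in>B. (if r = q then d else 0) + real D ^ 4 * Q\<^sup>2)"
  proof (intro sum_mono)
    fix q r assume "q \<in> B" "r \<in> B"
    thus "E q r \<le> (if r = q then d else 0) + real D ^ 4 * Q\<^sup>2"
      using diag[of q] off[of q r] o0 d0 by (auto simp: d_def intro: add_increasing2)
  qed
  also have "\<dots> = real (card B) * d + (real (card B))\<^sup>2 * (real D ^ 4 * Q\<^sup>2)"
    using B(1) by (simp add: sum.distrib power2_eq_square algebra_simps)
  finally show ?thesis by (simp add: d_def)
qed

text \<open>On (z, z^2] the weight ln p lies between ln z and 2 ln z, and for ln z \<ge> 2 C the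
  Mertens sum lies between ln z / 2 and 3 ln z / 2.\<close>

lemma sum_inverse_primes_in_bounds:
  "\<exists>z0>1. \<forall>z\<ge>z0. (\<Sum>p\<in>primes_in z (z\<^sup>2). 1 / real p) \<le> 2 \<and> 1 / 4 \<le> (\<Sum>p\<in>primes_in z (z\<^sup>2). 1 / real p)"
proof -
  obtain C :: real where C: "0 < C"
    "\<And>u v. 1 \<le> u \<Longrightarrow> u \<le> v \<Longrightarrow> \<bar>(\<Sum>p\<in>primes_in u v. ln (real p) / real p) - ln (v / u)\<bar> \<le> C"
    using mertens_first by blast
  have main: "(\<Sum>p\<in>primes_in z (z\<^sup>2). 1 / real p) \<le> 2 \<and> 1 / 4 \<le> (\<Sum>p\<in>primes_in z (z\<^sup>2). 1 / real p)"
    if z: "exp (2 * C) \<le> z" for z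
  proof -
    have z1: "1 < z" using z C(1) by (metis exp_gt_one less_le_trans mult_pos_pos zero_less_numeral)
    have lz: "2 * C \<le> ln z" using z by (metis exp_gt_zero ln_exp ln_mono)
    hence lz0: "0 < ln z" using C(1) by linarith
    define T where "T = (\<Sum>p\<in>primes_in z (z\<^sup>2). ln (real p) / real p)"
    define S where "S = (\<Sum>p\<in>primes_in z (z\<^sup>2). 1 / real p)"
    have "\<bar>T - ln (z\<^sup>2 / z)\<bar> \<le> C" unfolding T_def using z1 by (intro C(2)) (auto simp: power2_eq_square)
    hence T: "\<bar>T - ln z\<bar> \<le> C" using z1 by (simp add: power2_eq_square)
    have "ln z * S \<le> T" unfolding S_def T_def sum_distrib_left
    proof (rule sum_mono)
      fix p assume "p \<in> primes_in z (z\<^sup>2)"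
      hence p: "z < real p" by (simp add: primes_in_def)
      hence "ln z \<le> ln (real p)" using z1 by simp
      thus "ln z * (1 / real p) \<le> ln (real p) / real p" using p z1 by (simp add: divide_right_mono)
    qed
    hence "ln z * S \<le> ln z * 2" using T lz C(1) by linarith
    hence "S \<le> 2" using lz0 by (simp only: mult_le_cancel_left_pos)
    moreover have "T \<le> (2 * ln z) * S" unfolding S_def T_def sum_distrib_left
    proof (rule sum_mono)
      fix p assume "p \<in> primes_in z (z\<^sup>2)"
      hence p: "z < real p" "real p \<le> z\<^sup>2" by (auto simp: primes_in_def)
      hence "ln (real p) \<le> ln (z\<^sup>2)" using z1 by (intro ln_mono) auto
      also have "\<dots> = 2 * ln z" using z1 by (simp add: ln_realpow)
      finally show "ln (real p) / real p \<le> 2 * ln z * (1 / real p)" using p z1 by (simp add: divide_right_mono)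
    qed
    hence "ln z * (1 / 4) \<le> ln z * S" using T lz by linarith
    hence "1 / 4 \<le> S" using lz0 by (simp only: mult_le_cancel_left_pos)
    ultimately show ?thesis by (simp add: S_def)
  qed
  have "1 < exp (2 * C)" using C(1) by simp
  thus ?thesis using main by (intro exI[of _ "exp (2 * C)"]) simp
qed

text \<open>Let \<open>R\<close> be the number of bad moduli. Adding their coefficient bounds and
  applying Cauchy-Schwarz over the tuples, then the large sieve at each scale, gives
  \<open>\<kappa> ^ (2 * k) * R\<^sup>2\<close> \<le> O(R) + O(ln Q / Q) R^2. For large
  \<open>Q\<close> the last term is absorbed and \<open>R\<close> is bounded. The primes depend on
  \<open>Q\<close> and not on \<open>q\<close>, so one family of tuples serves all moduli.\<close>

lemma card_bad_modulus_le:
  fixes b :: nat and \<kappa> \<eta> :: real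
  assumes b: "2 \<le> b" and \<kappa>: "0 < \<kappa>" and \<eta>: "0 < \<eta>" "\<eta> \<le> 1 / 8"
  obtains C Q0 :: real where "1 < Q0"
    "\<And>Q. Q0 \<le> Q \<Longrightarrow> real (card {q. prime q \<and> Q powr (1/2) \<le> real q \<and> real q \<le> Q \<and>
        bad_modulus (primes_in (Q powr \<eta>) ((Q powr \<eta>)\<^sup>2)) b \<kappa> q}) \<le> C"
proof -
  obtain z0 :: real where z0: "1 < z0" "\<And>z. z0 \<le> z \<Longrightarrow> (\<Sum>p\<in>primes_in z (z\<^sup>2). 1 / real p) \<le> 2"
    using sum_inverse_primes_in_bounds by meson
  \<comment> \<open>With \<eta> k \<ge> 4 a product of k primes above Q^\<eta> is at least Q^4. An
    off-diagonal term of the large sieve is at most D^4 Q^2 \<le> Q^3, hence at most 1 / Q after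
    division by the length.\<close>
  define k where "k = nat \<lceil>4 / \<eta>\<rceil>"
  have k: "4 \<le> \<eta> * real k"
  proof -
    have "4 / \<eta> \<le> real k" unfolding k_def by (rule real_nat_ceiling_ge)
    thus ?thesis using \<eta> by (simp add: field_simps)
  qed
  \<comment> \<open>A tuple has scale at most k (2 \<eta> ln Q / ln b + 1), so at most
    \<open>A * ln Q\<close> scales occur once 1 \<le> ln Q.\<close>
  define A where "A = 2 * real k * \<eta> / ln (real b) + real k + 1"
  define E where "E = 2 ^ k * real (k ^ k) * A"
  define C where "C = 2 * E * (2 / \<eta> + 1) / \<kappa> ^ (2 * k)"
  have lnb: "0 < ln (real b)" using b by simp
  have A0: "0 < A" unfolding A_def using lnb \<eta> by (intro add_nonneg_pos add_nonneg_nonneg) auto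
  have E0: "0 \<le> E" unfolding E_def using A0 by simp
  have "\<forall>\<^sub>F Q in at_top. 2 \<le> Q \<and> z0 \<le> Q powr \<eta> \<and> exp 1 \<le> Q \<and> E * ln Q / Q \<le> \<kappa> ^ (2 * k) / 2"
  proof (intro eventually_conj)
    show "\<forall>\<^sub>F Q::real in at_top. 2 \<le> Q" "\<forall>\<^sub>F Q::real in at_top. exp 1 \<le> Q" by (rule eventually_ge_at_top)+
    have "filterlim (\<lambda>Q::real. Q powr \<eta>) at_top at_top" using \<eta> by real_asymp
    thus "\<forall>\<^sub>F Q in at_top. z0 \<le> Q powr \<eta>" by (simp add: filterlim_at_top)
    have "((\<lambda>Q::real. E * ln Q / Q) \<longlongrightarrow> 0) at_top" by real_asymp
    moreover have "0 < \<kappa> ^ (2 * k) / 2" using \<kappa> by simp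
    ultimately have "\<forall>\<^sub>F Q in at_top. E * ln Q / Q < \<kappa> ^ (2 * k) / 2" by (rule order_tendstoD(2))
    thus "\<forall>\<^sub>F Q in at_top. E * ln Q / Q \<le> \<kappa> ^ (2 * k) / 2" by eventually_elim simp
  qed
  then obtain Q0 where Q0: "\<And>Q. Q0 \<le> Q \<Longrightarrow> 2 \<le> Q \<and> z0 \<le> Q powr \<eta> \<and> exp 1 \<le> Q \<and> E * ln Q / Q \<le> \<kappa> ^ (2 * k) / 2"
    unfolding eventually_at_top_linorder by blast
  have "real (card {q. prime q \<and> Q powr (1/2) \<le> real q \<and> real q \<le> Q \<and>
        bad_modulus (primes_in (Q powr \<eta>) ((Q powr \<eta>)\<^sup>2)) b \<kappa> q}) \<le> C" if Q: "max 2 Q0 \<le> Q" for Q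
  proof -
    define z where "z = Q powr \<eta>"
    define P where "P = primes_in z (z\<^sup>2)"
    define D where "D = nat \<lfloor>z\<rfloor>"
    define B where "B = {q. prime q \<and> Q powr (1/2) \<le> real q \<and> real q \<le> Q \<and> bad_modulus P b \<kappa> q}"
    define R where "R = real (card B)"
    have Q2: "2 \<le> Q" "z0 \<le> z" "exp 1 \<le> Q" "E * ln Q / Q \<le> \<kappa> ^ (2 * k) / 2"
      using Q0[of Q] Q by (auto simp: z_def)
    have lnQ: "1 \<le> ln Q" using Q2 by (metis exp_gt_zero ln_exp ln_mono)
    have z1: "1 < z" using Q2 z0 by linarith
    have D1: "1 \<le> D" using z1 by (simp add: D_def le_nat_floor)
    have Dz: "real D \<le> z" "z < real D + 1" using z1 by (auto simp: D_def)
    have lnz: "ln z = \<eta> * ln Q" using Q2 by (simp add: z_def ln_powr)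
    \<comment> \<open>Since 2 \<eta> < 1/2, all primes of the operator lie below Q^(1/2), hence
      below every modulus considered, and are coprime to it.\<close>
    have z2: "z\<^sup>2 < Q powr (1/2)"
    proof -
      have "z\<^sup>2 = Q powr (2 * \<eta>)" using Q2 by (simp add: z_def powr_power)
      also have "\<dots> < Q powr (1/2)" using Q2 \<eta> by (intro powr_less_mono) auto
      finally show ?thesis .
    qed
    have zz: "z \<le> z\<^sup>2" using z1 by (simp add: power2_eq_square)
    have fP: "finite P" by (simp add: P_def)
    have P: "prime p" "z < real p" "real p \<le> z\<^sup>2" if "p \<in> P" for p
      using that by (auto simp: P_def primes_in_def)
    have fB: "finite B"
    proof (rule finite_subset)
      show "B \<subseteq> {..nat \<lfloor>Q\<rfloor>}" by (auto simp: B_def le_nat_floor)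
    qed simp
    have B: "prime q" "D < q" "real q \<le> Q" "\<And>p. p \<in> P \<Longrightarrow> coprime p q" "bad_modulus P b \<kappa> q" if q: "q \<in> B" for q
    proof -
      show pq: "prime q" and "real q \<le> Q" and "bad_modulus P b \<kappa> q" using q by (auto simp: B_def)
      have ge: "z\<^sup>2 < real q" using q z2 by (auto simp: B_def)
      thus "D < q" using Dz zz by linarith
      fix p assume "p \<in> P"
      thus "coprime p q" using P[of p] ge pq by (intro primes_coprime) auto
    qed
    define coeff where "coeff q c \<longleftrightarrow> (\<forall>s n. \<bar>c s n\<bar> \<le> (1::real)) \<and> (\<forall>s n. c s (n mod q) = c s n) \<and>
        (\<forall>s e. coprime e q \<longrightarrow> (\<Sum>n<q. c s (e * n)) = 0) \<and>
        \<kappa> ^ k \<le> (\<Sum>xs\<in>tuples P k. c (tuple_scale b xs) (prod_list xs) / real b ^ tuple_scale b xs)"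
      for q :: nat and c
    have "\<exists>c. coeff q c" if q: "q \<in> B" for q
    proof -
      have "1 < q" using B(1)[OF q] by (rule prime_gt_1_nat)
      obtain c :: "nat \<Rightarrow> nat \<Rightarrow> real" where
        "\<And>s n. \<bar>c s n\<bar> \<le> 1" "\<And>s n. c s (n mod q) = c s n"
        "\<And>s e. coprime e q \<Longrightarrow> (\<Sum>n<q. c s (e * n)) = 0"
        "\<kappa> ^ k \<le> (\<Sum>xs\<in>tuples P k. c (tuple_scale b xs) (prod_list xs) / real b ^ tuple_scale b xs)"
        using bad_modulus_coefficient[OF B(5)[OF q] fP B(4)[OF q] \<open>1 < q\<close> \<kappa>, of k] by blast
      hence "coeff q c" unfolding coeff_def by blast
      thus ?thesis by blast
    qed
    hence "\<forall>q\<in>B. \<exists>c. coeff q c" by blast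
    from bchoice[OF this] obtain c where coeff: "\<forall>q\<in>B. coeff q (c q)" ..
    have c: "\<bar>c q s n\<bar> \<le> (1::real)" "c q s (n mod q) = c q s n" "coprime e q \<Longrightarrow> (\<Sum>n<q. c q s (e * n)) = 0"
      "\<kappa> ^ k \<le> (\<Sum>xs\<in>tuples P k. c q (tuple_scale b xs) (prod_list xs) / real b ^ tuple_scale b xs)"
      if "q \<in> B" for q s n e
      using bspec[OF coeff that] unfolding coeff_def by blast+
    define T where "T = tuples P k"
    define W where "W xs = 1 / real b ^ tuple_scale b xs" for xs
    define V where "V s n = (\<Sum>q\<in>B. c q s n)" for s n
    have fT: "finite T" unfolding T_def using fP by simp
    have W0: "0 \<le> W xs" for xs by (simp add: W_def)
    have "R * \<kappa> ^ k = (\<Sum>q\<in>B. \<kappa> ^ k)" by (simp add: R_def)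
    also have "\<dots> \<le> (\<Sum>q\<in>B. \<Sum>xs\<in>T. c q (tuple_scale b xs) (prod_list xs) / real b ^ tuple_scale b xs)"
      unfolding T_def using c(4) by (rule sum_mono)
    also have "\<dots> = (\<Sum>xs\<in>T. \<Sum>q\<in>B. c q (tuple_scale b xs) (prod_list xs) / real b ^ tuple_scale b xs)"
      by (rule sum.swap)
    \<comment> \<open>Splitting the weight evenly prepares Cauchy-Schwarz: one factor becomes the
      total weight, at most 2^k, the other the weighted mean square of the sum \<open>V\<close> over
      the bad moduli.\<close>
    also have "\<dots> = (\<Sum>xs\<in>T. sqrt (W xs) * (sqrt (W xs) * V (tuple_scale b xs) (prod_list xs)))"
      using W0 by (intro sum.cong refl) (simp add: V_def W_def sum_divide_distrib flip: mult.assoc)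
    finally have "(R * \<kappa> ^ k)\<^sup>2 \<le> (\<Sum>xs\<in>T. sqrt (W xs) * (sqrt (W xs) * V (tuple_scale b xs) (prod_list xs)))\<^sup>2"
      using \<kappa> by (intro power_mono) (auto simp: R_def)
    also have "\<dots> \<le> (\<Sum>xs\<in>T. (sqrt (W xs))\<^sup>2) * (\<Sum>xs\<in>T. (sqrt (W xs) * V (tuple_scale b xs) (prod_list xs))\<^sup>2)"
      by (rule Cauchy_Schwarz_ineq_sum)
    also have "\<dots> = (\<Sum>xs\<in>T. W xs) * (\<Sum>xs\<in>T. W xs * (V (tuple_scale b xs) (prod_list xs))\<^sup>2)"
      using W0 by (simp add: power_mult_distrib)
    finally have dual: "(R * \<kappa> ^ k)\<^sup>2 \<le> (\<Sum>xs\<in>T. W xs) * (\<Sum>xs\<in>T. W xs * (V (tuple_scale b xs) (prod_list xs))\<^sup>2)" .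
    have W1: "(\<Sum>xs\<in>T. W xs) \<le> 2 ^ k"
    proof -
      have "(\<Sum>xs\<in>T. W xs) = (\<Sum>p\<in>P. 1 / real b ^ log_scale b p) ^ k"
        unfolding T_def W_def using fP by (rule sum_tuples_power)
      also have "\<dots> \<le> (\<Sum>p\<in>P. 1 / real p) ^ k"
      proof (intro power_mono sum_mono sum_nonneg)
        fix p assume "p \<in> P"
        hence "1 \<le> p" using P(1) prime_ge_1_nat by blast
        thus "1 / real b ^ log_scale b p \<le> 1 / real p"
          using log_scale_bounds(1)[OF b, of p] b by (intro divide_left_mono) auto
      qed auto
      also have "\<dots> \<le> 2 ^ k" unfolding P_def using z0(2)[of z] Q2 by (intro power_mono sum_nonneg) auto
      finally show ?thesis .
    qed
    define \<sigma> where "\<sigma> = real k * (2 * \<eta> * ln Q / ln (real b) + 1)"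
    define I where "I = {s. real s \<le> \<sigma> \<and> Q ^ 4 \<le> real b ^ s}"
    have fI: "finite I" by (rule finite_subset[of _ "{..nat \<lfloor>\<sigma>\<rfloor>}"]) (auto simp: I_def le_nat_floor)
    have cI: "real (card I) \<le> A * ln Q"
    proof -
      have s0: "0 \<le> \<sigma>" unfolding \<sigma>_def using lnb \<eta> lnQ by (intro mult_nonneg_nonneg add_nonneg_nonneg divide_nonneg_pos) auto
      have "card I \<le> card {..nat \<lfloor>\<sigma>\<rfloor>}" by (intro card_mono) (auto simp: I_def le_nat_floor)
      hence "real (card I) \<le> \<sigma> + 1" using s0 by (simp add: le_nat_floor) linarith
      also have "\<sigma> + 1 = (2 * real k * \<eta> / ln (real b)) * ln Q + (real k + 1) * 1" by (simp add: \<sigma>_def algebra_simps)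
      also have "\<dots> \<le> (2 * real k * \<eta> / ln (real b)) * ln Q + (real k + 1) * ln Q"
        using lnQ by (intro add_left_mono mult_left_mono) auto
      also have "\<dots> = A * ln Q" by (simp add: A_def algebra_simps)
      finally show ?thesis .
    qed
    have xs: "real (prod_list xs) \<le> real b ^ tuple_scale b xs" "z ^ length xs \<le> real (prod_list xs)"
      "real (tuple_scale b xs) \<le> real (length xs) * (2 * \<eta> * ln Q / ln (real b) + 1)" "rough (real D) (prod_list xs)"
      if "set xs \<subseteq> P" for xs
    proof -
      have "real (prod_list xs) \<le> real b ^ tuple_scale b xs \<and> z ^ length xs \<le> real (prod_list xs) \<and>
        real (tuple_scale b xs) \<le> real (length xs) * (2 * \<eta> * ln Q / ln (real b) + 1) \<and> rough (real D) (prod_list xs)"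
        using that
      proof (induction xs)
        case Nil
        thus ?case by (auto simp: rough_def)
      next
        case (Cons p xs)
        hence p: "p \<in> P" and IH: "real (prod_list xs) \<le> real b ^ tuple_scale b xs" "z ^ length xs \<le> real (prod_list xs)"
          "real (tuple_scale b xs) \<le> real (length xs) * (2 * \<eta> * ln Q / ln (real b) + 1)" "rough (real D) (prod_list xs)"
          by auto
        have p1: "1 \<le> p" using P(1)[OF p] prime_ge_1_nat by blast
        have "real (prod_list (p # xs)) \<le> real b ^ tuple_scale b (p # xs)"
          using log_scale_bounds(1)[OF b p1] IH by (simp add: power_add mult_mono)
        moreover have "z ^ length (p # xs) \<le> real (prod_list (p # xs))"
          using P(2)[OF p] IH z1 by (simp add: mult_mono)
        moreover have ls: "real (log_scale b p) \<le> 2 * \<eta> * ln Q / ln (real b) + 1"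
        proof -
          have "ln (real p) \<le> ln (z\<^sup>2)" using P(3)[OF p] p1 by (intro ln_mono) auto
          also have "\<dots> = 2 * \<eta> * ln Q" using lnz z1 by (simp add: ln_realpow)
          finally have "log (real b) (real p) \<le> 2 * \<eta> * ln Q / ln (real b)"
            unfolding log_def using lnb by (intro divide_right_mono) auto
          moreover have "0 \<le> log (real b) (real p)" using b p1 by simp
          ultimately show ?thesis unfolding log_scale_def by linarith
        qed
        have "real (length (p # xs)) * t = t + real (length xs) * t" for t
          by (simp add: distrib_right)
        moreover from ls this have "real (tuple_scale b (p # xs)) \<le> real (length (p # xs)) * (2 * \<eta> * ln Q / ln (real b) + 1)"
          using IH(3) by (simp only: list.map sum_list.Cons of_nat_add)
        moreover have "rough (real D) (prod_list (p # xs))"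
        proof -
          have "real D < real p" using P(2)[OF p] Dz by linarith
          thus ?thesis using IH(4) P(1)[OF p] p1
            by (auto simp: rough_def prime_dvd_mult_iff dest: primes_dvd_imp_eq)
        qed
        ultimately show ?case by blast
      qed
      thus "real (prod_list xs) \<le> real b ^ tuple_scale b xs" "z ^ length xs \<le> real (prod_list xs)"
        "real (tuple_scale b xs) \<le> real (length xs) * (2 * \<eta> * ln Q / ln (real b) + 1)" "rough (real D) (prod_list xs)"
        by auto
    qed
    have zk: "Q ^ 4 \<le> z ^ k"
    proof -
      have "Q ^ 4 = Q powr 4" using Q2 by simp
      also have "\<dots> \<le> Q powr (\<eta> * real k)" using Q2 k by (intro powr_mono) auto
      also have "\<dots> = z ^ k" using Q2 by (simp add: z_def powr_power mult.commute)
      finally show ?thesis .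
    qed
    \<comment> \<open>The scale of a tuple is kept beside its product because the coefficients
      depend on both. Passing from tuples to such pairs costs k^k, and the sum over products is then
      extended to all integers up to b^s with the Selberg majorant.\<close>
    define g where "g = (\<lambda>(s, n). 1 / real b ^ s * (selberg_beta D n * (V s n)\<^sup>2))"
    define Y where "Y = Sigma I (\<lambda>s. {1..b ^ s})"
    have "(\<Sum>xs\<in>T. W xs * (V (tuple_scale b xs) (prod_list xs))\<^sup>2) = (\<Sum>xs\<in>T. g (tuple_scale b xs, prod_list xs))"
    proof (intro sum.cong refl)
      fix ys assume "ys \<in> T"
      hence "rough (real D) (prod_list ys)" by (intro xs(4)) (simp add: T_def tuples_def)
      hence "selberg_beta D (prod_list ys) = 1" using D1 by (intro selberg_beta_rough)
      thus "W ys * (V (tuple_scale b ys) (prod_list ys))\<^sup>2 = g (tuple_scale b ys, prod_list ys)"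
        by (simp add: W_def g_def)
    qed
    also have "\<dots> \<le> real (k ^ k) * (\<Sum>y\<in>Y. g y)"
    proof (rule sum_over_fibres_le)
      show "(\<lambda>xs. (tuple_scale b xs, prod_list xs)) ` T \<subseteq> Y"
      proof (rule image_subsetI)
        fix ys assume "ys \<in> T"
        hence ys: "set ys \<subseteq> P" "length ys = k" by (auto simp: T_def tuples_def)
        have "real (prod_list ys) \<le> real (b ^ tuple_scale b ys)" using xs(1)[OF ys(1)] by simp
        hence "prod_list ys \<le> b ^ tuple_scale b ys" by (simp only: of_nat_le_iff)
        moreover have "Q ^ 4 \<le> real b ^ tuple_scale b ys" using xs(1)[OF ys(1)] xs(2)[OF ys(1)] zk unfolding ys(2) by linarith
        moreover have "real (tuple_scale b ys) \<le> \<sigma>" using xs(3)[OF ys(1)] ys(2) by (simp add: \<sigma>_def)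
        moreover have "0 < prod_list ys" using xs(4)[OF ys(1)] by (simp add: rough_def)
        ultimately show "(tuple_scale b ys, prod_list ys) \<in> Y" by (simp add: Y_def I_def Suc_le_eq)
      qed
      fix y
      have "card {xs\<in>T. (tuple_scale b xs, prod_list xs) = y} \<le> card {xs\<in>T. prod_list xs = snd y}"
        using fT by (intro card_mono) auto
      also have "\<dots> \<le> k ^ k" unfolding T_def using fP P(1) by (rule card_tuples_prod_le)
      finally show "card {xs\<in>T. (tuple_scale b xs, prod_list xs) = y} \<le> k ^ k" .
    qed (use fT fI in \<open>auto simp: Y_def g_def selberg_beta_nonneg\<close>)
    also have "(\<Sum>y\<in>Y. g y) = (\<Sum>s\<in>I. 1 / real b ^ s * (\<Sum>n\<in>{1..b ^ s}. selberg_beta D n * (V s n)\<^sup>2))"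
      unfolding Y_def g_def using fI by (subst sum.Sigma[symmetric]) (auto simp: sum_distrib_left)
    also have "\<dots> \<le> (\<Sum>s\<in>I. R * (2 / (\<eta> * ln Q) + 1 / Q ^ 3) + R\<^sup>2 * (1 / Q))"
    proof (rule sum_mono)
      fix s assume s: "s \<in> I"
      have bs: "Q ^ 4 \<le> real b ^ s" using s by (simp add: I_def)
      have Q40: "0 < Q ^ 4" using Q2 by simp
      hence bs0: "0 < real b ^ s" using bs by linarith
      have G0: "0 < selberg_G D" using D1 by (rule selberg_G_pos)
      have D4: "real D ^ 4 \<le> Q"
      proof -
        have "real D ^ 4 \<le> z ^ 4" using Dz by (intro power_mono) auto
        also have "\<dots> = Q powr (4 * \<eta>)" using Q2 by (simp add: z_def powr_power)
        also have "\<dots> \<le> Q powr 1" using Q2 \<eta> by (intro powr_mono) auto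
        finally show ?thesis using Q2 by simp
      qed
      have G: "1 / selberg_G D \<le> 2 / (\<eta> * ln Q)"
      proof -
        have "ln z \<le> ln (real D + 1)" using Dz z1 by (intro ln_mono) auto
        hence "\<eta> * ln Q / 2 \<le> selberg_G D" using selberg_G_ge[of D] lnz by linarith
        moreover have "0 < \<eta> * ln Q" using \<eta> lnQ by simp
        ultimately have "1 / selberg_G D \<le> 1 / (\<eta> * ln Q / 2)" by (intro divide_left_mono mult_pos_pos G0) auto
        thus ?thesis by simp
      qed
      have DQ: "real D ^ 4 / real b ^ s \<le> 1 / Q ^ 3"
      proof -
        have "real D ^ 4 / real b ^ s \<le> Q / Q ^ 4" using D4 bs Q40 Q2 by (intro frac_le) auto
        also have "\<dots> = 1 / Q ^ 3" using Q2 by (simp add: power_eq_if)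
        finally show ?thesis .
      qed
      have "(\<Sum>n\<in>{1..b ^ s}. selberg_beta D n * (V s n)\<^sup>2) \<le>
         R * (real (b ^ s) / selberg_G D + real D ^ 4) + R\<^sup>2 * (real D ^ 4 * Q\<^sup>2)"
        unfolding V_def R_def using fB D1 B(1,2,3) c(1,2,3) by (intro large_sieve_rough) auto
      hence "1 / real b ^ s * (\<Sum>n\<in>{1..b ^ s}. selberg_beta D n * (V s n)\<^sup>2) \<le>
         1 / real b ^ s * (R * (real (b ^ s) / selberg_G D + real D ^ 4) + R\<^sup>2 * (real D ^ 4 * Q\<^sup>2))"
        using bs0 by (intro mult_left_mono) auto
      also have "\<dots> = R * (1 / selberg_G D + real D ^ 4 / real b ^ s) + R\<^sup>2 * (real D ^ 4 / real b ^ s * Q\<^sup>2)"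
        using bs0 by (simp add: field_simps)
      also have "\<dots> \<le> R * (2 / (\<eta> * ln Q) + 1 / Q ^ 3) + R\<^sup>2 * (1 / Q ^ 3 * Q\<^sup>2)"
        using G DQ by (intro add_mono mult_left_mono mult_right_mono) (auto simp: R_def)
      also have "1 / Q ^ 3 * Q\<^sup>2 = 1 / Q" using Q2 by (simp add: power_eq_if)
      finally show "1 / real b ^ s * (\<Sum>n\<in>{1..b ^ s}. selberg_beta D n * (V s n)\<^sup>2) \<le>
          R * (2 / (\<eta> * ln Q) + 1 / Q ^ 3) + R\<^sup>2 * (1 / Q)" .
    qed
    also have "\<dots> = real (card I) * (R * (2 / (\<eta> * ln Q) + 1 / Q ^ 3) + R\<^sup>2 * (1 / Q))" by simp
    also have "\<dots> \<le> (A * ln Q) * (R * (2 / (\<eta> * ln Q) + 1 / Q ^ 3) + R\<^sup>2 * (1 / Q))"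
      using cI \<eta> lnQ Q2 by (intro mult_right_mono add_nonneg_nonneg mult_nonneg_nonneg) (auto simp: R_def)
    \<comment> \<open>The factor ln Q from the number of scales cancels the 1 / ln Q gained by the
      sieve in the diagonal term.\<close>
    also have "\<dots> = A * (R * (2 / \<eta> + ln Q / Q ^ 3) + R\<^sup>2 * (ln Q / Q))"
      using lnQ \<eta> by (simp add: field_simps)
    also have "\<dots> \<le> A * (R * (2 / \<eta> + 1) + R\<^sup>2 * (ln Q / Q))"
    proof -
      have "ln Q \<le> Q" using Q2 ln_bound[of Q] by simp
      also have "Q \<le> Q ^ 3" using Q2 by (intro self_le_power) auto
      finally have "ln Q / Q ^ 3 \<le> 1" using Q2 by simp
      thus ?thesis using A0 by (intro mult_left_mono add_mono) (auto simp: R_def)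
    qed
    finally have "(\<Sum>xs\<in>T. W xs * (V (tuple_scale b xs) (prod_list xs))\<^sup>2) \<le> real (k ^ k) * (A * (R * (2 / \<eta> + 1) + R\<^sup>2 * (ln Q / Q)))"
      by (simp add: mult_left_mono)
    hence "(\<Sum>xs\<in>T. W xs) * (\<Sum>xs\<in>T. W xs * (V (tuple_scale b xs) (prod_list xs))\<^sup>2) \<le>
        2 ^ k * (real (k ^ k) * (A * (R * (2 / \<eta> + 1) + R\<^sup>2 * (ln Q / Q))))"
      using W1 W0 by (intro mult_mono sum_nonneg mult_nonneg_nonneg) auto
    also have "\<dots> = E * (R * (2 / \<eta> + 1)) + (E * ln Q / Q) * R\<^sup>2" by (simp add: E_def algebra_simps)
    also have "\<dots> \<le> E * (R * (2 / \<eta> + 1)) + (\<kappa> ^ (2 * k) / 2) * R\<^sup>2"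
      using Q2 by (intro add_left_mono mult_right_mono) auto
    finally have "(R * \<kappa> ^ k)\<^sup>2 \<le> E * (R * (2 / \<eta> + 1)) + (\<kappa> ^ (2 * k) / 2) * R\<^sup>2" using dual by linarith
    moreover have "(R * \<kappa> ^ k)\<^sup>2 = \<kappa> ^ (2 * k) * R\<^sup>2" by (simp add: power_mult_distrib mult.commute flip: power_mult)
    ultimately have "\<kappa> ^ (2 * k) * R\<^sup>2 \<le> 2 * (E * (R * (2 / \<eta> + 1)))" by linarith
    hence "R * (\<kappa> ^ (2 * k) * R) \<le> R * (2 * E * (2 / \<eta> + 1))" by (simp add: power2_eq_square mult_ac)
    moreover have "0 \<le> 2 * E * (2 / \<eta> + 1)" using E0 \<eta> by (intro mult_nonneg_nonneg) auto
    ultimately have "\<kappa> ^ (2 * k) * R \<le> 2 * E * (2 / \<eta> + 1)"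
      by (cases "R = 0") (auto simp: R_def)
    hence "R \<le> C" unfolding C_def using \<kappa> by (simp add: pos_le_divide_eq mult.commute)
    thus ?thesis by (simp add: R_def B_def P_def z_def)
  qed
  thus thesis using that[of "max 2 Q0" C] by simp
qed

section \<open>Trilinear counting in a residue class\<close>

text \<open>The projection onto functions of the scale alone; on the side of characters, the
  contribution of the principal character.\<close>

definition scale_mean :: "nat \<Rightarrow> (nat \<times> nat \<Rightarrow> real) \<Rightarrow> nat \<times> nat \<Rightarrow> real" where
  "scale_mean q f = (\<lambda>(j, h). (\<Sum>a\<in>totatives q. f (j, a)) / real (card (totatives q)))"

lemma sum_square_deviation_le:
  fixes f :: "'a \<Rightarrow> real"
  assumes "finite A"
  shows "(\<Sum>a\<in>A. (f a - (\<Sum>a\<in>A. f a) / real (card A))\<^sup>2) \<le> (\<Sum>a\<in>A. (f a)\<^sup>2)"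
proof (cases "A = {}")
  case False
  define n where "n = real (card A)"
  define t where "t = (\<Sum>a\<in>A. f a)"
  have n: "0 < n" using False assms by (simp add: n_def card_gt_0_iff)
  have "(\<Sum>a\<in>A. (f a - t / n)\<^sup>2) = (\<Sum>a\<in>A. (f a)\<^sup>2 - 2 * (t / n) * f a + (t / n)\<^sup>2)"
    by (intro sum.cong refl) (simp add: power2_diff)
  also have "\<dots> = (\<Sum>a\<in>A. (f a)\<^sup>2) - 2 * (t / n) * t + n * (t / n)\<^sup>2"
    by (simp only: sum.distrib sum_subtractf sum_distrib_left[symmetric] sum_constant t_def n_def)
  also have "\<dots> = (\<Sum>a\<in>A. (f a)\<^sup>2) - t\<^sup>2 / n"
    using n by (simp add: power2_eq_square field_simps)
  also have "\<dots> \<le> (\<Sum>a\<in>A. (f a)\<^sup>2)" using n by simp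
  finally show ?thesis by (simp add: t_def n_def)
qed simp

lemma sum_grid: "(\<Sum>y\<in>grid m q. u y) = (\<Sum>i<m. \<Sum>a\<in>totatives q. u (i, a))"
  by (simp add: grid_def sum.cartesian_product)

text \<open>Subtracting the means at each scale leaves a function of mean zero with no larger norm.
  The operator contracts it by \<kappa>, and Cauchy-Schwarz against \<open>f\<close> bounds its
  contribution.\<close>

lemma not_bad_modulus_pairing:
  assumes good: "\<not> bad_modulus P b \<kappa> q" and m: "0 < m" and \<kappa>: "0 \<le> \<kappa>" and q: "1 < q"
    and F: "(\<Sum>x\<in>grid m q. (f x)\<^sup>2) \<le> F\<^sup>2" "0 \<le> F" and H: "(\<Sum>x\<in>grid m q. (h x)\<^sup>2) \<le> H\<^sup>2" "0 \<le> H"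
  shows "(\<Sum>x\<in>grid m q. f x * prime_op P b m q (scale_mean q h) x) - \<kappa> * F * H
           \<le> (\<Sum>x\<in>grid m q. f x * prime_op P b m q h x)"
proof -
  define u where "u = scale_mean q h"
  define v where "v x = h x - u x" for x
  define S where "S = prime_op P b m q"
  have fin: "finite (totatives q)" by simp
  have card: "0 < real (card (totatives q))" using q by (simp add: totient_def[symmetric])
  have "(\<Sum>a\<in>totatives q. v (i, a)) = 0" for i
    using card by (simp add: v_def u_def scale_mean_def sum_subtractf)
  hence "(\<Sum>x\<in>grid m q. (S v x)\<^sup>2) \<le> \<kappa>\<^sup>2 * (\<Sum>x\<in>grid m q. (v x)\<^sup>2)"
    using good m unfolding bad_modulus_def S_def by (meson not_less)
  also have "(\<Sum>x\<in>grid m q. (v x)\<^sup>2) \<le> (\<Sum>x\<in>grid m q. (h x)\<^sup>2)"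
  proof -
    have "(\<Sum>a\<in>totatives q. (v (i, a))\<^sup>2) \<le> (\<Sum>a\<in>totatives q. (h (i, a))\<^sup>2)" for i
      using sum_square_deviation_le[OF fin, of "\<lambda>a. h (i, a)"] by (simp add: v_def u_def scale_mean_def)
    hence "(\<Sum>i<m. \<Sum>a\<in>totatives q. (v (i, a))\<^sup>2) \<le> (\<Sum>i<m. \<Sum>a\<in>totatives q. (h (i, a))\<^sup>2)"
      by (rule sum_mono)
    thus ?thesis by (simp only: sum_grid)
  qed
  also have "\<dots> \<le> H\<^sup>2" by (rule H)
  finally have Sv: "(\<Sum>x\<in>grid m q. (S v x)\<^sup>2) \<le> (\<kappa> * H)\<^sup>2" by (simp add: power_mult_distrib mult_left_mono)
  have "(\<Sum>x\<in>grid m q. f x * S v x)\<^sup>2 \<le> (\<Sum>x\<in>grid m q. (f x)\<^sup>2) * (\<Sum>x\<in>grid m q. (S v x)\<^sup>2)"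
    by (rule Cauchy_Schwarz_ineq_sum)
  also have "\<dots> \<le> F\<^sup>2 * (\<kappa> * H)\<^sup>2" using F Sv by (intro mult_mono sum_nonneg) auto
  finally have "\<bar>\<Sum>x\<in>grid m q. f x * S v x\<bar>\<^sup>2 \<le> (F * (\<kappa> * H))\<^sup>2" by (simp add: power_mult_distrib)
  hence "\<bar>\<Sum>x\<in>grid m q. f x * S v x\<bar> \<le> F * (\<kappa> * H)"
    by (rule power2_le_imp_le) (use F H \<kappa> in simp)
  moreover have "S h x = S u x + S v x" for x
    unfolding S_def prime_op_def v_def sum.distrib[symmetric]
    by (rule sum.cong[OF refl]) (simp add: diff_divide_distrib)
  hence "(\<Sum>x\<in>grid m q. f x * S h x) = (\<Sum>x\<in>grid m q. f x * S u x) + (\<Sum>x\<in>grid m q. f x * S v x)"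
    by (simp add: algebra_simps flip: sum.distrib)
  ultimately show ?thesis unfolding S_def u_def by (simp add: mult_ac)
qed

lemma rough_coprime:
  assumes "rough N r" "0 < n" "real n \<le> N"
  shows "coprime n r"
proof (rule ccontr)
  assume "\<not> coprime n r"
  hence "gcd n r \<noteq> 1" using coprime_iff_gcd_eq_1 by blast
  then obtain l where l: "prime l" "l dvd gcd n r" using prime_factor_nat by blast
  hence "N < real l" "l \<le> n" using assms by (auto simp: rough_def dvd_imp_le)
  thus False using assms(3) by linarith
qed

text \<open>
  Products \<open>n p r\<close> with \<open>n \<le> b\<^sup>i\<close> for some \<open>i \<in> I\<close>, a prime \<open>p \<in> (z, z\<^sup>2]\<close>, and \<open>r\<close> free of prime factors up
  to \<open>N\<close>. The range of \<open>r\<close> is \<open>(x / b\<^sup>j\<^sup>+\<^sup>1, x / b\<^sup>j]\<close> with \<open>j\<close> the sum of the scales of \<open>n\<close> and \<open>p\<close>.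
\<close>

locale trilinear =
  fixes b q a m :: nat and N z x :: real and I :: "nat set"
  assumes b: "2 \<le> b" and q: "prime q" and a: "coprime a q"
    and N: "real q < N" "z\<^sup>2 \<le> N" and z: "1 < z" "z\<^sup>2 < real q" and x: "0 < x"
    and I: "finite I" "\<And>i. i \<in> I \<Longrightarrow> real q \<le> real b ^ i" "\<And>i. i \<in> I \<Longrightarrow> real b ^ i \<le> N"
    and m: "\<And>i p. i \<in> I \<Longrightarrow> p \<in> primes_in z (z\<^sup>2) \<Longrightarrow> i + log_scale b p < m"
begin

text \<open>Smooth only in contrast to \<open>rough_part\<close>: for a scale in \<open>I\<close>
  the members are at most \<open>N\<close>, so their prime factors lie below those of the rough
  factor.\<close>

definition smooth_part :: "int \<Rightarrow> nat \<Rightarrow> nat \<Rightarrow> nat set" where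
  "smooth_part s i g = {n\<in>{1..b ^ i}. [n = g] (mod q) \<and> moebius_mu n = s}"

text \<open>Here \<open>h\<close> is the class of n p, so the congruence places n p r in the class
  of \<open>a\<close>; the range for \<open>r\<close> has ratio \<open>b\<close>, so the ranges for
  different \<open>j\<close> are disjoint.\<close>

definition rough_part :: "int \<Rightarrow> nat \<Rightarrow> nat \<Rightarrow> nat set" where
  "rough_part s j h = {r. x / real b ^ j / real b < real r \<and> real r \<le> x / real b ^ j \<and> rough N r \<and>
      moebius_mu r = s \<and> [r * h = a] (mod q)}"

text \<open>Division by \<open>real b ^ i\<close> turns the count into a density of order at most 1
  / q; \<open>rough_fun\<close> carries the opposite power. Both sizes are thereby comparable across
  the scales.\<close>

definition smooth_fun :: "int \<Rightarrow> nat \<times> nat \<Rightarrow> real" where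
  "smooth_fun s = (\<lambda>(i, g). if i \<in> I then real (card (smooth_part s i g)) / real b ^ i else 0)"

definition rough_fun :: "int \<Rightarrow> nat \<times> nat \<Rightarrow> real" where
  "rough_fun s = (\<lambda>(j, h). real b ^ j * real (card (rough_part s j h)))"

definition triples :: "int \<Rightarrow> int \<Rightarrow> (nat \<times> nat \<times> nat \<times> nat \<times> nat) set" where
  "triples s t = (SIGMA i:I. SIGMA g:totatives q. SIGMA p:primes_in z (z\<^sup>2).
      smooth_part s i g \<times> rough_part t (i + log_scale b p) ((g * p) mod q))"

lemma q1: "1 < q" using q by (rule prime_gt_1_nat)

lemma bpos: "0 < real b" using b by simp

lemma finite_smooth_part [simp]: "finite (smooth_part s i g)"
  by (simp add: smooth_part_def)

lemma finite_le_real: "finite {r::nat. real r \<le> y}"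
  by (rule finite_subset[of _ "{..nat \<lfloor>y\<rfloor>}"]) (auto simp: le_nat_floor)

lemma finite_rough_part [simp]: "finite (rough_part s j h)"
  by (rule finite_subset[OF _ finite_le_real[of "x / real b ^ j"]]) (auto simp: rough_part_def)

lemma I_less_m: "i \<in> I \<Longrightarrow> primes_in z (z\<^sup>2) \<noteq> {} \<Longrightarrow> i < m"
  using m by fastforce

text \<open>All scales that occur stay below \<open>m\<close>, so the cyclic shift does not wrap
  around, and the powers of \<open>b\<close> in the two functions and in the operator cancel
  exactly.\<close>

lemma pairing_eq_card:
  assumes "primes_in z (z\<^sup>2) \<noteq> {}"
  shows "(\<Sum>y\<in>grid m q. smooth_fun s y * prime_op (primes_in z (z\<^sup>2)) b m q (rough_fun t) y) = real (card (triples s t))"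
proof -
  define P where "P = primes_in z (z\<^sup>2)"
  have "(\<Sum>y\<in>grid m q. smooth_fun s y * prime_op P b m q (rough_fun t) y) =
    (\<Sum>i<m. \<Sum>g\<in>totatives q. smooth_fun s (i, g) * prime_op P b m q (rough_fun t) (i, g))"
    by (rule sum_grid)
  also have "\<dots> = (\<Sum>i\<in>I. \<Sum>g\<in>totatives q. smooth_fun s (i, g) * prime_op P b m q (rough_fun t) (i, g))"
    using I_less_m[OF _ assms] by (intro sum.mono_neutral_right) (auto simp: smooth_fun_def)
  also have "\<dots> = (\<Sum>i\<in>I. \<Sum>g\<in>totatives q. \<Sum>p\<in>P. real (card (smooth_part s i g \<times> rough_part t (i + log_scale b p) ((g * p) mod q))))"
  proof (intro sum.cong refl)
    fix i g assume i: "i \<in> I" "g \<in> totatives q"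
    have "prime_op P b m q (rough_fun t) (i, g) = (\<Sum>p\<in>P. real b ^ i * real (card (rough_part t (i + log_scale b p) ((g * p) mod q))))"
      unfolding prime_op_def
    proof (intro sum.cong refl)
      fix p assume "p \<in> P"
      hence "i + log_scale b p < m" using m i by (simp add: P_def)
      thus "1 / real b ^ log_scale b p * rough_fun t (mult_shift m q (log_scale b p) p (i, g)) =
         real b ^ i * real (card (rough_part t (i + log_scale b p) ((g * p) mod q)))"
        using bpos by (simp add: mult_shift_def rough_fun_def power_add)
    qed
    thus "smooth_fun s (i, g) * prime_op P b m q (rough_fun t) (i, g) =
       (\<Sum>p\<in>P. real (card (smooth_part s i g \<times> rough_part t (i + log_scale b p) ((g * p) mod q))))"
      using i bpos by (simp add: smooth_fun_def card_cartesian_product sum_distrib_left)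
  qed
  also have "\<dots> = real (card (triples s t))"
    unfolding triples_def using I(1) by (simp add: P_def card_SigmaI finite_SigmaI)
  finally show ?thesis by (simp only: P_def)
qed

section \<open>Multiplicity of the representations as products\<close>

lemma triplesD:
  assumes "(i, g, p, n, r) \<in> triples s t"
  shows "i \<in> I" "g \<in> totatives q" "prime p" "z < real p" "real p \<le> z\<^sup>2" "0 < n" "real n \<le> N"
    "n \<le> b ^ i" "[n = g] (mod q)" "moebius_mu n = s" "rough N r" "0 < r" "moebius_mu r = t" "[n * p * r = a] (mod q)"
    "x / real b ^ (i + log_scale b p) / real b < real r" "real r \<le> x / real b ^ (i + log_scale b p)"
    "real (n * p * r) \<le> x" "coprime (n * p) r"
proof -
  have h: "i \<in> I" "g \<in> totatives q" "p \<in> primes_in z (z\<^sup>2)" "n \<in> smooth_part s i g"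
    "r \<in> rough_part t (i + log_scale b p) ((g * p) mod q)" using assms by (auto simp: triples_def)
  thus "i \<in> I" "g \<in> totatives q" and p: "prime p" "z < real p" "real p \<le> z\<^sup>2" and n0: "0 < n" "n \<le> b ^ i" and ng: "[n = g] (mod q)"
    and "moebius_mu n = s" and r: "rough N r" "0 < r" and "moebius_mu r = t"
    and "x / real b ^ (i + log_scale b p) / real b < real r" and rle: "real r \<le> x / real b ^ (i + log_scale b p)"
    by (auto simp: primes_in_def smooth_part_def rough_part_def rough_def)
  have "real n \<le> real (b ^ i)" using n0 by (simp only: of_nat_le_iff)
  hence nb: "real n \<le> real b ^ i" by (simp only: of_nat_power)
  thus nN: "real n \<le> N" using I(3)[OF h(1)] by linarith
  have "[r * ((g * p) mod q) = a] (mod q)" using h(5) by (simp add: rough_part_def)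
  hence "[r * (g * p) = a] (mod q)" by (simp add: Cong.cong_def mod_simps)
  moreover have "[n * p * r = g * p * r] (mod q)" using ng by (intro cong_mult cong_refl)
  ultimately show "[n * p * r = a] (mod q)" by (metis cong_trans mult.commute)
  have p1: "1 \<le> p" using p(1) by (rule prime_ge_1_nat)
  have "real (n * p * r) \<le> real b ^ i * real b ^ log_scale b p * (x / real b ^ (i + log_scale b p))"
    unfolding of_nat_mult using rle log_scale_bounds(1)[OF b p1] nb x bpos
    by (intro mult_mono) auto
  also have "\<dots> = x" using bpos by (simp add: power_add)
  finally show "real (n * p * r) \<le> x" .
  have "coprime n r" "coprime p r"
    using rough_coprime[OF r(1)] n0 nN p(3) p1 N(2) by auto
  thus "coprime (n * p) r" by simp
qed

definition value_of :: "nat \<times> nat \<times> nat \<times> nat \<times> nat \<Rightarrow> nat" where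
  "value_of = (\<lambda>(i, g, p, n, r). n * p * r)"

text \<open>For a fixed prime \<open>p\<close> the product determines the rest. Each rough factor is
  coprime to the small factors of the other representation, so \<open>r\<close> and
  \<open>r'\<close> divide each other; then \<open>n\<close> follows, its class gives
  \<open>g\<close>, and the range containing \<open>r\<close> gives \<open>i\<close>.\<close>

lemma triples_eqI:
  assumes "(i, g, p, n, r) \<in> triples s t" "(i', g', p, n', r') \<in> triples s t" "n * p * r = n' * p * r'"
  shows "(i, g, p, n, r) = (i', g', p, n', r')"
proof -
  note T = triplesD[OF assms(1)] and T' = triplesD[OF assms(2)]
  have p0: "0 < p" using T(3) by (rule prime_gt_0_nat)
  have pN: "real p \<le> N" using T(5) N(2) by linarith
  have c: "coprime r (n' * p)" "coprime r' (n * p)"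
    using rough_coprime[OF T(11)] rough_coprime[OF T'(11)] T(6,7) T'(6,7) p0 pN
    by (simp_all add: coprime_commute)
  have "r dvd n' * p * r'" "r' dvd n * p * r" using assms(3) by (metis dvd_triv_right)+
  hence "r dvd r'" "r' dvd r" using c by (simp_all only: coprime_dvd_mult_right_iff)
  hence r: "r = r'" by (rule dvd_antisym)
  hence n: "n = n'" using assms(3) p0 T(12) by simp
  have "[g = g'] (mod q)" using T(9) T'(9) n by (metis cong_sym cong_trans)
  moreover have "g < q" "g' < q" using T(2) T'(2) q1 by (auto intro: totatives_less)
  ultimately have g: "g = g'" by (simp add: Cong.cong_def)
  \<comment> \<open>The half-open ranges (x / b^(j+1), x / b^j] are disjoint for distinct
    exponents.\<close>
  have le: "j \<le> k" if "x / real b ^ (k + s) / real b < real r" "real r \<le> x / real b ^ (j + s)" for j k s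
  proof (rule ccontr)
    assume "\<not> j \<le> k"
    hence "Suc (k + s) \<le> j + s" by simp
    hence "real b ^ Suc (k + s) \<le> real b ^ (j + s)" using b by (intro power_increasing) auto
    hence "x / real b ^ (j + s) \<le> x / real b ^ Suc (k + s)" using x bpos by (intro divide_left_mono) auto
    also have "\<dots> = x / real b ^ (k + s) / real b" by (simp add: mult.commute)
    finally show False using that by linarith
  qed
  have "i = i'" using le[OF T(15)] le[of i' "log_scale b p" i] T(15,16) T'(15,16) r by (intro antisym) auto
  thus ?thesis using r n g by simp
qed

definition good_values :: "int \<Rightarrow> nat set" where
  "good_values s = {n. n > 0 \<and> real n \<le> x \<and> [n = a] (mod q) \<and> moebius_mu n = s}"

definition bad_values :: "nat set" where
  "bad_values = {n. n > 0 \<and> real n \<le> x \<and> [n = a] (mod q) \<and> (\<exists>p\<in>primes_in z (z\<^sup>2). p\<^sup>2 dvd n)}"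

lemma finite_values [simp]: "finite (good_values s)" "finite bad_values"
  by (auto simp: good_values_def bad_values_def intro: finite_subset[OF _ finite_le_real[of x]])

text \<open>The prime contributes the minus sign. If \<open>p\<close> divides \<open>n\<close>, the
  Moebius value is lost, but the product is then divisible by p^2 and falls under
  \<open>bad_values\<close>.\<close>

lemma value_of_triples:
  assumes "\<tau> \<in> triples s t"
  shows "value_of \<tau> \<in> good_values (- (s * t)) \<union> bad_values"
proof -
  obtain i g p n r where \<tau>: "\<tau> = (i, g, p, n, r)" by (cases \<tau>)
  note T = triplesD[OF assms[unfolded \<tau>]]
  have p0: "0 < p" using T(3) by (rule prime_gt_0_nat)
  have pos: "0 < n * p * r" using T(6,12) p0 by simp
  show ?thesis
  proof (cases "p dvd n")
    case True
    hence "p\<^sup>2 dvd n * p * r" by (simp add: power2_eq_square mult_dvd_mono)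
    moreover have "p \<in> primes_in z (z\<^sup>2)" using T by (simp add: primes_in_def)
    ultimately show ?thesis using T pos by (auto simp: \<tau> value_of_def bad_values_def)
  next
    case False
    hence "coprime n p" using prime_imp_coprime[OF T(3)] by (simp add: coprime_commute)
    hence "moebius_mu (n * p * r) = - (s * t)"
      using T(3,10,13,18) by (simp add: moebius_mu_mult moebius_mu_prime)
    thus ?thesis using T pos by (auto simp: \<tau> value_of_def good_values_def)
  qed
qed

text \<open>A representation is determined by its prime, which must divide the small factor n0 p0 of
  any one fixed representation. That factor is at most N z^2, too small for more than
  \<open>K\<close> prime factors above \<open>z\<close>.\<close>

lemma card_fibre_le:
  assumes K: "N * z\<^sup>2 < z ^ Suc K"
  shows "card {\<tau>\<in>triples s t. value_of \<tau> = v} \<le> K"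
proof (cases "{\<tau>\<in>triples s t. value_of \<tau> = v} = {}")
  case False
  then obtain i0 g0 p0 n0 r0 where t0: "(i0, g0, p0, n0, r0) \<in> triples s t" "n0 * p0 * r0 = v"
    by (auto simp: value_of_def)
  note T0 = triplesD[OF t0(1)]
  have p00: "0 < p0" using T0(3) by (rule prime_gt_0_nat)
  define P where "P = {p \<in> prime_factors (n0 * p0). z < real p}"
  have "card {\<tau>\<in>triples s t. value_of \<tau> = v} \<le> card P"
  proof (rule card_inj_on_le)
    show "inj_on (\<lambda>(i, g, p, n, r). p) {\<tau>\<in>triples s t. value_of \<tau> = v}"
    proof (rule inj_onI)
      fix u w
      assume uw: "u \<in> {\<tau>\<in>triples s t. value_of \<tau> = v}" "w \<in> {\<tau>\<in>triples s t. value_of \<tau> = v}"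
        "(\<lambda>(i, g, p, n, r). p) u = (\<lambda>(i, g, p, n, r). p) w"
      obtain i g p n r where u: "u = (i, g, p, n, r)" by (cases u)
      obtain i' g' n' r' where w: "w = (i', g', p, n', r')" using uw(3) by (cases w) (auto simp: u)
      show "u = w" unfolding u w
        using uw by (intro triples_eqI[where s = s and t = t]) (simp_all add: u w value_of_def)
    qed
    show "(\<lambda>(i, g, p, n, r). p) ` {\<tau>\<in>triples s t. value_of \<tau> = v} \<subseteq> P"
    proof (clarify)
      fix i g p n r assume t1: "(i, g, p, n, r) \<in> triples s t" and v: "v = value_of (i, g, p, n, r)"
      note T = triplesD[OF t1]
      have "real p \<le> N" using T(5) N(2) by linarith
      hence "coprime p r0" using prime_gt_0_nat[OF T(3)] by (intro rough_coprime[OF T0(11)])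
      moreover have "p dvd n0 * p0 * r0" using v t0(2) by (simp add: value_of_def)
      ultimately have "p dvd n0 * p0" by (simp add: coprime_dvd_mult_left_iff)
      thus "p \<in> P" using T T0(6) p00 by (auto simp: P_def in_prime_factors_iff)
    qed
    show "finite P" by (simp add: P_def)
  qed
  also have "card P \<le> K"
  proof (rule ccontr)
    assume "\<not> card P \<le> K"
    hence "z ^ Suc K \<le> z ^ card P" using z(1) by (intro power_increasing) auto
    also have "\<dots> = (\<Prod>p\<in>P. z)" by simp
    also have "\<dots> \<le> (\<Prod>p\<in>P. real p)" using z(1) by (intro prod_mono) (auto simp: P_def)
    also have "\<dots> = real (\<Prod>P)" by simp
    also have "\<dots> \<le> real (n0 * p0)"
    proof -
      have "\<Prod>P dvd \<Prod>(prime_factors (n0 * p0))" by (intro prod_dvd_prod_subset) (auto simp: P_def)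
      also have "\<dots> dvd (\<Prod>p\<in>prime_factors (n0 * p0). p ^ multiplicity p (n0 * p0))"
        by (intro prod_dvd_prod) (auto simp: prime_factors_multiplicity intro: dvd_power)
      also have "\<dots> = n0 * p0" using T0(6) p00 by (intro prime_factorization_nat[symmetric]) simp
      finally show ?thesis using T0(6) p00 by (simp only: of_nat_le_iff) (intro dvd_imp_le, auto)
    qed
    also have "\<dots> \<le> N * z\<^sup>2" unfolding of_nat_mult using T0(5,7) by (intro mult_mono) auto
    finally show False using K by linarith
  qed
  finally show ?thesis .
next
  case True
  show ?thesis unfolding True by simp
qed

lemma finite_triples: "finite (triples s t)"
  unfolding triples_def using I(1) by (intro finite_SigmaI) auto

lemma card_triples_le:
  assumes K: "N * z\<^sup>2 < z ^ Suc K"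
  shows "card (triples s t) \<le> K * (card (good_values (- (s * t))) + card bad_values)"
proof -
  define V where "V = good_values (- (s * t)) \<union> bad_values"
  have "real (card (triples s t)) = (\<Sum>\<tau>\<in>triples s t. (\<lambda>_. 1) (value_of \<tau>))" by simp
  also have "\<dots> \<le> real K * (\<Sum>v\<in>V. 1)"
  proof (rule sum_over_fibres_le)
    show "value_of ` triples s t \<subseteq> V" unfolding V_def by (intro image_subsetI value_of_triples)
    show "card {\<tau>\<in>triples s t. value_of \<tau> = v} \<le> K" for v using K by (rule card_fibre_le)
  qed (simp_all add: finite_triples V_def)
  finally have "real (card (triples s t)) \<le> real (K * card V)" by simp
  hence "card (triples s t) \<le> K * card V" by (simp only: of_nat_le_iff)
  also have "\<dots> \<le> K * (card (good_values (- (s * t))) + card bad_values)"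
    unfolding V_def by (intro mult_left_mono card_Un_le) auto
  finally show ?thesis .
qed

text \<open>For each prime the count is x / (q p^2) up to an error of 1. The tail of the inverse
  squares beyond \<open>z\<close> gives the first term and the number of primes the second.\<close>

lemma card_bad_values_le: "real (card bad_values) \<le> 2 * x / (real q * z) + z\<^sup>2"
proof -
  define P where "P = primes_in z (z\<^sup>2)"
  define Y where "Y = nat \<lfloor>x\<rfloor>"
  have Y: "real Y \<le> x" using x by (simp add: Y_def)
  define U where "U p = {n\<in>{1..Y}. p\<^sup>2 dvd n \<and> [n = a] (mod q)}" for p :: nat
  define k where "k = nat \<lfloor>z\<rfloor>"
  define l where "l = nat \<lfloor>z\<^sup>2\<rfloor>"
  have k: "0 < k" "z \<le> 2 * real k" "real k \<le> z" 
  proof -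
    show "0 < k" using z(1) by (simp add: k_def)
    hence "1 \<le> real k" by simp
    moreover have "z < real k + 1" using z(1) by (simp add: k_def)
    ultimately show "z \<le> 2 * real k" by linarith
    show "real k \<le> z" using z(1) by (simp add: k_def)
  qed
  have Pk: "P \<subseteq> {k<..l}" using k(3) by (auto simp: P_def primes_in_def l_def le_nat_floor)
  have "bad_values \<subseteq> (\<Union>p\<in>P. U p)"
    by (auto simp: bad_values_def U_def P_def Y_def le_nat_floor Suc_le_eq)
  hence "card bad_values \<le> card (\<Union>p\<in>P. U p)"
    by (intro card_mono) (auto simp: P_def U_def)
  also have "\<dots> \<le> (\<Sum>p\<in>P. card (U p))" by (rule card_UN_le) (simp add: P_def)
  finally have "real (card bad_values) \<le> (\<Sum>p\<in>P. real (card (U p)))" by (simp flip: of_nat_sum)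
  also have "\<dots> \<le> (\<Sum>p\<in>P. x / real q * (1 / real p ^ 2) + 1)"
  proof (rule sum_mono)
    fix p assume "p \<in> P"
    hence p: "prime p" "real p < real q" using z by (auto simp: P_def primes_in_def)
    hence "coprime (p\<^sup>2) q" using q by (simp add: primes_coprime)
    hence "\<bar>real (card (U p)) - real Y / (real q * real (p\<^sup>2))\<bar> \<le> 1"
      unfolding U_def using p q1 prime_gt_0_nat[OF p(1)] by (intro card_residue_class_multiples) auto
    hence "real (card (U p)) \<le> real Y / (real q * real (p\<^sup>2)) + 1" by linarith
    also have "real Y / (real q * real (p\<^sup>2)) \<le> x / (real q * real (p\<^sup>2))" using Y by (intro divide_right_mono) auto
    also have "\<dots> = x / real q * (1 / real p ^ 2)" by simp
    finally show "real (card (U p)) \<le> x / real q * (1 / real p ^ 2) + 1" by simp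
  qed
  also have "\<dots> = x / real q * (\<Sum>p\<in>P. 1 / real p ^ 2) + real (card P)"
    by (simp add: sum.distrib sum_distrib_left)
  also have "\<dots> \<le> x / real q * (2 / z) + z\<^sup>2"
  proof (intro add_mono mult_left_mono)
    have "(\<Sum>p\<in>P. 1 / real p ^ 2) \<le> (\<Sum>p\<in>{k<..l}. 1 / real p ^ 2)"
      using Pk by (intro sum_mono2) auto
    also have "\<dots> \<le> 1 / real k" using k by (intro sum_inverse_squares_le)
    also have "\<dots> = 2 / (2 * real k)" by simp
    also have "\<dots> \<le> 2 / z" using k z(1) by (intro divide_left_mono) auto
    finally show "(\<Sum>p\<in>P. 1 / real p ^ 2) \<le> 2 / z" .
    have "card P \<le> card {k<..l}" using Pk by (intro card_mono) auto
    hence "real (card P) \<le> real l" by simp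
    thus "real (card P) \<le> z\<^sup>2" by (simp add: l_def) linarith
  qed (use x in auto)
  finally show ?thesis by (simp add: mult.commute)
qed

section \<open>Norms of the two functions and the main term\<close>

lemma smooth_fun_norm: "(\<Sum>y\<in>grid m q. (smooth_fun s y)\<^sup>2) \<le> 4 * real (card I) / real q"
proof -
  have "(\<Sum>y\<in>grid m q. (smooth_fun s y)\<^sup>2) = (\<Sum>i<m. \<Sum>g\<in>totatives q. (smooth_fun s (i, g))\<^sup>2)"
    by (rule sum_grid)
  also have "\<dots> \<le> (\<Sum>i<m. if i \<in> I then 4 / real q else 0)"
  proof (rule sum_mono)
    fix i assume "i \<in> {..<m}"
    show "(\<Sum>g\<in>totatives q. (smooth_fun s (i, g))\<^sup>2) \<le> (if i \<in> I then 4 / real q else 0)"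
    proof (cases "i \<in> I")
      case True
      have "smooth_fun s (i, g) \<le> 2 / real q" for g
      proof -
        have "card (smooth_part s i g) \<le> card {n\<in>{1..b ^ i}. [n = g] (mod q)}"
          unfolding smooth_part_def by (intro card_mono) auto
        moreover have "real (card {n\<in>{1..b ^ i}. [n = g] (mod q)}) \<le> real (b ^ i) / real q + 1"
          using card_residue_class[of q "b ^ i" g] q1 by linarith
        \<comment> \<open>The range of \<open>n\<close> is at least as long as \<open>q\<close>, so
          the rounding error is no larger than the expected count; hence the factor 2.\<close>
        moreover have "1 \<le> real (b ^ i) / real q" using I(2)[OF True] q1 by simp
        ultimately have "real (card (smooth_part s i g)) \<le> 2 / real q * real b ^ i" by simp
        thus ?thesis using True bpos by (simp add: smooth_fun_def pos_divide_le_eq)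
      qed
      moreover have "0 \<le> smooth_fun s (i, g)" for g by (simp add: smooth_fun_def)
      ultimately have "(\<Sum>g\<in>totatives q. (smooth_fun s (i, g))\<^sup>2) \<le> of_nat (card (totatives q)) * (2 / real q)\<^sup>2"
        by (intro sum_bounded_above power_mono)
      also have "\<dots> \<le> real q * (2 / real q)\<^sup>2"
        using totient_le[of q] by (intro mult_right_mono) (auto simp: totient_def)
      also have "\<dots> = 4 / real q" using q1 by (simp add: power2_eq_square)
      finally show ?thesis using True by simp
    qed (simp add: smooth_fun_def)
  qed
  also have "\<dots> = (\<Sum>i\<in>{..<m} \<inter> I. 4 / real q)" by (rule sum.inter_restrict[symmetric]) simp
  also have "\<dots> \<le> (\<Sum>i\<in>I. 4 / real q)" using I(1) by (intro sum_mono2) auto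
  finally show ?thesis by (simp add: mult.commute)
qed

lemma rough_fun_norm:
  assumes M: "\<And>j h. j < m \<Longrightarrow> h \<in> totatives q \<Longrightarrow> rough_fun s (j, h) \<le> M"
  shows "(\<Sum>y\<in>grid m q. (rough_fun s y)\<^sup>2) \<le> real m * real q * M\<^sup>2"
proof -
  have "(\<Sum>y\<in>grid m q. (rough_fun s y)\<^sup>2) \<le> of_nat (card (grid m q)) * M\<^sup>2"
    using M by (intro sum_bounded_above power_mono) (auto simp: grid_def rough_fun_def)
  also have "card (grid m q) \<le> m * q"
    using totient_le[of q] by (simp add: grid_def card_cartesian_product totient_def)
  hence "of_nat (card (grid m q)) * M\<^sup>2 \<le> real (m * q) * M\<^sup>2" by (intro mult_right_mono) (simp_all only: of_nat_le_iff zero_le_power2)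
  finally show ?thesis by simp
qed

lemma sum_smooth_fun_ge:
  assumes "36 \<le> q" "s = 1 \<or> s = -1" "i \<in> I"
  shows "1 / 108 \<le> (\<Sum>g\<in>totatives q. smooth_fun s (i, g))"
proof -
  define A where "A = {n\<in>{1..b ^ i}. moebius_mu n = s \<and> \<not> q dvd n}"
  have "2 \<le> real b ^ i" using I(2)[OF assms(3)] assms(1) by linarith
  hence "2 \<le> b ^ i" by (metis of_nat_le_iff of_nat_numeral of_nat_power)
  hence "real (b ^ i) / 108 \<le> real (card A)"
    unfolding A_def using q assms by (intro card_moebius_mu_eq_ge) auto
  also have "A \<subseteq> (\<Union>g\<in>totatives q. smooth_part s i g)"
  proof
    fix n assume n: "n \<in> A"
    hence "coprime q n" using prime_imp_coprime[OF q] by (simp add: A_def)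
    hence "coprime (n mod q) q" using q1 by (simp add: coprime_mod_left_iff coprime_commute)
    moreover have "n mod q \<noteq> 0" using n by (simp add: A_def mod_greater_zero_iff_not_dvd)
    ultimately have "n mod q \<in> totatives q" using q1 by (simp add: totatives_def less_imp_le)
    moreover have "n \<in> smooth_part s i (n mod q)" using n by (auto simp: smooth_part_def A_def Cong.cong_def)
    ultimately show "n \<in> (\<Union>g\<in>totatives q. smooth_part s i g)" by blast
  qed
  hence "card A \<le> card (\<Union>g\<in>totatives q. smooth_part s i g)" by (intro card_mono) auto
  also have "\<dots> \<le> (\<Sum>g\<in>totatives q. card (smooth_part s i g))" by (rule card_UN_le) simp
  finally have "real (b ^ i) / 108 \<le> (\<Sum>g\<in>totatives q. real (card (smooth_part s i g)))"
    by (simp flip: of_nat_sum)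
  hence "real (b ^ i) / 108 / real b ^ i \<le> (\<Sum>g\<in>totatives q. real (card (smooth_part s i g))) / real b ^ i"
    using bpos by (intro divide_right_mono) auto
  thus ?thesis using assms(3) bpos by (simp add: smooth_fun_def sum_divide_distrib)
qed

text \<open>Every rough squarefree \<open>r\<close> is coprime to \<open>q\<close>, so r h = a has a
  solution h among the classes. Only the two signs of the Moebius function together are bounded
  below, since the sign of \<open>r\<close> is out of reach of the sieve.\<close>

lemma sum_rough_fun_ge:
  assumes "c \<le> real (card {r. x / real b ^ j / real b < real r \<and> real r \<le> x / real b ^ j \<and> rough N r \<and> squarefree r})"
  shows "real b ^ j * c \<le> (\<Sum>h\<in>totatives q. rough_fun 1 (j, h)) + (\<Sum>h\<in>totatives q. rough_fun (-1) (j, h))"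
proof -
  define A where "A = {r. x / real b ^ j / real b < real r \<and> real r \<le> x / real b ^ j \<and> rough N r \<and> squarefree r}"
  define U where "U h = rough_part 1 j h \<union> rough_part (-1) j h" for h
  have "A \<subseteq> (\<Union>h\<in>totatives q. U h)"
  proof
    fix r assume r: "r \<in> A"
    hence "coprime q r" using q1 N(1) by (intro rough_coprime[where N = N]) (auto simp: A_def)
    hence "bij_betw (\<lambda>h. (h * r) mod q) (totatives q) (totatives q)"
      using q1 by (intro totatives_mult_bij) (simp_all add: coprime_commute)
    hence img: "(\<lambda>h. (h * r) mod q) ` totatives q = totatives q" by (rule bij_betw_imp_surj_on)
    have "a mod q \<in> totatives q"
    proof -
      have "coprime (a mod q) q" using a q1 by (simp add: coprime_mod_left_iff)
      moreover from this have "a mod q \<noteq> 0" using q1 by (metis coprime_0_left_iff nat_dvd_1_iff_1 nat_neq_iff)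
      ultimately show ?thesis using q1 by (simp add: totatives_def less_imp_le)
    qed
    hence "a mod q \<in> (\<lambda>h. (h * r) mod q) ` totatives q" unfolding img .
    then obtain h where h: "a mod q = (h * r) mod q" "h \<in> totatives q" by (rule imageE)
    moreover have "moebius_mu r = 1 \<or> moebius_mu r = -1" using r by (intro moebius_mu_cases) (simp add: A_def)
    ultimately show "r \<in> (\<Union>h\<in>totatives q. U h)"
      using r by (auto simp: U_def rough_part_def A_def Cong.cong_def mult.commute)
  qed
  hence "card A \<le> card (\<Union>h\<in>totatives q. U h)" by (intro card_mono) (auto simp: U_def)
  also have "\<dots> \<le> (\<Sum>h\<in>totatives q. card (U h))" by (rule card_UN_le) simp
  also have "\<dots> \<le> (\<Sum>h\<in>totatives q. card (rough_part 1 j h) + card (rough_part (-1) j h))"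
    unfolding U_def by (intro sum_mono card_Un_le)
  finally have "real (card A) \<le> (\<Sum>h\<in>totatives q. real (card (rough_part 1 j h)) + real (card (rough_part (-1) j h)))"
    by (simp flip: of_nat_sum of_nat_add)
  hence "c \<le> (\<Sum>h\<in>totatives q. real (card (rough_part 1 j h))) + (\<Sum>h\<in>totatives q. real (card (rough_part (-1) j h)))"
    using assms unfolding A_def[symmetric] sum.distrib by linarith
  hence "real b ^ j * c \<le> real b ^ j * ((\<Sum>h\<in>totatives q. real (card (rough_part 1 j h))) + (\<Sum>h\<in>totatives q. real (card (rough_part (-1) j h))))"
    using bpos by (intro mult_left_mono) auto
  thus ?thesis by (simp add: rough_fun_def sum_distrib_left distrib_left)
qed

text \<open>A nonempty \<open>rough_part\<close> forces \<open>h\<close> to be invertible, so all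
  its members lie in the residue class of any one of them, where Selberg's sieve of level
  \<open>D\<close> applies.\<close>

lemma rough_fun_le:
  assumes D: "1 \<le> D" "real D \<le> N" "D < q"
  shows "rough_fun s (j, h) \<le> x / (real q * selberg_G D) + real b ^ j * real D ^ 4"
proof (cases "rough_part s j h = {}")
  case True
  thus ?thesis using x selberg_G_pos[OF D(1)] by (simp add: rough_fun_def)
next
  case False
  then obtain r0 where r0: "r0 \<in> rough_part s j h" by blast
  have D0: "coprime d q" if "d \<in> {1..D}" for d
  proof -
    have "\<not> q dvd d" using that D(3) by (auto dest: dvd_imp_le)
    thus ?thesis using prime_imp_coprime[OF q] by (simp add: coprime_commute)
  qed
  define Y where "Y = nat \<lfloor>x / real b ^ j\<rfloor>"
  have Y: "real Y \<le> x / real b ^ j" using x bpos by (simp add: Y_def)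
  have "[r0 * h = a] (mod q)" using r0 by (simp add: rough_part_def)
  hence "coprime (r0 * h) q" using a cong_imp_coprime cong_sym by blast
  hence ch: "coprime h q" by simp
  have "rough_part s j h \<subseteq> {r\<in>{1..Y}. [r = r0] (mod q) \<and> rough (real D) r}"
  proof
    fix r assume r: "r \<in> rough_part s j h"
    hence "[r * h = r0 * h] (mod q)" using r0 by (auto simp: rough_part_def intro: cong_trans cong_sym)
    hence "[r = r0] (mod q)" using ch cong_mult_rcancel_nat by blast
    moreover have "rough (real D) r" using r D(2) by (auto simp: rough_part_def rough_def intro: le_less_trans)
    ultimately show "r \<in> {r\<in>{1..Y}. [r = r0] (mod q) \<and> rough (real D) r}"
      using r by (auto simp: rough_part_def Y_def le_nat_floor rough_def)
  qed
  hence "card (rough_part s j h) \<le> card {r\<in>{1..Y}. [r = r0] (mod q) \<and> rough (real D) r}" by (intro card_mono) auto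
  hence "real (card (rough_part s j h)) \<le> real Y / (real q * selberg_G D) + real D ^ 4"
    using card_rough_residue_class_le[OF D(1), of q Y r0] D0 q1 by fastforce
  also have "\<dots> \<le> x / real b ^ j / (real q * selberg_G D) + real D ^ 4"
    using Y selberg_G_pos[OF D(1)] by (intro add_right_mono divide_right_mono) auto
  finally have "real b ^ j * real (card (rough_part s j h)) \<le> real b ^ j * (x / real b ^ j / (real q * selberg_G D) + real D ^ 4)"
    using bpos by (intro mult_left_mono) auto
  also have "\<dots> = x / (real q * selberg_G D) + real b ^ j * real D ^ 4"
    using bpos by (simp add: distrib_left)
  finally show ?thesis by (simp add: rough_fun_def)
qed

text \<open>The means do not depend on the residue class, so the sum over the classes factors
  out.\<close>

lemma main_term_eq:
  assumes "primes_in z (z\<^sup>2) \<noteq> {}"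
  shows "(\<Sum>y\<in>grid m q. smooth_fun s y * prime_op (primes_in z (z\<^sup>2)) b m q (scale_mean q (rough_fun t)) y) =
    (\<Sum>i\<in>I. \<Sum>p\<in>primes_in z (z\<^sup>2). (\<Sum>g\<in>totatives q. smooth_fun s (i, g)) * (1 / real b ^ log_scale b p *
        ((\<Sum>h\<in>totatives q. rough_fun t (i + log_scale b p, h)) / real (card (totatives q)))))"
proof -
  define P where "P = primes_in z (z\<^sup>2)"
  define S where "S = prime_op P b m q (scale_mean q (rough_fun t))"
  have "(\<Sum>y\<in>grid m q. smooth_fun s y * S y) = (\<Sum>i<m. \<Sum>g\<in>totatives q. smooth_fun s (i, g) * S (i, g))"
    by (rule sum_grid)
  also have "\<dots> = (\<Sum>i\<in>I. \<Sum>g\<in>totatives q. smooth_fun s (i, g) * S (i, g))"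
    using I_less_m[OF _ assms] by (intro sum.mono_neutral_right) (auto simp: smooth_fun_def)
  also have "\<dots> = (\<Sum>i\<in>I. \<Sum>p\<in>P. (\<Sum>g\<in>totatives q. smooth_fun s (i, g)) * (1 / real b ^ log_scale b p *
        ((\<Sum>h\<in>totatives q. rough_fun t (i + log_scale b p, h)) / real (card (totatives q)))))"
  proof (rule sum.cong[OF refl])
    fix i assume i: "i \<in> I"
    have "S (i, g) = (\<Sum>p\<in>P. 1 / real b ^ log_scale b p * ((\<Sum>h\<in>totatives q. rough_fun t (i + log_scale b p, h)) / real (card (totatives q))))" for g
      unfolding S_def prime_op_def using m i
      by (intro sum.cong refl) (simp add: mult_shift_def scale_mean_def P_def)
    hence "(\<Sum>g\<in>totatives q. smooth_fun s (i, g) * S (i, g)) = (\<Sum>g\<in>totatives q. smooth_fun s (i, g)) *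
        (\<Sum>p\<in>P. 1 / real b ^ log_scale b p * ((\<Sum>h\<in>totatives q. rough_fun t (i + log_scale b p, h)) / real (card (totatives q))))"
      by (simp only: sum_distrib_right)
    also have "\<dots> = (\<Sum>p\<in>P. (\<Sum>g\<in>totatives q. smooth_fun s (i, g)) * (1 / real b ^ log_scale b p *
        ((\<Sum>h\<in>totatives q. rough_fun t (i + log_scale b p, h)) / real (card (totatives q)))))"
      by (rule sum_distrib_left)
    finally show "(\<Sum>g\<in>totatives q. smooth_fun s (i, g) * S (i, g)) = \<dots>" .
  qed
  finally show ?thesis by (simp only: S_def P_def)
qed

text \<open>The pairs of signs (s, 1) and (-s, -1) for n and r lead to the same sign of \<mu>(n p
  r). The factors from \<open>n\<close> are at least 1 / 108 for either sign, so the bound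
  \<open>E\<close> for both signs of \<open>r\<close> together is enough.\<close>

lemma main_term_ge:
  assumes "primes_in z (z\<^sup>2) \<noteq> {}" "36 \<le> q" "s = 1 \<or> s = -1" "0 \<le> E"
    and E: "\<And>j. j < m \<Longrightarrow> E \<le> (\<Sum>h\<in>totatives q. rough_fun 1 (j, h)) + (\<Sum>h\<in>totatives q. rough_fun (-1) (j, h))"
  defines "T \<equiv> \<lambda>s t. (\<Sum>y\<in>grid m q. smooth_fun s y * prime_op (primes_in z (z\<^sup>2)) b m q (scale_mean q (rough_fun t)) y)"
  shows "real (card I) * (1 / 108 * ((\<Sum>p\<in>primes_in z (z\<^sup>2). 1 / real b ^ log_scale b p) * (E / real q))) \<le> T s 1 + T (- s) (-1)"
proof -
  define P where "P = primes_in z (z\<^sup>2)"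
  define F where "F s i = (\<Sum>g\<in>totatives q. smooth_fun s (i, g))" for s i
  define H where "H t j = (\<Sum>h\<in>totatives q. rough_fun t (j, h)) / real (card (totatives q))" for t j
  have tot: "0 < card (totatives q)" "card (totatives q) \<le> q" using q1 totient_le[of q] by (simp_all add: totient_def[symmetric])
  have H0: "0 \<le> H t j" for t j unfolding H_def rough_fun_def by (intro divide_nonneg_nonneg sum_nonneg) auto
  have H: "E / real q \<le> H 1 j + H (-1) j" if "j < m" for j
  proof -
    have "E / real q \<le> E / real (card (totatives q))" using tot assms(4) by (intro divide_left_mono) auto
    also have "\<dots> \<le> H 1 j + H (-1) j" unfolding H_def add_divide_distrib[symmetric]
      using E[OF that] by (intro divide_right_mono) auto
    finally show ?thesis .
  qed
  have F: "1 / 108 \<le> F s i" "1 / 108 \<le> F (- s) i" if "i \<in> I" for i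
    unfolding F_def by (rule sum_smooth_fun_ge; use assms(2,3) that in auto)+
  have "real (card I) * (1 / 108 * ((\<Sum>p\<in>P. 1 / real b ^ log_scale b p) * (E / real q))) =
    (\<Sum>i\<in>I. \<Sum>p\<in>P. 1 / 108 * (1 / real b ^ log_scale b p * (E / real q)))"
    by (simp only: sum_distrib_left[symmetric] sum_distrib_right[symmetric] sum_constant mult_ac)
  also have "\<dots> \<le> (\<Sum>i\<in>I. \<Sum>p\<in>P. F s i * (1 / real b ^ log_scale b p * H 1 (i + log_scale b p)) + F (- s) i * (1 / real b ^ log_scale b p * H (-1) (i + log_scale b p)))"
  proof (intro sum_mono)
    fix i p assume ip: "i \<in> I" "p \<in> P"
    define w where "w = 1 / real b ^ log_scale b p"
    define j where "j = i + log_scale b p"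
    have w: "0 \<le> w" using bpos by (simp add: w_def)
    have "w * (E / real q) \<le> w * (H 1 j + H (-1) j)"
      using w m ip by (intro mult_left_mono H) (auto simp: P_def j_def)
    hence "1 / 108 * (w * (E / real q)) \<le> 1 / 108 * (w * (H 1 j + H (-1) j))" by (rule mult_left_mono) simp
    also have "\<dots> = 1 / 108 * (w * H 1 j) + 1 / 108 * (w * H (-1) j)" by (simp add: algebra_simps)
    also have "\<dots> \<le> F s i * (w * H 1 j) + F (- s) i * (w * H (-1) j)"
      using F[OF ip(1)] w H0 by (intro add_mono mult_right_mono) auto
    finally show "1 / 108 * (1 / real b ^ log_scale b p * (E / real q)) \<le> 
       F s i * (1 / real b ^ log_scale b p * H 1 (i + log_scale b p)) + F (- s) i * (1 / real b ^ log_scale b p * H (-1) (i + log_scale b p))"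
      by (simp only: w_def j_def)
  qed
  also have "\<dots> = T s 1 + T (- s) (-1)"
    unfolding T_def main_term_eq[OF assms(1)] by (simp only: sum.distrib P_def F_def H_def)
  finally show ?thesis by (simp only: P_def)
qed

end

section \<open>Good moduli\<close>

lemma card_scales_ge:
  fixes b :: nat and u v :: real
  assumes "2 \<le> b" "0 \<le> u"
  shows "(v - u) / ln (real b) - 1 \<le> real (card {i. exp u \<le> real b ^ i \<and> real b ^ i \<le> exp v})"
proof (cases "u \<le> v")
  case True
  define l where "l = ln (real b)"
  have l: "0 < l" using assms by (simp add: l_def)
  define I where "I = {i. exp u \<le> real b ^ i \<and> real b ^ i \<le> exp v}"
  have pw: "real b ^ i = exp (real i * l)" for i
    using assms by (simp add: l_def exp_of_nat_mult)
  have I: "I = {i. u / l \<le> real i \<and> real i \<le> v / l}"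
    using l by (auto simp: I_def pw pos_divide_le_eq pos_le_divide_eq)
  have "{nat \<lceil>u / l\<rceil>..nat \<lfloor>v / l\<rfloor>} \<subseteq> I"
  proof
    fix i assume i: "i \<in> {nat \<lceil>u / l\<rceil>..nat \<lfloor>v / l\<rfloor>}"
    have "0 \<le> v / l" using l assms True by simp
    hence "real i \<le> v / l" using i by (simp add: le_nat_iff le_floor_iff)
    moreover have "u / l \<le> real i" using i by (simp add: nat_le_iff ceiling_le_iff)
    ultimately show "i \<in> I" by (simp add: I)
  qed
  moreover have "finite I"
    by (rule finite_subset[of _ "{..nat \<lfloor>v / l\<rfloor>}"]) (auto simp: I le_nat_floor)
  ultimately have "card {nat \<lceil>u / l\<rceil>..nat \<lfloor>v / l\<rfloor>} \<le> card I" by (rule card_mono[rotated])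
  moreover have "v / l - u / l - 1 \<le> real (card {nat \<lceil>u / l\<rceil>..nat \<lfloor>v / l\<rfloor>})"
  proof -
    have "0 \<le> u / l" "0 \<le> v / l" using l assms True by simp_all
    hence "real (nat \<lceil>u / l\<rceil>) < u / l + 1" "v / l - 1 < real (nat \<lfloor>v / l\<rfloor>)" by linarith+
    thus ?thesis by (simp add: of_nat_diff)
  qed
  ultimately show ?thesis unfolding I_def l_def by (simp add: diff_divide_distrib)
next
  case False
  hence "(v - u) / ln (real b) \<le> 0" using assms by (intro divide_nonpos_nonneg) auto
  thus ?thesis by linarith
qed

text \<open>With t = q and L = ln q, about \<delta> L / l scales of \<open>n\<close> contribute
  order x / (q L) each. The resulting main term is compared with the error
  \<open>\<kappa> * F * H\<close>, also of order x / q; all constants depend on \<epsilon>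
  alone.\<close>

lemma good_modulus_moebius_count_ge:
  fixes \<epsilon> :: real
  assumes \<epsilon>: "0 < \<epsilon>" "\<epsilon> \<le> 1"
  shows "\<exists>(b::nat) \<kappa> \<eta> c Q1. 2 \<le> b \<and> 0 < \<kappa> \<and> 0 < \<eta> \<and> \<eta> \<le> 1 / 8 \<and> 0 < c \<and>
    (\<forall>Q\<ge>Q1. \<forall>q. prime q \<and> Q powr (1/2) \<le> real q \<and> real q \<le> Q \<and>
        \<not> bad_modulus (primes_in (Q powr \<eta>) ((Q powr \<eta>)\<^sup>2)) b \<kappa> q \<longrightarrow>
        (\<forall>x\<ge>real q powr (2 + \<epsilon>). \<forall>a\<in>totatives q. \<forall>s\<in>{1, -1}. c * (x / real q) \<le> real (moebius_count s x q a)))"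
proof -
  \<comment> \<open>Budget of exponents: N = q^(1 + 2\<delta>) and the scales reach q^(1 +
    3\<delta>), which leaves at least q^(2 + 8\<delta> - 1 - 3\<delta>) = q^(1 + 5\<delta>) for
    \<open>r\<close>, more than N^(1 + \<delta>).\<close>
  define \<delta> where "\<delta> = \<epsilon> / 8"
  \<comment> \<open>As Q \<le> q^2, \<open>z\<close> is at most q^(2\<eta>), so D^4 is at most
    q^(8\<eta>) = q^\<delta>, and b z^2 is at most q^(\<delta>/2 + 4\<eta>) = q^\<delta>.\<close>
  define \<eta> where "\<eta> = \<delta> / 8"
  have \<delta>: "0 < \<delta>" "\<delta> \<le> 1 / 8" using \<epsilon> by (simp_all add: \<delta>_def)
  have \<eta>: "0 < \<eta>" "\<eta> \<le> 1 / 64" using \<delta> by (simp_all add: \<eta>_def)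
  obtain b :: nat where b: "2 \<le> b"
    "\<And>Y. real b \<le> Y \<Longrightarrow> Y / real b \<le> (\<Sum>p\<in>primes_in (Y / real b) Y. ln (real p))"
    using chebyshev_interval by blast
  obtain c1 N1 :: real where c1: "0 < c1" "1 \<le> N1"
    "\<And>N X. N1 \<le> N \<Longrightarrow> N powr (1 + \<delta>) \<le> X \<Longrightarrow> 
        c1 * X / ln N \<le> real (card {r. X / real b < real r \<and> real r \<le> X \<and> rough N r \<and> squarefree r})"
  proof (rule card_rough_squarefree_ge[OF b, of \<delta>])
  qed (use \<delta> in auto)
  obtain z0 :: real where z0: "1 < z0" "\<And>z. z0 \<le> z \<Longrightarrow> 1 / 4 \<le> (\<Sum>p\<in>primes_in z (z\<^sup>2). 1 / real p)"
    using sum_inverse_primes_in_bounds by meson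
  define l where "l = ln (real b)"
  have l: "0 < l" using b by (simp add: l_def)
  \<comment> \<open>With \<eta> K \<ge> 3 the power z^(K + 1) exceeds N z^2, so \<open>K\<close>
    bounds the multiplicity of a product.\<close>
  define K where "K = nat \<lceil>3 / \<eta>\<rceil>"
  have K: "3 \<le> \<eta> * real K" "0 < K"
  proof -
    have "3 / \<eta> \<le> real K" unfolding K_def by (rule real_nat_ceiling_ge)
    thus "3 \<le> \<eta> * real K" using \<eta> by (simp add: field_simps)
    thus "0 < K" by (auto intro: Nat.gr0I)
  qed
  define A where "A = 2 / l + 1"
  define A3 where "A3 = 2 / \<eta> + 1"
  have A: "0 < A" "0 < A3" using l \<eta> by (simp_all add: A_def A3_def add_pos_pos)
  \<comment> \<open>Main term: at least \<delta> L / (2 l) scales, 1 / 108 for the density of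
    \<open>n\<close>, 1 / (4 b) for the primes and c1 x / (2 L) for \<open>r\<close>; here 1728 = 2
    * 108 * 4 * 2.\<close>
  define c2 where "c2 = \<delta> * c1 / (1728 * real b * l)"
  have c2: "0 < c2" using \<delta> c1 b l by (simp add: c2_def)
  \<comment> \<open>Since F H = 2 A A3 x / q, each of the two pairings loses only c2 / 4 times x /
    q, together half of the main term.\<close>
  define \<kappa> where "\<kappa> = c2 / (8 * A * A3)"
  have \<kappa>: "0 < \<kappa>" using c2 A by (simp add: \<kappa>_def)
  \<comment> \<open>Half of the main term, divided by the multiplicity 2 K of both pairings, is 2 c
    x / q; one half of this is reserved for \<open>bad_values\<close>.\<close>
  define c where "c = c2 / (8 * real K)"
  have c: "0 < c" using c2 K by (simp add: c_def)
  have "\<forall>\<^sub>F t in at_top. (36 \<le> t \<and> N1 \<le> t \<and> 1 \<le> ln t \<and> z0 \<le> t powr \<eta>) \<and>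
      (real b \<le> t powr (\<delta> / 2) \<and> ln t \<le> t powr (4 * \<delta>) \<and> 2 * l / \<delta> \<le> ln t \<and> 2 / t powr \<eta> + 1 / t powr (1/2) \<le> c)"
  proof (intro eventually_conj)
    show "\<forall>\<^sub>F t::real in at_top. 36 \<le> t" "\<forall>\<^sub>F t::real in at_top. N1 \<le> t" by (rule eventually_ge_at_top)+
    have "filterlim (\<lambda>t::real. ln t) at_top at_top" by real_asymp
    thus "\<forall>\<^sub>F t::real in at_top. 1 \<le> ln t" "\<forall>\<^sub>F t::real in at_top. 2 * l / \<delta> \<le> ln t" by (simp_all add: filterlim_at_top)
    have "filterlim (\<lambda>t::real. t powr \<eta>) at_top at_top" using \<eta> by real_asymp
    thus "\<forall>\<^sub>F t in at_top. z0 \<le> t powr \<eta>" by (simp add: filterlim_at_top)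
    have "filterlim (\<lambda>t::real. t powr (\<delta> / 2)) at_top at_top" using \<delta> by real_asymp
    thus "\<forall>\<^sub>F t in at_top. real b \<le> t powr (\<delta> / 2)" by (simp add: filterlim_at_top)
    show "\<forall>\<^sub>F t in at_top. ln t \<le> t powr (4 * \<delta>)" using \<delta> by real_asymp
    have "((\<lambda>t::real. 2 / t powr \<eta> + 1 / t powr (1/2)) \<longlongrightarrow> 0) at_top" using \<eta> by real_asymp
    from order_tendstoD(2)[OF this c] show "\<forall>\<^sub>F t in at_top. 2 / t powr \<eta> + 1 / t powr (1/2) \<le> c"
      by eventually_elim simp
  qed
  then obtain t0 where t0: "\<And>t. t0 \<le> t \<Longrightarrow> (36 \<le> t \<and> N1 \<le> t \<and> 1 \<le> ln t \<and> z0 \<le> t powr \<eta>) \<and>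
      (real b \<le> t powr (\<delta> / 2) \<and> ln t \<le> t powr (4 * \<delta>) \<and> 2 * l / \<delta> \<le> ln t \<and> 2 / t powr \<eta> + 1 / t powr (1/2) \<le> c)"
    unfolding eventually_at_top_linorder by blast
  \<comment> \<open>The square, because q is only known to be at least the square root of
    \<open>Q\<close>.\<close>
  define Q1 where "Q1 = (max 1 t0)\<^sup>2"
  have main: "c * (x / real q) \<le> real (moebius_count s x q a)"
    if Q: "Q1 \<le> Q" and q: "prime q" "Q powr (1/2) \<le> real q" "real q \<le> Q"
      and good: "\<not> bad_modulus (primes_in (Q powr \<eta>) ((Q powr \<eta>)\<^sup>2)) b \<kappa> q"
      and x: "real q powr (2 + \<epsilon>) \<le> x" and a: "a \<in> totatives q" and s: "s = 1 \<or> s = -1" for Q q x a s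
  proof -
    define t where "t = real q"
    define L where "L = ln t"
    define z where "z = Q powr \<eta>"
    define P where "P = primes_in z (z\<^sup>2)"
    have Q1: "1 \<le> Q" using Q by (simp add: Q1_def) (smt (verit) one_le_power max.cobounded1)
    have sq: "sqrt Q \<le> t" using q(2) Q1 by (simp add: powr_half_sqrt t_def)
    have "max 1 t0 \<le> sqrt Q" using Q by (intro real_le_rsqrt) (simp add: Q1_def)
    hence "t0 \<le> t" using sq by linarith
    note big = t0[OF this]
    have t: "36 \<le> t" "N1 \<le> t" "1 \<le> L" "z0 \<le> t powr \<eta>" "real b \<le> t powr (\<delta> / 2)" "L \<le> t powr (4 * \<delta>)"
      "2 * l / \<delta> \<le> L" "2 / t powr \<eta> + 1 / t powr (1/2) \<le> c"
      using big by (auto simp: L_def)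
    have t0': "0 < t" "1 < t" using t by auto
    have tL: "t powr u = exp (u * L)" for u using t0' by (simp add: powr_def L_def)
    have pm: "u \<le> v \<Longrightarrow> t powr u \<le> t powr v" for u v using t0' by (intro powr_mono) auto
    have pa: "t powr u * t powr v = t powr (u + v)" for u v by (simp add: powr_add)
    have zl: "t powr \<eta> \<le> z" unfolding z_def using q(3) \<eta> t0' by (intro powr_mono2) (auto simp: t_def)
    have zu: "z \<le> t powr (2 * \<eta>)"
    proof -
      have "Q \<le> t\<^sup>2" using sq Q1 real_sqrt_le_iff[of Q "t\<^sup>2"] t0' by simp
      also have "t\<^sup>2 = t powr 2" using t0' by simp
      finally have "z \<le> (t powr 2) powr \<eta>" unfolding z_def using Q1 \<eta> by (intro powr_mono2) auto
      thus ?thesis by (simp add: powr_powr)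
    qed
    have z1: "1 < z" using z0(1) t(4) zl by linarith
    have z2: "z\<^sup>2 \<le> t powr (4 * \<eta>)"
    proof -
      have "z\<^sup>2 \<le> (t powr (2 * \<eta>))\<^sup>2" using zu z1 by (intro power_mono) auto
      thus ?thesis using t0' by (simp add: powr_power)
    qed
    define N where "N = t powr (1 + 2 * \<delta>)"
    have tN: "t < N" 
    proof -
      have "t powr 1 < N" unfolding N_def using t0' \<delta> by (intro powr_less_mono) auto
      thus ?thesis using t0' by simp
    qed
    have z2t: "z\<^sup>2 \<le> t powr (1/2)" using z2 pm[of "4 * \<eta>" "1/2"] \<eta> by linarith
    have th: "t powr (1/2) < t"
    proof -
      have "t powr (1/2) < t powr 1" using t0' by (intro powr_less_mono) auto
      thus ?thesis using t0' by simp
    qed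
    have bz: "real b * z\<^sup>2 \<le> t powr \<delta>"
    proof -
      have "real b * z\<^sup>2 \<le> t powr (\<delta> / 2) * t powr (4 * \<eta>)" using t(5) z2 by (intro mult_mono) auto
      also have "\<dots> = t powr \<delta>" unfolding pa by (rule arg_cong[where f = "\<lambda>u. t powr u"]) (simp add: \<eta>_def field_simps)
      finally show ?thesis .
    qed
    \<comment> \<open>The scales of \<open>n\<close> from q^(1 + \<delta>) to q^(1 + 2\<delta>):
      long enough to cover every class, and proportional to L in number.\<close>
    define I where "I = {i. exp ((1 + \<delta>) * L) \<le> real b ^ i \<and> real b ^ i \<le> exp ((1 + 2 * \<delta>) * L)}"
    define m where "m = nat \<lfloor>(1 + 3 * \<delta>) * L / l\<rfloor> + 1"
    have pw: "real b ^ j = exp (real j * l)" for j using b by (simp add: l_def exp_of_nat_mult)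
    have m_iff: "j < m \<longleftrightarrow> real b ^ j \<le> t powr (1 + 3 * \<delta>)" for j
    proof -
      have "0 \<le> (1 + 3 * \<delta>) * L / l" using \<delta> t l by simp
      hence "j < m \<longleftrightarrow> real j \<le> (1 + 3 * \<delta>) * L / l"
        unfolding m_def by (simp add: less_Suc_eq_le le_nat_iff le_floor_iff)
      also have "\<dots> \<longleftrightarrow> real b ^ j \<le> t powr (1 + 3 * \<delta>)" using l by (simp add: pw tL pos_le_divide_eq)
      finally show ?thesis .
    qed
    have mA: "real m \<le> A * L"
    proof -
      have "0 \<le> (1 + 3 * \<delta>) * L / l" using \<delta> t l by simp
      hence "real m \<le> (1 + 3 * \<delta>) * L / l + 1" by (simp add: m_def)
      also have "\<dots> \<le> 2 * L / l + L" using \<delta> t l by (intro add_mono divide_right_mono mult_right_mono) auto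
      also have "\<dots> = A * L" by (simp add: A_def algebra_simps)
      finally show ?thesis .
    qed
    have Im: "I \<subseteq> {..<m}"
    proof
      fix i assume "i \<in> I"
      hence "real b ^ i \<le> t powr (1 + 2 * \<delta>)" by (simp add: I_def tL)
      also have "\<dots> \<le> t powr (1 + 3 * \<delta>)" using \<delta> by (intro pm) auto
      finally show "i \<in> {..<m}" using m_iff by simp
    qed
    hence fI: "finite I" and cI: "card I \<le> m" using finite_subset card_mono[OF _ Im] by auto
    have x0: "0 < x" using x t0' by (metis less_le_trans powr_gt_zero t_def less_irrefl)
    interpret tri: trilinear b q a m N z x I
    proof
      show "2 \<le> b" by (rule b)
      show "prime q" by (rule q)
      show "coprime a q" using a by (simp add: totatives_def)
      show "real q < N" using tN by (simp add: t_def)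
      show "z\<^sup>2 \<le> N" using z2t th tN by linarith
      show "1 < z" by (rule z1)
      show "z\<^sup>2 < real q" using z2t th by (simp add: t_def)
      show "0 < x" by (rule x0)
      show "finite I" by (rule fI)
      show "real b ^ i \<le> N" if "i \<in> I" for i using that by (simp add: I_def N_def tL)
      show "real q \<le> real b ^ i" if "i \<in> I" for i
      proof -
        have "t powr 1 \<le> t powr (1 + \<delta>)" using \<delta> by (intro pm) auto
        also have "\<dots> \<le> real b ^ i" using that by (simp add: I_def tL)
        finally show ?thesis using t0' by (simp add: t_def)
      qed
      show "i + log_scale b p < m" if ip: "i \<in> I" "p \<in> primes_in z (z\<^sup>2)" for i p
      proof -
        have p: "1 \<le> p" "real p \<le> z\<^sup>2" using ip by (auto simp: primes_in_def prime_gt_0_nat Suc_le_eq)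
        have "real b ^ (i + log_scale b p) = real b ^ i * real b ^ log_scale b p" by (rule power_add)
        also have "\<dots> \<le> t powr (1 + 2 * \<delta>) * (real b * real p)"
          using ip log_scale_bounds(2)[OF b(1) p(1)] by (intro mult_mono) (auto simp: I_def tL)
        also have "\<dots> \<le> t powr (1 + 2 * \<delta>) * t powr \<delta>"
          using p bz by (intro mult_left_mono order_trans[OF mult_left_mono bz]) auto
        also have "\<dots> = t powr (1 + 3 * \<delta>)" unfolding pa by (rule arg_cong[where f = "\<lambda>u. t powr u"]) (simp add: field_simps)
        finally show ?thesis using m_iff by simp
      qed
    qed
    have q36: "36 \<le> q" using t(1) by (simp add: t_def)
    have Pw: "1 / (4 * real b) \<le> (\<Sum>p\<in>P. 1 / real b ^ log_scale b p)"
    proof -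
      have "1 / (4 * real b) = (1 / real b) * (1 / 4)" by simp
      also have "\<dots> \<le> (1 / real b) * (\<Sum>p\<in>P. 1 / real p)"
        unfolding P_def using z0(2)[of z] t(4) zl by (intro mult_left_mono) auto
      also have "\<dots> = (\<Sum>p\<in>P. 1 / (real b * real p))" by (simp add: sum_distrib_left)
      also have "\<dots> \<le> (\<Sum>p\<in>P. 1 / real b ^ log_scale b p)"
      proof (rule sum_mono)
        fix p assume "p \<in> P"
        hence "1 \<le> p" by (auto simp: P_def primes_in_def prime_gt_0_nat Suc_le_eq)
        thus "1 / (real b * real p) \<le> 1 / real b ^ log_scale b p"
          using log_scale_bounds(2)[OF b(1), of p] b(1) by (intro divide_left_mono) auto
      qed
      finally show ?thesis .
    qed
    have Pne: "primes_in z (z\<^sup>2) \<noteq> {}"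
    proof
      assume "primes_in z (z\<^sup>2) = {}"
      hence "1 / (4 * real b) \<le> 0" using Pw by (simp add: P_def)
      thus False using b(1) by simp
    qed
    have xj: "t powr (1 + 5 * \<delta>) \<le> x / real b ^ j" if "j < m" for j
    proof -
      have "t powr (1 + 5 * \<delta>) * real b ^ j \<le> t powr (1 + 5 * \<delta>) * t powr (1 + 3 * \<delta>)"
        using that m_iff by (intro mult_left_mono) auto
      also have "\<dots> = t powr (2 + \<epsilon>)" unfolding pa by (rule arg_cong[where f = "\<lambda>u. t powr u"]) (simp add: \<delta>_def field_simps)
      also have "\<dots> \<le> x" using x by (simp add: t_def)
      finally show ?thesis using tri.bpos by (simp add: pos_le_divide_eq)
    qed
    define E where "E = c1 * x / (2 * L)"
    have E: "E \<le> (\<Sum>h\<in>totatives q. tri.rough_fun 1 (j, h)) + (\<Sum>h\<in>totatives q. tri.rough_fun (-1) (j, h))" if j: "j < m" for j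
    proof -
      have lnN: "ln N = (1 + 2 * \<delta>) * L" using t0' by (simp add: N_def ln_powr L_def)
      have "N powr (1 + \<delta>) = t powr ((1 + 2 * \<delta>) * (1 + \<delta>))" by (simp add: N_def powr_powr)
      also have "\<dots> \<le> t powr (1 + 5 * \<delta>)"
      proof (rule pm)
        have "\<delta> * \<delta> \<le> \<delta> * 1" using \<delta> by (intro mult_left_mono) auto
        thus "(1 + 2 * \<delta>) * (1 + \<delta>) \<le> 1 + 5 * \<delta>" by (simp add: algebra_simps)
      qed
      also have "\<dots> \<le> x / real b ^ j" using j by (rule xj)
      finally have "c1 * (x / real b ^ j) / ln N \<le> real (card {r. x / real b ^ j / real b < real r \<and> real r \<le> x / real b ^ j \<and> rough N r \<and> squarefree r})"
        using t(2) tN by (intro c1(3)) auto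
      hence "real b ^ j * (c1 * (x / real b ^ j) / ln N) \<le> (\<Sum>h\<in>totatives q. tri.rough_fun 1 (j, h)) + (\<Sum>h\<in>totatives q. tri.rough_fun (-1) (j, h))"
        by (rule tri.sum_rough_fun_ge)
      moreover have "real b ^ j * (c1 * (x / real b ^ j) / ln N) = c1 * x / ln N" using tri.bpos by simp
      moreover have "E \<le> c1 * x / ln N"
        unfolding E_def lnN using c1(1) x0 \<delta> t(3) by (intro divide_left_mono mult_right_mono mult_pos_pos) auto
      ultimately show ?thesis by linarith
    qed
    define D where "D = nat \<lfloor>z\<rfloor>"
    have D: "1 \<le> D" "real D \<le> z" "z < real D + 1" using z1 by (auto simp: D_def le_nat_floor)
    have zz: "z \<le> z\<^sup>2" using z1 by (simp add: power2_eq_square)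
    define M where "M = A3 * (x / (t * L))"
    have M: "tri.rough_fun s (j, h) \<le> M" if j: "j < m" for s j h
    proof -
      have DN: "real D \<le> N" "D < q" using D zz z2t th tN by (auto simp: t_def)
      have "tri.rough_fun s (j, h) \<le> x / (real q * selberg_G D) + real b ^ j * real D ^ 4"
        using D(1) DN by (rule tri.rough_fun_le)
      also have "x / (real q * selberg_G D) \<le> x / (t * (\<eta> * L / 2))"
      proof -
        have "ln (t powr \<eta>) \<le> ln z" using zl t0' by (intro ln_mono) auto
        also have "\<dots> \<le> ln (real D + 1)" using D z1 by (intro ln_mono) auto
        finally have "\<eta> * L / 2 \<le> selberg_G D" using selberg_G_ge[of D] t0' by (simp add: ln_powr L_def)
        moreover have "0 < \<eta> * L / 2" using \<eta> t(3) by simp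
        ultimately show ?thesis unfolding t_def[symmetric] using x0 t0' by (intro divide_left_mono mult_left_mono mult_pos_pos) auto
      qed
      also have "real b ^ j * real D ^ 4 \<le> x / (t * L)"
      proof -
        have "real D ^ 4 \<le> (t powr (2 * \<eta>)) ^ 4" using D zu by (intro power_mono) auto
        also have "\<dots> = t powr \<delta>" using t0' by (simp add: powr_power \<eta>_def)
        finally have "real b ^ j * real D ^ 4 \<le> t powr (1 + 3 * \<delta>) * t powr \<delta>"
          using j m_iff by (intro mult_mono) auto
        hence "real b ^ j * real D ^ 4 * (t * L) \<le> t powr (1 + 3 * \<delta>) * t powr \<delta> * (t powr 1 * t powr (4 * \<delta>))"
          using t(3,6) t0' by (intro mult_mono[OF _ mult_mono]) auto
        also have "\<dots> = t powr (2 + \<epsilon>)" unfolding pa by (rule arg_cong[where f = "\<lambda>u. t powr u"]) (simp add: \<delta>_def field_simps)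
        also have "\<dots> \<le> x" using x by (simp add: t_def)
        finally show ?thesis using t0' t(3) by (simp add: pos_le_divide_eq)
      qed
      finally show ?thesis using \<eta> by (simp add: M_def A3_def algebra_simps)
    qed
    \<comment> \<open>The two square roots multiply to A L, which cancels the 1 / L in
      \<open>M\<close>; this is what permits a constant \<kappa>.\<close>
    define F where "F = 2 * sqrt (A * L / t)"
    define H where "H = sqrt (A * L * t) * M"
    have AL: "0 \<le> A * L" using A t(3) by simp
    have F: "(\<Sum>y\<in>grid m q. (tri.smooth_fun s y)\<^sup>2) \<le> F\<^sup>2" for s
    proof -
      have "(\<Sum>y\<in>grid m q. (tri.smooth_fun s y)\<^sup>2) \<le> 4 * real (card I) / real q" by (rule tri.smooth_fun_norm)
      also have "\<dots> \<le> 4 * (A * L) / t" unfolding t_def[symmetric]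
        using cI mA t0' by (intro divide_right_mono) auto
      also have "\<dots> = F\<^sup>2" using AL t0' by (simp add: F_def power_mult_distrib)
      finally show ?thesis .
    qed
    have H: "(\<Sum>y\<in>grid m q. (tri.rough_fun s y)\<^sup>2) \<le> H\<^sup>2" for s
    proof -
      have "(\<Sum>y\<in>grid m q. (tri.rough_fun s y)\<^sup>2) \<le> real m * real q * M\<^sup>2" using M by (intro tri.rough_fun_norm)
      also have "\<dots> \<le> A * L * t * M\<^sup>2" unfolding t_def using mA by (intro mult_right_mono) auto
      also have "\<dots> = H\<^sup>2" using AL t0' by (simp add: H_def power_mult_distrib)
      finally show ?thesis .
    qed
    have M0: "0 \<le> M" using A x0 t0' t(3) by (simp add: M_def)
    have FH: "\<kappa> * F * H = c2 / 4 * (x / t)"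
    proof -
      have "sqrt (A * L / t) * sqrt (A * L * t) = A * L"
      proof -
        have "A * L / t * (A * L * t) = (A * L)\<^sup>2" using t0' by (simp add: power2_eq_square)
        thus ?thesis by (simp only: real_sqrt_mult[symmetric] real_sqrt_abs abs_of_nonneg[OF AL])
      qed
      hence "F * H = 2 * (A * L) * M" by (simp add: F_def H_def)
      also have "\<dots> = 2 * A * A3 * (x / t)" using t(3) t0' by (simp add: M_def)
      finally have "\<kappa> * F * H = \<kappa> * (2 * A * A3 * (x / t))" by (simp add: mult.assoc)
      also have "\<dots> = c2 / 4 * (x / t)" using A by (simp add: \<kappa>_def field_simps)
      finally show ?thesis .
    qed
    have pairing: "(\<Sum>y\<in>grid m q. tri.smooth_fun s y * prime_op (primes_in z (z\<^sup>2)) b m q (scale_mean q (tri.rough_fun u)) y)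
        - c2 / 4 * (x / t) \<le> real (card (tri.triples s u))" for s u
      using not_bad_modulus_pairing[OF good[folded z_def] _ _ tri.q1 F[of s] _ H[of u], unfolded FH] \<kappa> A AL t0' M0
      unfolding tri.pairing_eq_card[OF Pne] by (simp add: F_def H_def m_def)
    have "real (card I) * (1 / 108 * ((\<Sum>p\<in>P. 1 / real b ^ log_scale b p) * (E / t))) \<le>
       real (card (tri.triples (- s) 1)) + real (card (tri.triples s (-1))) + c2 / 2 * (x / t)"
    proof -
      have "- s = 1 \<or> - s = -1" "0 \<le> E" using s c1 x0 t(3) by (auto simp: E_def)
      from tri.main_term_ge[OF Pne q36 this E] pairing[of "- s" 1] pairing[of s "-1"]
      show ?thesis by (simp add: P_def t_def)
    qed
    moreover have "c2 * (x / t) \<le> real (card I) * (1 / 108 * ((\<Sum>p\<in>P. 1 / real b ^ log_scale b p) * (E / t)))"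
    proof -
      have "((1 + 2 * \<delta>) * L - (1 + \<delta>) * L) / l - 1 \<le> real (card I)"
        unfolding I_def l_def using b(1) \<delta> t(3) by (intro card_scales_ge) auto
      moreover have "((1 + 2 * \<delta>) * L - (1 + \<delta>) * L) / l = \<delta> * L / l" by (simp add: algebra_simps)
      moreover have "1 \<le> \<delta> * L / (2 * l)" using t(7) \<delta> l by (simp add: field_simps)
      moreover have "\<delta> * L / l = 2 * (\<delta> * L / (2 * l))" by simp
      ultimately have "\<delta> * L / (2 * l) \<le> real (card I)" by linarith
      hence "\<delta> * L / (2 * l) * (1 / 108 * (1 / (4 * real b) * (E / t))) \<le>
         real (card I) * (1 / 108 * ((\<Sum>p\<in>P. 1 / real b ^ log_scale b p) * (E / t)))"
        using Pw c1(1) x0 t(3) t0' \<delta> l b(1)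
        by (intro mult_mono mult_nonneg_nonneg) (auto simp: E_def intro: sum_nonneg)
      moreover have "\<delta> * L / (2 * l) * (1 / 108 * (1 / (4 * real b) * (E / t))) = c2 * (x / t)"
        using t(3) l tri.bpos t0' by (simp add: E_def c2_def field_simps)
      ultimately show ?thesis by simp
    qed
    ultimately have low: "c2 / 2 * (x / t) \<le> real (card (tri.triples (- s) 1)) + real (card (tri.triples s (-1)))" by simp
    have NK: "N * z\<^sup>2 < z ^ Suc K"
    proof -
      have "N * z\<^sup>2 \<le> t powr (1 + 2 * \<delta>) * t powr (1/2)" unfolding N_def using z2t by (intro mult_left_mono) auto
      also have "\<dots> = t powr (3/2 + 2 * \<delta>)" unfolding pa by (rule arg_cong[where f = "\<lambda>u. t powr u"]) (simp add: field_simps)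
      also have "\<dots> < t powr (\<eta> * real (Suc K))"
        using t0' K \<eta> \<delta> by (intro powr_less_mono) (auto simp: algebra_simps)
      also have "\<dots> = (t powr \<eta>) ^ Suc K" using t0' by (subst powr_power) (auto simp: mult.commute)
      also have "\<dots> \<le> z ^ Suc K" using zl by (intro power_mono) auto
      finally show ?thesis .
    qed
    define g where "g = real (moebius_count s x q a)"
    have g: "card (tri.good_values s) = moebius_count s x q a"
      by (simp add: tri.good_values_def moebius_count_def)
    have "card (tri.triples (- s) 1) \<le> K * (card (tri.good_values s) + card tri.bad_values)"
      "card (tri.triples s (-1)) \<le> K * (card (tri.good_values s) + card tri.bad_values)"
      using tri.card_triples_le[OF NK, of "- s" 1] tri.card_triples_le[OF NK, of s "-1"] by simp_all
    hence "card (tri.triples (- s) 1) + card (tri.triples s (-1)) \<le> 2 * K * (moebius_count s x q a + card tri.bad_values)"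
      by (simp add: g)
    hence "real (card (tri.triples (- s) 1) + card (tri.triples s (-1))) \<le> real (2 * K * (moebius_count s x q a + card tri.bad_values))"
      by (simp only: of_nat_le_iff)
    hence "c2 / 2 * (x / t) \<le> 2 * real K * (g + real (card tri.bad_values))" using low by (simp add: g_def)
    moreover have "2 * real K * (2 * c * (x / t)) = c2 / 2 * (x / t)" using K(2) by (simp add: c_def)
    ultimately have "2 * real K * (2 * c * (x / t)) \<le> 2 * real K * (g + real (card tri.bad_values))" by linarith
    hence "2 * c * (x / t) \<le> g + real (card tri.bad_values)" using K(2) by (simp only: mult_le_cancel_left_pos)
    moreover have "real (card tri.bad_values) \<le> c * (x / t)"
    proof -
      have "real (card tri.bad_values) \<le> 2 * x / (t * z) + z\<^sup>2" unfolding t_def by (rule tri.card_bad_values_le)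
      also have "2 * x / (t * z) \<le> 2 * x / (t * t powr \<eta>)"
        using x0 t0' zl z1 by (intro divide_left_mono mult_left_mono mult_pos_pos) auto
      also have "z\<^sup>2 \<le> (x / t) * (1 / t powr (1/2))"
      proof -
        have "t powr (1/2) * t powr (1/2) * t powr 1 = t powr 2" by (simp only: pa) simp
        also have "\<dots> \<le> t powr (2 + \<epsilon>)" using \<epsilon> by (intro pm) auto
        also have "\<dots> \<le> x" using x by (simp add: t_def)
        finally have "t powr (1/2) * t powr (1/2) * t \<le> x" using t0' by simp
        hence "t powr (1/2) \<le> (x / t) * (1 / t powr (1/2))" using t0' by (simp add: pos_le_divide_eq mult_ac)
        thus ?thesis using z2t by linarith
      qed
      finally have "real (card tri.bad_values) \<le> (2 / t powr \<eta> + 1 / t powr (1/2)) * (x / t)"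
        by (simp add: add_divide_distrib algebra_simps)
      also have "\<dots> \<le> c * (x / t)" using t(8) x0 t0' by (intro mult_right_mono) auto
      finally show ?thesis .
    qed
    ultimately show ?thesis by (simp add: g_def t_def)
  qed
  show ?thesis
    by (rule exI[of _ b], rule exI[of _ \<kappa>], rule exI[of _ \<eta>], rule exI[of _ c], rule exI[of _ Q1])
      (use b \<kappa> \<eta> c main in auto)
qed

lemma min_moebius_count_geI:
  assumes "prime q" "\<And>a. a \<in> totatives q \<Longrightarrow> y \<le> real (moebius_count s x q a)"
  shows "y \<le> real (min_moebius_count s x q)"
proof -
  have "totatives q \<noteq> {}" using assms(1) by (simp add: prime_gt_0_nat totatives_eq_empty_iff)
  hence "min_moebius_count s x q \<in> moebius_count s x q ` totatives q"
    unfolding min_moebius_count_def by (intro Min_in) auto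
  thus ?thesis using assms(2) by auto
qed

theorem proposition2p3:
  fixes \<epsilon> :: real
  assumes "\<epsilon> > 0"
  shows "(\<exists>c::real. c > 0 \<and> (\<exists>C::real. \<forall>Q::real. Q \<ge> 2 \<longrightarrow>
            real (card (exceptional_primes (-1) \<epsilon> c Q)) \<le> C)) \<and>
         (\<exists>c::real. c > 0 \<and> (\<exists>C::real. \<forall>Q::real. Q \<ge> 2 \<longrightarrow>
            real (card (exceptional_primes 1 \<epsilon> c Q)) \<le> C))"
proof -
  \<comment> \<open>A larger \<epsilon> only shrinks the range of \<open>x\<close>, so the case of
    \<epsilon> at most 1 carries over.\<close>
  define \<epsilon>' where "\<epsilon>' = min \<epsilon> 1"
  have \<epsilon>': "0 < \<epsilon>'" "\<epsilon>' \<le> 1" "\<epsilon>' \<le> \<epsilon>" using assms by (auto simp: \<epsilon>'_def)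
  from good_modulus_moebius_count_ge[OF \<epsilon>'(1,2)] obtain b :: nat and \<kappa> \<eta> c Q1 where
    b: "2 \<le> b" and \<kappa>: "0 < \<kappa>" and \<eta>: "0 < \<eta>" "\<eta> \<le> 1 / 8" and c: "0 < c" and
    good: "\<forall>Q\<ge>Q1. \<forall>q. prime q \<and> Q powr (1/2) \<le> real q \<and> real q \<le> Q \<and>
        \<not> bad_modulus (primes_in (Q powr \<eta>) ((Q powr \<eta>)\<^sup>2)) b \<kappa> q \<longrightarrow>
        (\<forall>x\<ge>real q powr (2 + \<epsilon>'). \<forall>a\<in>totatives q. \<forall>s\<in>{1, -1}. c * (x / real q) \<le> real (moebius_count s x q a))"
    by (elim exE conjE)
  obtain C Q0 :: real where "1 < Q0" and
    C: "\<And>Q. Q0 \<le> Q \<Longrightarrow> real (card {q. prime q \<and> Q powr (1/2) \<le> real q \<and> real q \<le> Q \<and>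
        bad_modulus (primes_in (Q powr \<eta>) ((Q powr \<eta>)\<^sup>2)) b \<kappa> q}) \<le> C"
    using card_bad_modulus_le[OF b \<kappa> \<eta>] by blast
  define Q2 where "Q2 = max Q0 Q1"
  have "real (card (exceptional_primes s \<epsilon> c Q)) \<le> max C (real (nat \<lfloor>Q2\<rfloor> + 1))" if s: "s \<in> {1, -1}" and Q: "2 \<le> Q" for s Q
  proof (cases "Q2 \<le> Q")
    case True
    define B where "B = {q. prime q \<and> Q powr (1/2) \<le> real q \<and> real q \<le> Q \<and>
        bad_modulus (primes_in (Q powr \<eta>) ((Q powr \<eta>)\<^sup>2)) b \<kappa> q}"
    have "exceptional_primes s \<epsilon> c Q \<subseteq> B"
    proof
      fix q assume q: "q \<in> exceptional_primes s \<epsilon> c Q"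
      hence q': "prime q" "Q powr (1/2) \<le> real q" "real q \<le> Q" by (auto simp: exceptional_primes_def)
      from q obtain x where x: "real q powr (2 + \<epsilon>) \<le> x" "\<not> c * (x / real q) \<le> real (min_moebius_count s x q)"
        by (auto simp: exceptional_primes_def)
      have "real q powr (2 + \<epsilon>') \<le> real q powr (2 + \<epsilon>)"
        using \<epsilon>'(3) prime_ge_1_nat[OF q'(1)] by (intro powr_mono) auto
      hence "real q powr (2 + \<epsilon>') \<le> x" using x by linarith
      moreover have "Q1 \<le> Q" using True by (simp add: Q2_def)
      ultimately have "bad_modulus (primes_in (Q powr \<eta>) ((Q powr \<eta>)\<^sup>2)) b \<kappa> q"
        using good q' s x(2) min_moebius_count_geI[OF q'(1)] by blast
      thus "q \<in> B" using q' by (simp add: B_def)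
    qed
    moreover have "finite B" by (rule finite_subset[of _ "{..nat \<lfloor>Q\<rfloor>}"]) (auto simp: B_def le_nat_floor)
    ultimately have "card (exceptional_primes s \<epsilon> c Q) \<le> card B" by (intro card_mono)
    moreover have "real (card B) \<le> C" unfolding B_def using True by (intro C) (simp add: Q2_def)
    ultimately show ?thesis by linarith
  next
    case False
    \<comment> \<open>For small \<open>Q\<close> all moduli are bounded, and counting every one of
      them is affordable.\<close>
    have "exceptional_primes s \<epsilon> c Q \<subseteq> {..nat \<lfloor>Q2\<rfloor>}"
      using False by (auto simp: exceptional_primes_def intro!: le_nat_floor)
    hence "card (exceptional_primes s \<epsilon> c Q) \<le> card {..nat \<lfloor>Q2\<rfloor>}" by (intro card_mono) auto
    thus ?thesis by simp
  qed
  thus ?thesis using c by blast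
qed

end
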